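(* (1) The categories $\mathcal{C}^{\mathbf{t}}_{\pi=1}$ and $\mathcal{C}^{\mathbf{t}}_{\pi=-1}$ are equivalent. (2) The characters of the integrable $\mathbf{U}|_{\pi=-1}$-module $V(\lambda)_{\pi=-1}$ and the integrable $\mathbf{U}|_{\pi=1}$-module $V(\lambda)_{\pi=1}$ coincide, for each $\lambda\in X^+$.
   Context: Datum. $(I,\cdot)$ is a bar-consistent super Cartan datum of anisotropic type: $I$ is a finite set with a $\mathbb{Z}$-valued symmetric bilinear form $\cdot$ on the free abelian group $\mathbb{Z}[I]$ such that $d_i=\frac{i\cdot i}{2}\in\mathbb{Z}_{>0}$ for all $i\in I$ and $a_{ij}=2\frac{i\cdot j}{i\cdot i}\in\mathbb{Z}_{\le 0}$ for $i\ne j$ (for $i=j$ the same formula gives $a_{ii}=2$); there is a partition $I=I_{\bar 0}\sqcup I_{\bar 1}$ with $I_{\bar1}\neq\emptyset$, with parity $p(i)=0$ for $i\in I_{\bar 0}$ and $p(i)=1$ for $i\in I_{\bar 1}$; $a_{ij}\in 2\mathbb{Z}$ for $i\in I_{\bar 1}$, $j\in I$; and $d_i\equiv p(i)\bmod 2$ for all $i$. Put $b_{ij}=1-a_{ij}$. A super root datum $(Y,X,I,\cdot)$ is given: finitely generated free abelian groups $Y,X$ with a perfect bilinear pairing $\langle\cdot,\cdot\rangle:Y\times X\to\mathbb{Z}$, and embeddings $I\subset X$ ($i\mapsto i'$), $I\subset Y$ ($i\mapsto i$), with linearly independent images, such that $\langle i,j'\rangle=a_{ij}$ for all $i,j\in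 I$. Scalars. $v$ is a formal parameter, $\pi$ an indeterminate with $\pi^2=1$; for a ring $R$, $R^\pi=R[\pi]/(\pi^2-1)$. $\mathbf{t}$ is a square root of $-1$. Put $v_i=v^{d_i}$, $\pi_i=\pi^{d_i}$, $\begin{bmatrix}n\\k\end{bmatrix}_{v,\pi}=\frac{\prod_{l=n-k+1}^n((\pi v)^l-v^{-l})}{\prod_{l=1}^k((\pi v)^l-v^{-l})}$. For an $R^\pi$-module (or algebra) $M$, $M|_{\pi=\pm1}=R_\pm\otimes_{R^\pi}M$, where $R_\pm=R$ with $\pi$ acting as $\pm1$. Covering quantum group. $\mathbf{U}$ is the $\mathbb{Q}(v)^\pi$-algebra with generators $E_i,F_i$ ($i\in I$), $K_\mu,J_\mu$ ($\mu\in Y$) and relations, for $i,j\in I$, $\mu,\nu\in Y$: $J_\mu J_\nu=J_{\mu+\nu}$, $K_\mu K_\nu=K_{\mu+\nu}$, $K_0=J_0=J_\nu^2=1$, $J_\mu K_\nu=K_\nu J_\mu$; $J_\mu E_i=\pi^{\langle\mu,i'\rangle}E_iJ_\mu$, $J_\mu F_i=\pi^{-\langle\mu,i'\rangle}F_iJ_\mu$; $K_\mu E_i=v^{\langle\mu,i'\rangle}E_iK_\mu$, $K_\mu F_i=v^{-\langle\mu,i'\rangle}F_iK_\mu$; $E_iF_j-\pi^{p(i)p(j)}F_jE_i=\delta_{ij}\frac{J_{d_ii}K_{d_ii}-K_{-d_ii}}{\pi_iv_i-v_i^{-1}}$; and for $i\neq j$, $\sum_{k=0}^{b_{ij}}(-1)^k\pi^{\binom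 k2p(i)+kp(i)p(j)}\begin{bmatrix}b_{ij}\\k\end{bmatrix}_{v_i,\pi_i}E_i^{b_{ij}-k}E_jE_i^k=0$, and the same relation with $F$ in place of $E$. Set $\mathbf{U}[\mathbf{t}]=\mathbb{Q}(v,\mathbf{t})^\pi\otimes_{\mathbb{Q}(v)^\pi}\mathbf{U}$. Weight modules. A module $M$ over $\mathbf{U}[\mathbf{t}]|_{\pi=\pm1}$ (over $\mathbb{Q}(v,\mathbf{t})$), or over $\mathbf{U}|_{\pi=\pm1}$ (over $\mathbb{Q}(v)$), is a weight module if $M=\bigoplus_{\lambda\in X}M_\lambda$ with $M_\lambda=\{m\in M\mid K_\nu m=v^{\langle\nu,\lambda\rangle}m,\ J_\nu m=\pi^{\langle\nu,\lambda\rangle}m\ \forall\nu\in Y\}$, where $\pi$ is read as $\pm1$ respectively. $\mathcal{C}^{\mathbf{t}}_{\pi=\pm1}$ is the category of weight modules of $\mathbf{U}[\mathbf{t}]|_{\pi=\pm1}$ over $\mathbb{Q}(v,\mathbf{t})$. The character of a weight module records the dimensions of its weight spaces $M_\mu$, $\mu\in X$. Highest weight modules. $X^+=\{\lambda\in X\mid\langle i,\lambda\rangle\in\mathbb{Z}_{\ge0}\ \forall i\in I\}$. For $\lambda\in X^+$, $V(\lambda)_{\pi=\pm1}$ is the simple highest weight (weight) module of $\mathbf{U}|_{\pi=\pm1}$ over $\mathbb{Q}(v)$ of highest weight $\lambda$, i.e. the simple weight module generated by a nonzero vector of weight $\lambda$ annihilated by all $E_i$; for $\lambda\in X^+$ it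 is integrable, and as $\lambda$ ranges over $X^+$ these form a complete list of pairwise non-isomorphic simple integrable modules. *)

theory Defs
  imports
    "HOL-Algebra.QuotRing"
    "HOL-Algebra.Module"
    "HOL-Library.Poly_Mapping"
    "HOL-Library.Extended_Nat"
    "HOL-Library.FuncSet"
    "HOL-Computational_Algebra.Polynomial"
    "HOL-Computational_Algebra.Fraction_Field"
begin

section \<open>Scalars\<close>

text \<open>\<open>R[\<pi>]/(\<pi>\<^sup>2 - 1)\<close>; the element \<open>Cov a b\<close> is \<open>a + b \<pi>\<close>.\<close>

datatype 'a cov = Cov (cov0: 'a) (cov1: 'a)

lemma cov_eq_iff: "x = y \<longleftrightarrow> cov0 x = cov0 y \<and> cov1 x = cov1 y"
  by (cases x; cases y) simp

instantiation cov :: (comm_ring_1) comm_ring_1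
begin
definition "0 = Cov 0 0"
definition "1 = Cov 1 0"
definition "x + y = Cov (cov0 x + cov0 y) (cov1 x + cov1 y)"
definition "- x = Cov (- cov0 x) (- cov1 x)"
definition "x - y = Cov (cov0 x - cov0 y) (cov1 x - cov1 y)"
definition "x * y = Cov (cov0 x * cov0 y + cov1 x * cov1 y) (cov0 x * cov1 y + cov1 x * cov0 y)"
instance
  by standard
    (auto simp: cov_eq_iff zero_cov_def one_cov_def plus_cov_def uminus_cov_def minus_cov_def
      times_cov_def algebra_simps)
end

text \<open>\<open>R[\<pi>]/(\<pi>\<^sup>2 - 1)\<close> has zero divisors; the \<open>inverse\<close> below is the inverse of \<open>a + b \<pi>\<close> whenever
  that element is a unit, i.e. \<open>a\<^sup>2 \<noteq> b\<^sup>2\<close>, and is only used for units.\<close>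

instantiation cov :: (field) inverse
begin
definition "inverse x =
  Cov (cov0 x / ((cov0 x)\<^sup>2 - (cov1 x)\<^sup>2)) (- cov1 x / ((cov0 x)\<^sup>2 - (cov1 x)\<^sup>2))"
definition "x div y = x * inverse (y :: 'a cov)"
instance ..
end

lemma cov_right_inverse:
  fixes x :: "'a :: field cov"
  assumes "(cov0 x)\<^sup>2 \<noteq> (cov1 x)\<^sup>2"
  shows "x * inverse x = 1"
proof -
  have "(cov0 x)\<^sup>2 - (cov1 x)\<^sup>2 \<noteq> 0" using assms by simp
  then show ?thesis
    by (simp add: cov_eq_iff times_cov_def inverse_cov_def one_cov_def diff_divide_distrib [symmetric]
        power2_eq_square)
qed

definition cov_pi :: "'a :: comm_ring_1 cov"
  where "cov_pi = Cov 0 1"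

definition cov_spec :: "int \<Rightarrow> 'a :: comm_ring_1 cov \<Rightarrow> 'a"
  where "cov_spec e x = cov0 x + of_int e * cov1 x"

text \<open>\<open>k(t)\<close> with \<open>t\<^sup>2 = -1\<close>; the element \<open>Gauss a b\<close> is \<open>a + b t\<close>. It is a field because \<open>-1\<close> is not a
  square in the ordered field \<open>k\<close>.\<close>

datatype 'a gauss = Gauss (gauss0: 'a) (gauss1: 'a)

lemma gauss_eq_iff: "x = y \<longleftrightarrow> gauss0 x = gauss0 y \<and> gauss1 x = gauss1 y"
  by (cases x; cases y) simp

instantiation gauss :: (linordered_field) field
begin
definition "0 = Gauss 0 0"
definition "1 = Gauss 1 0"
definition "x + y = Gauss (gauss0 x + gauss0 y) (gauss1 x + gauss1 y)"
definition "- x = Gauss (- gauss0 x) (- gauss1 x)"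
definition "x - y = Gauss (gauss0 x - gauss0 y) (gauss1 x - gauss1 y)"
definition "x * y = Gauss (gauss0 x * gauss0 y - gauss1 x * gauss1 y)
                          (gauss0 x * gauss1 y + gauss1 x * gauss0 y)"
definition "inverse x =
  Gauss (gauss0 x / ((gauss0 x)\<^sup>2 + (gauss1 x)\<^sup>2)) (- gauss1 x / ((gauss0 x)\<^sup>2 + (gauss1 x)\<^sup>2))"
definition "x div y = x * inverse (y :: 'a gauss)"
instance
proof
  fix x :: "'a gauss"
  assume "x \<noteq> 0"
  then have "(gauss0 x)\<^sup>2 + (gauss1 x)\<^sup>2 \<noteq> 0"
    by (auto simp: gauss_eq_iff zero_gauss_def sum_power2_eq_zero_iff)
  then show "inverse x * x = 1"
    by (simp add: gauss_eq_iff times_gauss_def inverse_gauss_def one_gauss_def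
        add_divide_distrib [symmetric] power2_eq_square)
qed (auto simp: gauss_eq_iff zero_gauss_def one_gauss_def plus_gauss_def uminus_gauss_def
      minus_gauss_def times_gauss_def inverse_gauss_def divide_gauss_def algebra_simps)
end

type_synonym qv = "rat poly fract"
type_synonym qvt = "qv gauss"

definition qv_v :: qv
  where "qv_v = Fract [:0, 1:] 1"

definition qvt_of :: "qv \<Rightarrow> qvt"
  where "qvt_of a = Gauss a 0"

definition cov_qvt_of :: "qv cov \<Rightarrow> qvt cov"
  where "cov_qvt_of x = Cov (qvt_of (cov0 x)) (qvt_of (cov1 x))"

definition cov_binom :: "'a \<Rightarrow> 'a \<Rightarrow> nat \<Rightarrow> nat \<Rightarrow> 'a :: {comm_ring_1, inverse}"
  where "cov_binom w p n k =
    (\<Prod>l = n - k + 1..n. (p * w) ^ l - w powi (- int l)) /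
    (\<Prod>l = 1..k. (p * w) ^ l - w powi (- int l))"


section \<open>Super root data\<close>

definition zscale :: "int \<Rightarrow> 'a :: ab_group_add \<Rightarrow> 'a"
  where "zscale n x =
    (if 0 \<le> n then ((+) x ^^ nat n) 0 else - (((+) x ^^ nat (- n)) 0))"

lemma zscale_0: "zscale 0 x = 0"
  by (simp add: zscale_def)

lemma zscale_succ: "zscale (n + 1) x = zscale n x + x"
proof (cases "0 \<le> n")
  case True
  then have "nat (n + 1) = Suc (nat n)" by simp
  with True show ?thesis by (simp add: zscale_def add.commute)
next
  case False
  define m where "m = nat (- n) - 1"
  have m: "nat (- n) = Suc m" using False by (simp add: m_def)
  show ?thesis
  proof (cases "n = -1")
    case True
    then show ?thesis by (simp add: zscale_def)
  next
    case n: False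
    have "nat (- (n + 1)) = m" "\<not> 0 \<le> n + 1" using False n m by simp_all
    with False m show ?thesis by (simp add: zscale_def)
  qed
qed

lemma zscale_pred: "zscale (n - 1) x = zscale n x - x"
  using zscale_succ [of "n - 1" x] by (simp add: algebra_simps)

lemma zscale_add: "zscale (m + n) x = zscale m x + zscale n x"
proof (induction n rule: int_induct [where k = 0])
  case base
  show ?case by (simp add: zscale_0)
next
  case (step1 i)
  then show ?case by (simp add: zscale_succ add.assoc [symmetric])
next
  case (step2 i)
  have "zscale (m + (i - 1)) x = zscale (m + i - 1) x" by (simp add: algebra_simps)
  with step2 show ?case by (simp add: zscale_pred algebra_simps)
qed

interpretation Zmod: Modules.module zscale
proof
  fix a b :: int and x y :: 'a
  show "zscale (a + b) x = zscale a x + zscale b x" by (rule zscale_add)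
  show "zscale a (x + y) = zscale a x + zscale a y"
    by (induction a rule: int_induct [where k = 0])
      (simp_all add: zscale_0 zscale_succ zscale_pred algebra_simps)
  show "zscale a (zscale b x) = zscale (a * b) x"
    by (induction a rule: int_induct [where k = 0])
      (simp_all add: zscale_0 zscale_succ zscale_pred zscale_add algebra_simps
        eq_diff_eq flip: zscale_add)
  show "zscale 1 x = x" by (simp add: zscale_def)
qed

definition fg_free :: "'a :: ab_group_add itself \<Rightarrow> bool"
  where "fg_free _ \<longleftrightarrow> (\<exists>B :: 'a set. finite B \<and> Zmod.independent B \<and> Zmod.span B = UNIV)"

definition biadditive :: "('a :: ab_group_add \<Rightarrow> 'b :: ab_group_add \<Rightarrow> int) \<Rightarrow> bool"
  where "biadditive f \<longleftrightarrow>
    (\<forall>x x' y. f (x + x') y = f x y + f x' y) \<and> (\<forall>x y y'. f x (y + y') = f x y + f x y')"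

definition perfect_pairing :: "('a :: ab_group_add \<Rightarrow> 'b :: ab_group_add \<Rightarrow> int) \<Rightarrow> bool"
  where "perfect_pairing f \<longleftrightarrow> biadditive f \<and>
    (\<forall>h :: 'b \<Rightarrow> int. (\<forall>x y. h (x + y) = h x + h y) \<longrightarrow> (\<exists>!a. \<forall>x. h x = f a x)) \<and>
    (\<forall>h :: 'a \<Rightarrow> int. (\<forall>x y. h (x + y) = h x + h y) \<longrightarrow> (\<exists>!b. \<forall>y. h y = f y b))"

text \<open>The form is defined on \<open>\<int>[I]\<close>, realised as the type of finitely supported functions \<open>I \<rightarrow> \<int>\<close>.
  \<open>sr_odd\<close> is the odd part of \<open>I\<close>; the even part is its complement.\<close>

record ('i, 'y, 'x) root_datum =
  sr_form :: "('i \<Rightarrow>\<^sub>0 int) \<Rightarrow> ('i \<Rightarrow>\<^sub>0 int) \<Rightarrow> int"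
  sr_odd :: "'i set"
  sr_pair :: "'y \<Rightarrow> 'x \<Rightarrow> int"
  sr_iY :: "'i \<Rightarrow> 'y"
  sr_iX :: "'i \<Rightarrow> 'x"

definition sr_dot :: "('i, 'y, 'x) root_datum \<Rightarrow> 'i \<Rightarrow> 'i \<Rightarrow> int"
  where "sr_dot D i j = sr_form D (Poly_Mapping.single i 1) (Poly_Mapping.single j 1)"

text \<open>Integer division in the next two definitions; exactness is part of the axioms below.\<close>

definition sr_d :: "('i, 'y, 'x) root_datum \<Rightarrow> 'i \<Rightarrow> int"
  where "sr_d D i = sr_dot D i i div 2"

definition sr_a :: "('i, 'y, 'x) root_datum \<Rightarrow> 'i \<Rightarrow> 'i \<Rightarrow> int"
  where "sr_a D i j = 2 * sr_dot D i j div sr_dot D i i"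

definition sr_b :: "('i, 'y, 'x) root_datum \<Rightarrow> 'i \<Rightarrow> 'i \<Rightarrow> nat"
  where "sr_b D i j = nat (1 - sr_a D i j)"

definition sr_p :: "('i, 'y, 'x) root_datum \<Rightarrow> 'i \<Rightarrow> nat"
  where "sr_p D i = (if i \<in> sr_odd D then 1 else 0)"

definition super_cartan_datum :: "('i :: finite, 'y, 'x) root_datum \<Rightarrow> bool"
  where "super_cartan_datum D \<longleftrightarrow>
    biadditive (sr_form D) \<and>
    (\<forall>x y. sr_form D x y = sr_form D y x) \<and>
    (\<forall>i. 2 dvd sr_dot D i i \<and> 0 < sr_d D i) \<and>
    (\<forall>i j. sr_dot D i i dvd 2 * sr_dot D i j) \<and>
    (\<forall>i j. i \<noteq> j \<longrightarrow> sr_a D i j \<le> 0) \<and>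
    sr_odd D \<noteq> {} \<and>
    (\<forall>i \<in> sr_odd D. \<forall>j. even (sr_a D i j)) \<and>
    (\<forall>i. sr_d D i mod 2 = int (sr_p D i) mod 2)"

definition super_root_datum ::
    "('i :: finite, 'y :: ab_group_add, 'x :: ab_group_add) root_datum \<Rightarrow> bool"
  where "super_root_datum D \<longleftrightarrow>
    super_cartan_datum D \<and>
    fg_free TYPE('y) \<and> fg_free TYPE('x) \<and>
    perfect_pairing (sr_pair D) \<and>
    inj (sr_iY D) \<and> Zmod.independent (range (sr_iY D)) \<and>
    inj (sr_iX D) \<and> Zmod.independent (range (sr_iX D)) \<and>
    (\<forall>i j. sr_pair D (sr_iY D i) (sr_iX D j) = sr_a D i j)"

definition dominant :: "('i, 'y, 'x) root_datum \<Rightarrow> 'x set"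
  where "dominant D = {l. \<forall>i. 0 \<le> sr_pair D (sr_iY D i) l}"


section \<open>Algebras and extension of scalars\<close>

text \<open>An algebra over a commutative ring given as a type \<open>'r\<close> is a ring in the sense of
  HOL-Algebra together with a scalar multiplication, bundled in the library record
  \<^typ>\<open>('r, 'a) module\<close>.\<close>

definition as_algebra :: "'a ring \<Rightarrow> ('r \<Rightarrow> 'a) \<Rightarrow> ('r, 'a) module"
  where "as_algebra A h =
    \<lparr>carrier = carrier A, monoid.mult = monoid.mult A, one = one A, zero = zero A, add = add A,
     module.smult = (\<lambda>r a. h r \<otimes>\<^bsub>A\<^esub> a)\<rparr>"

definition type_ring :: "'a :: ring_1 ring"
  where "type_ring = \<lparr>carrier = UNIV, monoid.mult = (*), one = 1, zero = 0, add = (+)\<rparr>"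

lemma ring_type_ring: "ring (type_ring :: 'a :: ring_1 ring)"
proof (rule ringI)
  show "abelian_group (type_ring :: 'a ring)"
  proof (rule abelian_groupI)
    fix x :: 'a
    show "\<exists>y\<in>carrier type_ring. y \<oplus>\<^bsub>type_ring\<^esub> x = \<zero>\<^bsub>type_ring\<^esub>"
      by (rule bexI [of _ "- x"]) (simp_all add: type_ring_def)
  qed (auto simp: type_ring_def add.assoc add.commute)
  show "Group.monoid (type_ring :: 'a ring)"
    by (rule monoidI) (auto simp: type_ring_def mult.assoc)
qed (auto simp: type_ring_def algebra_simps)

text \<open>\<open>S \<otimes>\<^sub>R A\<close> along \<open>f : R \<rightarrow> S\<close>: the free abelian group on the pairs \<open>(s, a)\<close>, with
  \<open>(s, a)(s', a') = (ss', aa')\<close>, modulo the usual balanced bilinearity relations.\<close>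

definition pair_mult ::
    "('r, 'a) module \<Rightarrow> ('s :: comm_ring_1 \<times> 'a \<Rightarrow>\<^sub>0 int) \<Rightarrow> ('s \<times> 'a \<Rightarrow>\<^sub>0 int) \<Rightarrow> ('s \<times> 'a \<Rightarrow>\<^sub>0 int)"
  where "pair_mult A x y =
    frag_extend (\<lambda>p. frag_extend (\<lambda>q. frag_of (fst p * fst q, snd p \<otimes>\<^bsub>A\<^esub> snd q)) y) x"

definition pair_ring :: "('r, 'a) module \<Rightarrow> ('s :: comm_ring_1 \<times> 'a \<Rightarrow>\<^sub>0 int) ring"
  where "pair_ring A =
    \<lparr>carrier = {x. Poly_Mapping.keys x \<subseteq> UNIV \<times> carrier A}, monoid.mult = pair_mult A,
     one = frag_of (1, \<one>\<^bsub>A\<^esub>), zero = 0, add = (+)\<rparr>"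

lemma pair_mult_of [simp]:
  "pair_mult A (frag_of p) (frag_of q) = frag_of (fst p * fst q, snd p \<otimes>\<^bsub>A\<^esub> snd q)"
  by (simp add: pair_mult_def)

lemma pair_mult_0 [simp]: "pair_mult A 0 y = 0" "pair_mult A x 0 = 0"
  by (simp_all add: pair_mult_def) (simp add: frag_extend_def)

lemma pair_mult_diff_left: "pair_mult A (x - x') y = pair_mult A x y - pair_mult A x' y"
  by (simp add: pair_mult_def frag_extend_diff)

lemma pair_mult_add_left: "pair_mult A (x + x') y = pair_mult A x y + pair_mult A x' y"
  by (simp add: pair_mult_def frag_extend_add)

lemma pair_mult_add_right: "pair_mult A x (y + y') = pair_mult A x y + pair_mult A x y'"
  unfolding pair_mult_def frag_extend_add
  by (simp add: frag_extend_def frag_cmul_distrib2 sum.distrib)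

lemma pair_mult_diff_right: "pair_mult A x (y - y') = pair_mult A x y - pair_mult A x y'"
  using pair_mult_add_right [of A x "y - y'" y'] by (simp add: algebra_simps)

lemma pair_mult_closed:
  assumes A: "ring A"
    and x: "Poly_Mapping.keys x \<subseteq> UNIV \<times> carrier A"
    and y: "Poly_Mapping.keys y \<subseteq> UNIV \<times> carrier A"
  shows "Poly_Mapping.keys (pair_mult A x y) \<subseteq> UNIV \<times> carrier A"
  using x
proof (induction x rule: frag_induction)
  case (one p)
  show ?case using y
  proof (induction y rule: frag_induction)
    case (one q)
    interpret ring A by (rule A)
    show ?case using one \<open>p \<in> _\<close> by (auto simp: keys_frag_of)
  next
    case (diff a b)
    then show ?case using keys_diff by (fastforce simp: pair_mult_diff_right)
  qed simp
next
  case (diff a b)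
  then show ?case using keys_diff by (fastforce simp: pair_mult_diff_left)
qed simp

lemma pair_mult_assoc:
  assumes A: "ring A"
    and x: "Poly_Mapping.keys x \<subseteq> UNIV \<times> carrier A"
    and y: "Poly_Mapping.keys y \<subseteq> UNIV \<times> carrier A"
    and z: "Poly_Mapping.keys z \<subseteq> UNIV \<times> carrier A"
  shows "pair_mult A (pair_mult A x y) z = pair_mult A x (pair_mult A y z)"
  using x
proof (induction x rule: frag_induction)
  case p: (one p)
  show ?case using y
  proof (induction y rule: frag_induction)
    case q: (one q)
    show ?case using z
    proof (induction z rule: frag_induction)
      case (one r)
      interpret ring A by (rule A)
      show ?case using p q one by (auto simp: mult.assoc m_assoc)
    qed (simp_all add: pair_mult_diff_right)
  qed (simp_all add: pair_mult_diff_left pair_mult_diff_right)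
qed (simp_all add: pair_mult_diff_left)

lemma pair_mult_one:
  assumes A: "ring A" and x: "Poly_Mapping.keys x \<subseteq> UNIV \<times> carrier A"
  shows "pair_mult A (frag_of (1, \<one>\<^bsub>A\<^esub>)) x = x" "pair_mult A x (frag_of (1, \<one>\<^bsub>A\<^esub>)) = x"
proof -
  interpret ring A by (rule A)
  show "pair_mult A (frag_of (1, \<one>\<^bsub>A\<^esub>)) x = x"
    using x by (induction x rule: frag_induction) (auto simp: pair_mult_diff_right)
  show "pair_mult A x (frag_of (1, \<one>\<^bsub>A\<^esub>)) = x"
    using x by (induction x rule: frag_induction) (auto simp: pair_mult_diff_left)
qed

lemma ring_pair_ring:
  assumes A: "ring A"
  shows "ring (pair_ring A)"
proof (rule ringI)
  interpret ring A by (rule A)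
  show "abelian_group (pair_ring A)"
  proof (rule abelian_groupI)
    fix x
    assume "x \<in> carrier (pair_ring A)"
    then show "\<exists>y\<in>carrier (pair_ring A). y \<oplus>\<^bsub>pair_ring A\<^esub> x = \<zero>\<^bsub>pair_ring A\<^esub>"
      by (intro bexI [of _ "- x"]) (simp_all add: pair_ring_def)
  qed (use Poly_Mapping.keys_add in \<open>fastforce simp: pair_ring_def add.assoc add.commute\<close>)+
  show "Group.monoid (pair_ring A)"
    using A by (intro monoidI)
      (auto simp: pair_ring_def keys_frag_of pair_mult_assoc pair_mult_one
        dest: pair_mult_closed [OF A, THEN subsetD])
qed (simp_all add: pair_ring_def pair_mult_add_left pair_mult_add_right)

definition tensor_rels ::
    "('r \<Rightarrow> 's :: comm_ring_1) \<Rightarrow> ('r, 'a) module \<Rightarrow> ('s \<times> 'a \<Rightarrow>\<^sub>0 int) set"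
  where "tensor_rels f A =
    {frag_of (s + s', a) - frag_of (s, a) - frag_of (s', a) | s s' a. a \<in> carrier A} \<union>
    {frag_of (s, a \<oplus>\<^bsub>A\<^esub> a') - frag_of (s, a) - frag_of (s, a') | s a a'.
       a \<in> carrier A \<and> a' \<in> carrier A} \<union>
    {frag_of (s * f r, a) - frag_of (s, r \<odot>\<^bsub>A\<^esub> a) | s r a. a \<in> carrier A}"

lemma tensor_rels_closed:
  assumes "ring A" and "\<And>r a. a \<in> carrier A \<Longrightarrow> r \<odot>\<^bsub>A\<^esub> a \<in> carrier A"
  shows "tensor_rels f A \<subseteq> carrier (pair_ring A)"
proof -
  interpret ring A by (rule assms)
  have diff: "Poly_Mapping.keys (x - y) \<subseteq> S"
    if "Poly_Mapping.keys x \<subseteq> S" "Poly_Mapping.keys y \<subseteq> S" for x y :: "'x \<Rightarrow>\<^sub>0 int" and S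
    using that keys_diff [of x y] by blast
  have pair: "Poly_Mapping.keys (frag_of (s, a)) \<subseteq> UNIV \<times> carrier A"
    if "a \<in> carrier A" for s a
    using that by (simp add: keys_frag_of)
  have "Poly_Mapping.keys x \<subseteq> UNIV \<times> carrier A" if "x \<in> tensor_rels f A" for x
    using that unfolding tensor_rels_def
    by (elim UnE CollectE exE conjE)
      (hypsubst, intro diff pair assms(2) a_closed, assumption+)+
  then show ?thesis by (auto simp: pair_ring_def simp del: keys_single)
qed

definition tensor_ideal ::
    "('r \<Rightarrow> 's :: comm_ring_1) \<Rightarrow> ('r, 'a) module \<Rightarrow> ('s \<times> 'a \<Rightarrow>\<^sub>0 int) set"
  where "tensor_ideal f A = Idl\<^bsub>pair_ring A\<^esub> (tensor_rels f A)"

definition tens ::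
    "('r \<Rightarrow> 's :: comm_ring_1) \<Rightarrow> ('r, 'a) module \<Rightarrow> 's \<Rightarrow> 'a \<Rightarrow> ('s \<times> 'a \<Rightarrow>\<^sub>0 int) set"
  where "tens f A s a = tensor_ideal f A +>\<^bsub>pair_ring A\<^esub> frag_of (s, a)"

definition base_change ::
    "('r \<Rightarrow> 's :: comm_ring_1) \<Rightarrow> ('r, 'a) module \<Rightarrow> ('s, ('s \<times> 'a \<Rightarrow>\<^sub>0 int) set) module"
  where "base_change f A =
    as_algebra (pair_ring A Quot tensor_ideal f A) (\<lambda>s. tens f A s \<one>\<^bsub>A\<^esub>)"

lemma ring_as_algebra:
  assumes "ring A"
  shows "ring (as_algebra A h)"
proof (rule ringI)
  interpret ring A by (rule assms)
  show "abelian_group (as_algebra A h)"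
  proof (rule abelian_groupI)
    fix x
    assume "x \<in> carrier (as_algebra A h)"
    then show "\<exists>y\<in>carrier (as_algebra A h). y \<oplus>\<^bsub>as_algebra A h\<^esub> x = \<zero>\<^bsub>as_algebra A h\<^esub>"
      by (intro bexI [of _ "\<ominus>\<^bsub>A\<^esub> x"]) (simp_all add: as_algebra_def l_neg)
  qed (simp_all add: as_algebra_def a_ac)
  show "Group.monoid (as_algebra A h)"
    by (rule monoidI) (simp_all add: as_algebra_def m_assoc)
qed (simp_all add: as_algebra_def ring.ring_simprules [OF assms])

lemma ring_base_change:
  assumes "ring A" and "\<And>r a. a \<in> carrier A \<Longrightarrow> r \<odot>\<^bsub>A\<^esub> a \<in> carrier A"
  shows "ring (base_change f A)"
  unfolding base_change_def tensor_ideal_def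
  by (intro ring_as_algebra ideal.quotient_is_ring ring.genideal_ideal ring_pair_ring
      tensor_rels_closed assms)


section \<open>The covering quantum group\<close>

datatype ('i, 'y) gen = GE 'i | GF 'i | GK 'y | GJ 'y

datatype 'g word = Word (letters: "'g list")

instantiation word :: (type) monoid_add
begin
definition "0 = Word []"
definition "u + w = Word (letters u @ letters w)"
instance by standard (simp_all add: zero_word_def plus_word_def)
end

text \<open>The free \<open>R\<close>-algebra on \<open>'g\<close> is the monoid algebra \<open>'g word \<Rightarrow>\<^sub>0 'r\<close> of the free monoid.\<close>

definition fgen :: "'g \<Rightarrow> 'g word \<Rightarrow>\<^sub>0 'r :: comm_ring_1"
  where "fgen g = Poly_Mapping.single (Word [g]) 1"

definition fscal :: "'r :: comm_ring_1 \<Rightarrow> 'g word \<Rightarrow>\<^sub>0 'r"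
  where "fscal r = Poly_Mapping.single 0 r"

type_synonym ('i, 'y) freeU = "('i, 'y) gen word \<Rightarrow>\<^sub>0 qv cov"

abbreviation U_v :: "qv cov"
  where "U_v \<equiv> Cov qv_v 0"

definition serre ::
    "('i, 'y, 'x) root_datum \<Rightarrow> ('i \<Rightarrow> ('i, 'y) gen) \<Rightarrow> 'i \<Rightarrow> 'i \<Rightarrow> ('i, 'y) freeU"
  where "serre D G i j =
    (\<Sum>k = 0..sr_b D i j.
       fscal ((-1) ^ k * cov_pi ^ ((k choose 2) * sr_p D i + k * sr_p D i * sr_p D j) *
              cov_binom (U_v powi sr_d D i) (cov_pi powi sr_d D i) (sr_b D i j) k) *
       fgen (G i) ^ (sr_b D i j - k) * fgen (G j) * fgen (G i) ^ k)"

inductive_set U_rels :: "('i, 'y :: ab_group_add, 'x) root_datum \<Rightarrow> ('i, 'y) freeU set"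
  for D
  where
    JJ: "fgen (GJ m) * fgen (GJ n) - fgen (GJ (m + n)) \<in> U_rels D"
  | KK: "fgen (GK m) * fgen (GK n) - fgen (GK (m + n)) \<in> U_rels D"
  | K0: "fgen (GK 0) - 1 \<in> U_rels D"
  | J0: "fgen (GJ 0) - 1 \<in> U_rels D"
  | J2: "fgen (GJ n) ^ 2 - 1 \<in> U_rels D"
  | JK: "fgen (GJ m) * fgen (GK n) - fgen (GK n) * fgen (GJ m) \<in> U_rels D"
  | JE: "fgen (GJ m) * fgen (GE i) -
         fscal (cov_pi powi sr_pair D m (sr_iX D i)) * fgen (GE i) * fgen (GJ m) \<in> U_rels D"
  | JF: "fgen (GJ m) * fgen (GF i) -
         fscal (cov_pi powi (- sr_pair D m (sr_iX D i))) * fgen (GF i) * fgen (GJ m) \<in> U_rels D"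
  | KE: "fgen (GK m) * fgen (GE i) -
         fscal (U_v powi sr_pair D m (sr_iX D i)) * fgen (GE i) * fgen (GK m) \<in> U_rels D"
  | KF: "fgen (GK m) * fgen (GF i) -
         fscal (U_v powi (- sr_pair D m (sr_iX D i))) * fgen (GF i) * fgen (GK m) \<in> U_rels D"
  | EF: "fgen (GE i) * fgen (GF j) -
         fscal (cov_pi ^ (sr_p D i * sr_p D j)) * fgen (GF j) * fgen (GE i) -
         (if i = j then
            fscal (1 / (cov_pi powi sr_d D i * U_v powi sr_d D i - U_v powi (- sr_d D i))) *
            (fgen (GJ (zscale (sr_d D i) (sr_iY D i))) * fgen (GK (zscale (sr_d D i) (sr_iY D i))) -
             fgen (GK (zscale (- sr_d D i) (sr_iY D i))))
          else 0) \<in> U_rels D"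
  | SE: "i \<noteq> j \<Longrightarrow> serre D GE i j \<in> U_rels D"
  | SF: "i \<noteq> j \<Longrightarrow> serre D GF i j \<in> U_rels D"

definition U_ideal :: "('i, 'y :: ab_group_add, 'x) root_datum \<Rightarrow> ('i, 'y) freeU set"
  where "U_ideal D = Idl\<^bsub>type_ring\<^esub> (U_rels D)"

definition U_class ::
    "('i, 'y :: ab_group_add, 'x) root_datum \<Rightarrow> ('i, 'y) freeU \<Rightarrow> ('i, 'y) freeU set"
  where "U_class D x = U_ideal D +>\<^bsub>type_ring\<^esub> x"

definition U :: "('i, 'y :: ab_group_add, 'x) root_datum \<Rightarrow> (qv cov, ('i, 'y) freeU set) module"
  where "U D = as_algebra (type_ring Quot U_ideal D) (\<lambda>r. U_class D (fscal r))"

definition Ut ::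
    "('i, 'y :: ab_group_add, 'x) root_datum \<Rightarrow>
     (qvt cov, (qvt cov \<times> ('i, 'y) freeU set \<Rightarrow>\<^sub>0 int) set) module"
  where "Ut D = base_change cov_qvt_of (U D)"

text \<open>\<open>U|\<^bsub>\<pi>=e\<^esub>\<close> over \<open>\<rat>(v)\<close> and \<open>U[t]|\<^bsub>\<pi>=e\<^esub>\<close> over \<open>\<rat>(v,t)\<close>, together with the images of the generators
  \<open>E\<^sub>i, F\<^sub>i, K\<^sub>\<mu>, J\<^sub>\<mu>\<close>.\<close>

type_synonym ('i, 'y) U_elt = "(qv \<times> ('i, 'y) freeU set \<Rightarrow>\<^sub>0 int) set"
type_synonym ('i, 'y) Ut_elt =
  "(qvt \<times> (qvt cov \<times> ('i, 'y) freeU set \<Rightarrow>\<^sub>0 int) set \<Rightarrow>\<^sub>0 int) set"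

definition U_at ::
    "int \<Rightarrow> ('i, 'y :: ab_group_add, 'x) root_datum \<Rightarrow> (qv, ('i, 'y) U_elt) module"
  where "U_at e D = base_change (cov_spec e) (U D)"

definition U_at_gen ::
    "int \<Rightarrow> ('i, 'y :: ab_group_add, 'x) root_datum \<Rightarrow> ('i, 'y) gen \<Rightarrow> ('i, 'y) U_elt"
  where "U_at_gen e D g = tens (cov_spec e) (U D) 1 (U_class D (fgen g))"

definition Ut_at ::
    "int \<Rightarrow> ('i, 'y :: ab_group_add, 'x) root_datum \<Rightarrow> (qvt, ('i, 'y) Ut_elt) module"
  where "Ut_at e D = base_change (cov_spec e) (Ut D)"

definition Ut_at_gen ::
    "int \<Rightarrow> ('i, 'y :: ab_group_add, 'x) root_datum \<Rightarrow> ('i, 'y) gen \<Rightarrow> ('i, 'y) Ut_elt"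
  where "Ut_at_gen e D g =
    tens (cov_spec e) (Ut D) 1 (tens cov_qvt_of (U D) 1 (U_class D (fgen g)))"


section \<open>Weight modules\<close>

text \<open>The library locale for modules assumes a commutative base ring. Only the fields
  \<open>carrier\<close>, \<open>zero\<close>, \<open>add\<close> and \<open>smult\<close> of \<open>M\<close> are relevant.\<close>

definition left_module :: "('k, 'a) module \<Rightarrow> ('a, 'm) module \<Rightarrow> bool"
  where "left_module A M \<longleftrightarrow> abelian_group M \<and>
    (\<forall>a \<in> carrier A. \<forall>m \<in> carrier M. a \<odot>\<^bsub>M\<^esub> m \<in> carrier M) \<and>
    (\<forall>a \<in> carrier A. \<forall>b \<in> carrier A. \<forall>m \<in> carrier M.
       (a \<oplus>\<^bsub>A\<^esub> b) \<odot>\<^bsub>M\<^esub> m = a \<odot>\<^bsub>M\<^esub> m \<oplus>\<^bsub>M\<^esub> b \<odot>\<^bsub>M\<^esub> m) \<and>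
    (\<forall>a \<in> carrier A. \<forall>m \<in> carrier M. \<forall>n \<in> carrier M.
       a \<odot>\<^bsub>M\<^esub> (m \<oplus>\<^bsub>M\<^esub> n) = a \<odot>\<^bsub>M\<^esub> m \<oplus>\<^bsub>M\<^esub> a \<odot>\<^bsub>M\<^esub> n) \<and>
    (\<forall>a \<in> carrier A. \<forall>b \<in> carrier A. \<forall>m \<in> carrier M.
       (a \<otimes>\<^bsub>A\<^esub> b) \<odot>\<^bsub>M\<^esub> m = a \<odot>\<^bsub>M\<^esub> (b \<odot>\<^bsub>M\<^esub> m)) \<and>
    (\<forall>m \<in> carrier M. \<one>\<^bsub>A\<^esub> \<odot>\<^bsub>M\<^esub> m = m)"

definition scal_act :: "('k, 'a) module \<Rightarrow> ('a, 'm) module \<Rightarrow> 'k \<Rightarrow> 'm \<Rightarrow> 'm"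
  where "scal_act A M c m = (c \<odot>\<^bsub>A\<^esub> \<one>\<^bsub>A\<^esub>) \<odot>\<^bsub>M\<^esub> m"

text \<open>In the following definitions \<open>A\<close> is an algebra over the field \<open>'k\<close>, \<open>g\<close> gives the images in \<open>A\<close> of the
  generators, \<open>w \<in> 'k\<close> is the formal parameter and \<open>e = \<plusminus>1\<close> the value of \<open>\<pi>\<close>.\<close>

definition weight_space ::
    "('i, 'y, 'x) root_datum \<Rightarrow> ('k :: field, 'a) module \<Rightarrow> (('i, 'y) gen \<Rightarrow> 'a) \<Rightarrow> 'k \<Rightarrow> int \<Rightarrow>
     ('a, 'm) module \<Rightarrow> 'x \<Rightarrow> 'm set"
  where "weight_space D A g w e M l = {m \<in> carrier M. \<forall>n.
     g (GK n) \<odot>\<^bsub>M\<^esub> m = scal_act A M (w powi sr_pair D n l) m \<and>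
     g (GJ n) \<odot>\<^bsub>M\<^esub> m = scal_act A M (of_int e powi sr_pair D n l) m}"

definition weight_module ::
    "('i, 'y, 'x) root_datum \<Rightarrow> ('k :: field, 'a) module \<Rightarrow> (('i, 'y) gen \<Rightarrow> 'a) \<Rightarrow> 'k \<Rightarrow> int \<Rightarrow>
     ('a, 'm) module \<Rightarrow> bool"
  where "weight_module D A g w e M \<longleftrightarrow> left_module A M \<and>
    (\<forall>m \<in> carrier M. \<exists>!c :: 'x \<Rightarrow> 'm.
       (\<forall>l. c l \<in> weight_space D A g w e M l) \<and>
       finite {l. c l \<noteq> \<zero>\<^bsub>M\<^esub>} \<and>
       m = finsum M c {l. c l \<noteq> \<zero>\<^bsub>M\<^esub>})"

definition fin_basis :: "('k, 'a) module \<Rightarrow> ('a, 'm) module \<Rightarrow> 'm set \<Rightarrow> 'm set \<Rightarrow> bool"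
  where "fin_basis A M W B \<longleftrightarrow> finite B \<and> B \<subseteq> W \<and>
    (\<forall>x \<in> W. \<exists>!c :: 'm \<Rightarrow> 'k. c \<in> B \<rightarrow>\<^sub>E UNIV \<and> x = finsum M (\<lambda>b. scal_act A M (c b) b) B)"

definition vdim :: "('k, 'a) module \<Rightarrow> ('a, 'm) module \<Rightarrow> 'm set \<Rightarrow> enat"
  where "vdim A M W =
    (if \<exists>B. fin_basis A M W B then enat (card (SOME B. fin_basis A M W B)) else \<infinity>)"

definition character ::
    "('i, 'y, 'x) root_datum \<Rightarrow> ('k :: field, 'a) module \<Rightarrow> (('i, 'y) gen \<Rightarrow> 'a) \<Rightarrow> 'k \<Rightarrow> int \<Rightarrow>
     ('a, 'm) module \<Rightarrow> 'x \<Rightarrow> enat"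
  where "character D A g w e M l = vdim A M (weight_space D A g w e M l)"

definition simple_module :: "('k, 'a) module \<Rightarrow> ('a, 'm) module \<Rightarrow> bool"
  where "simple_module A M \<longleftrightarrow> left_module A M \<and> carrier M \<noteq> {\<zero>\<^bsub>M\<^esub>} \<and>
    (\<forall>H. submodule H A M \<longrightarrow> H = {\<zero>\<^bsub>M\<^esub>} \<or> H = carrier M)"

text \<open>\<open>is_V e D l M\<close>: \<open>M\<close> is (a model of) the simple highest weight module \<open>V(l)\<close> of \<open>U|\<^bsub>\<pi>=e\<^esub>\<close>, which is
  determined by this property up to isomorphism.\<close>

definition is_V ::
    "int \<Rightarrow> ('i, 'y :: ab_group_add, 'x) root_datum \<Rightarrow> 'x \<Rightarrow> (('i, 'y) U_elt, 'm) module \<Rightarrow> bool"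
  where "is_V e D l M \<longleftrightarrow>
    weight_module D (U_at e D) (U_at_gen e D) qv_v e M \<and>
    simple_module (U_at e D) M \<and>
    (\<exists>x \<in> weight_space D (U_at e D) (U_at_gen e D) qv_v e M l.
       x \<noteq> \<zero>\<^bsub>M\<^esub> \<and>
       (\<forall>i. U_at_gen e D (GE i) \<odot>\<^bsub>M\<^esub> x = \<zero>\<^bsub>M\<^esub>) \<and>
       (\<forall>H. submodule H (U_at e D) M \<and> x \<in> H \<longrightarrow> H = carrier M))"

definition char_U ::
    "int \<Rightarrow> ('i, 'y :: ab_group_add, 'x) root_datum \<Rightarrow> (('i, 'y) U_elt, 'm) module \<Rightarrow> 'x \<Rightarrow> enat"
  where "char_U e D M = character D (U_at e D) (U_at_gen e D) qv_v e M"


section \<open>Categories\<close>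

text \<open>Hom-sets are families indexed by pairs of objects and need not be disjoint;
  \<open>Cmp C X Y Z g f\<close> is the composite of \<open>f : X \<rightarrow> Y\<close> and \<open>g : Y \<rightarrow> Z\<close>.\<close>

record ('o, 'f) precat =
  Obj :: "'o set"
  Hom :: "'o \<Rightarrow> 'o \<Rightarrow> 'f set"
  Idn :: "'o \<Rightarrow> 'f"
  Cmp :: "'o \<Rightarrow> 'o \<Rightarrow> 'o \<Rightarrow> 'f \<Rightarrow> 'f \<Rightarrow> 'f"

definition is_category :: "('o, 'f) precat \<Rightarrow> bool"
  where "is_category C \<longleftrightarrow>
    (\<forall>X \<in> Obj C. Idn C X \<in> Hom C X X) \<and>
    (\<forall>X \<in> Obj C. \<forall>Y \<in> Obj C. \<forall>Z \<in> Obj C. \<forall>f \<in> Hom C X Y. \<forall>g \<in> Hom C Y Z.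
       Cmp C X Y Z g f \<in> Hom C X Z) \<and>
    (\<forall>X \<in> Obj C. \<forall>Y \<in> Obj C. \<forall>f \<in> Hom C X Y.
       Cmp C X X Y f (Idn C X) = f \<and> Cmp C X Y Y (Idn C Y) f = f) \<and>
    (\<forall>X \<in> Obj C. \<forall>Y \<in> Obj C. \<forall>Z \<in> Obj C. \<forall>W \<in> Obj C.
       \<forall>f \<in> Hom C X Y. \<forall>g \<in> Hom C Y Z. \<forall>h \<in> Hom C Z W.
       Cmp C X Z W h (Cmp C X Y Z g f) = Cmp C X Y W (Cmp C Y Z W h g) f)"

definition is_functor ::
    "('o, 'f) precat \<Rightarrow> ('p, 'g) precat \<Rightarrow> ('o \<Rightarrow> 'p) \<Rightarrow> ('o \<Rightarrow> 'o \<Rightarrow> 'f \<Rightarrow> 'g) \<Rightarrow> bool"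
  where "is_functor C D F Fm \<longleftrightarrow>
    (\<forall>X \<in> Obj C. F X \<in> Obj D) \<and>
    (\<forall>X \<in> Obj C. \<forall>Y \<in> Obj C. \<forall>f \<in> Hom C X Y. Fm X Y f \<in> Hom D (F X) (F Y)) \<and>
    (\<forall>X \<in> Obj C. Fm X X (Idn C X) = Idn D (F X)) \<and>
    (\<forall>X \<in> Obj C. \<forall>Y \<in> Obj C. \<forall>Z \<in> Obj C. \<forall>f \<in> Hom C X Y. \<forall>g \<in> Hom C Y Z.
       Fm X Z (Cmp C X Y Z g f) = Cmp D (F X) (F Y) (F Z) (Fm Y Z g) (Fm X Y f))"

definition is_iso :: "('o, 'f) precat \<Rightarrow> 'o \<Rightarrow> 'o \<Rightarrow> 'f \<Rightarrow> bool"
  where "is_iso C X Y f \<longleftrightarrow> f \<in> Hom C X Y \<and>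
    (\<exists>g \<in> Hom C Y X. Cmp C X Y X g f = Idn C X \<and> Cmp C Y X Y f g = Idn C Y)"

definition natural_iso ::
    "('o, 'f) precat \<Rightarrow> ('p, 'g) precat \<Rightarrow> ('o \<Rightarrow> 'p) \<Rightarrow> ('o \<Rightarrow> 'o \<Rightarrow> 'f \<Rightarrow> 'g) \<Rightarrow>
     ('o \<Rightarrow> 'p) \<Rightarrow> ('o \<Rightarrow> 'o \<Rightarrow> 'f \<Rightarrow> 'g) \<Rightarrow> ('o \<Rightarrow> 'g) \<Rightarrow> bool"
  where "natural_iso C D F Fm G Gm h \<longleftrightarrow>
    (\<forall>X \<in> Obj C. is_iso D (F X) (G X) (h X)) \<and>
    (\<forall>X \<in> Obj C. \<forall>Y \<in> Obj C. \<forall>f \<in> Hom C X Y.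
       Cmp D (F X) (F Y) (G Y) (h Y) (Fm X Y f) = Cmp D (F X) (G X) (G Y) (Gm X Y f) (h X))"

definition equivalent_categories :: "('o, 'f) precat \<Rightarrow> ('p, 'g) precat \<Rightarrow> bool"
  where "equivalent_categories C D \<longleftrightarrow> is_category C \<and> is_category D \<and>
    (\<exists>F Fm G Gm h k. is_functor C D F Fm \<and> is_functor D C G Gm \<and>
       natural_iso C C (\<lambda>X. X) (\<lambda>X Y f. f) (\<lambda>X. G (F X)) (\<lambda>X Y f. Gm (F X) (F Y) (Fm X Y f)) h \<and>
       natural_iso D D (\<lambda>X. F (G X)) (\<lambda>X Y f. Fm (G X) (G Y) (Gm X Y f)) (\<lambda>X. X) (\<lambda>X Y f. f) k)"

definition module_hom ::
    "('k, 'a) module \<Rightarrow> ('a, 'm) module \<Rightarrow> ('a, 'n) module \<Rightarrow> ('m \<Rightarrow> 'n) set"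
  where "module_hom A M N = {f \<in> carrier M \<rightarrow>\<^sub>E carrier N.
    (\<forall>x \<in> carrier M. \<forall>y \<in> carrier M. f (x \<oplus>\<^bsub>M\<^esub> y) = f x \<oplus>\<^bsub>N\<^esub> f y) \<and>
    (\<forall>a \<in> carrier A. \<forall>x \<in> carrier M. f (a \<odot>\<^bsub>M\<^esub> x) = a \<odot>\<^bsub>N\<^esub> f x)}"

text \<open>The category of weight modules of \<open>U[t]|\<^bsub>\<pi>=e\<^esub>\<close> with underlying set contained in the type \<open>'m\<close>,
  which plays the role of the universe of sets.\<close>

definition Ct ::
    "int \<Rightarrow> ('i, 'y :: ab_group_add, 'x) root_datum \<Rightarrow>
     ((('i, 'y) Ut_elt, 'm) module, 'm \<Rightarrow> 'm) precat"
  where "Ct e D =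
    \<lparr>Obj = {M. weight_module D (Ut_at e D) (Ut_at_gen e D) (qvt_of qv_v) e M},
     Hom = module_hom (Ut_at e D),
     Idn = (\<lambda>M. \<lambda>x \<in> carrier M. x),
     Cmp = (\<lambda>L M N g f. compose (carrier L) g f)\<rparr>"

end

theory Submission
  imports Defs
begin

text \<open>
  The two specialisations of the covering quantum group become the same algebra once \<open>t\<close> with
  \<open>t\<^sup>2 = -1\<close> is available, because \<open>(-1) t = t\<^sup>-\<^sup>1\<close>: replacing \<open>v\<close> by \<open>t v\<close> and \<open>\<pi>\<close> by \<open>-\<pi>\<close> multiplies
  \<open>(\<pi> v)\<^sup>n - v\<^sup>-\<^sup>n\<close> by the single factor \<open>t\<^sup>-\<^sup>n\<close>. Quantum integers and quantum binomials therefore only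
  change by powers of \<open>t\<close>, and these powers, like the signs \<open>\<pi>\<^sup>p\<^sup>(\<^sup>i\<^sup>)\<^sup>p\<^sup>(\<^sup>j\<^sup>)\<close>, can be absorbed into the generators
  \<open>E\<^sub>i\<close> and \<open>F\<^sub>i\<close> by rescaling them on each weight space by a power of \<open>t\<close>. This is the twistor.

  Concretely, let \<open>M\<close> be a weight module over \<open>U[t]\<close> at \<open>\<pi> = e\<close>. The twisted module has the same
  underlying group and the same weight spaces; a scalar acts through the automorphism of \<open>\<rat>(v, t)\<close> with
  \<open>v \<mapsto> t\<^sup>\<plusminus>\<^sup>1 v\<close>, and on weight \<open>l\<close> the generators \<open>E\<^sub>i\<close> and \<open>F\<^sub>i\<close> are multiplied by \<open>t\<close> to the powers \<open>f i l\<close>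
  and \<open>g i l\<close>. The relations at \<open>\<pi> = -e\<close> amount to congruences modulo \<open>4\<close> for \<open>f\<close> and \<open>g\<close>
  (\<open>twist_exponents\<close>). These can be solved (\<open>twist_exponents_exist\<close>): the weight lattice is a free
  set under translation by the root lattice, so it suffices to choose a bilinear form on the root lattice with
  prescribed antisymmetric part, and the parity conditions on the datum make the prescription consistent.
  That twisting produces a module is \<open>twisted_rep\<close>. Its action on morphisms is the identity, and twisting
  back with the inverse automorphism and the opposite exponents undoes it, so the identity maps form the natural
  isomorphisms of an equivalence (\<open>equivalence_Ct\<close>).

  For the characters no extension of scalars of modules is needed. In a simple module with highest weight
  vector \<open>x\<close> of weight \<open>l\<close>, the weight space of weight \<open>\<mu>\<close> is spanned by the \<open>F\<^sub>b x\<close>, where \<open>b\<close> is a word of weight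
  \<open>l - \<mu>\<close>, and by simplicity a vector in it vanishes as soon as all \<open>E\<^sub>a\<close> with \<open>a\<close> of weight \<open>l - \<mu>\<close> kill it
  (\<open>nondegenerate\<close>). Hence the dimension is the rank of the matrix \<open>P(a, b)\<close> defined by \<open>E\<^sub>a F\<^sub>b x = P(a, b) x\<close>,
  which depends only on \<open>l\<close>, \<open>v\<close> and \<open>\<pi>\<close>. The twistor computation shows that the matrix at \<open>\<pi> = -1\<close> arises
  from the one at \<open>\<pi> = 1\<close> by a field automorphism of \<open>\<rat>(v, t)\<close> and by rescaling rows and columns with powers of
  \<open>t\<close> (\<open>EF_matrix_twist\<close>). None of this changes which sets of columns are independent, and independence over
  \<open>\<rat>(v)\<close> and over \<open>\<rat>(v, t)\<close> agree (\<open>indep_cols_sign\<close>); so the ranks agree (\<open>char_U_sign\<close>).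
\<close>


section \<open>Scalars\<close>

locale ring_map =
  fixes h :: "'a :: comm_ring_1 \<Rightarrow> 'b :: comm_ring_1"
  assumes add: "h (x + y) = h x + h y"
    and mult: "h (x * y) = h x * h y"
    and one: "h 1 = 1"
begin

lemma zero: "h 0 = 0"
  using add [of 0 0] by simp

lemma minus: "h (- x) = - h x"
  using add [of x "- x"] by (simp add: zero eq_neg_iff_add_eq_0 add.commute)

lemma diff: "h (x - y) = h x - h y"
  using add [of x "- y"] by (simp add: minus)

lemma power: "h (x ^ n) = h x ^ n"
  by (induction n) (simp_all add: one mult)

lemma prod: "h (prod f A) = prod (\<lambda>a. h (f a)) A"
  by (induction A rule: infinite_finite_induct) (simp_all add: one mult)

end

lemma ring_map_comp:
  assumes "ring_map f" "ring_map g"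
  shows "ring_map (\<lambda>x. f (g x))"
proof -
  interpret f: ring_map f by fact
  interpret g: ring_map g by fact
  show ?thesis by unfold_locales (simp_all add: f.add f.mult f.one g.add g.mult g.one)
qed

locale field_map = ring_map h for h :: "'a :: field \<Rightarrow> 'b :: field"
begin

lemma eq_0_iff: "h x = 0 \<longleftrightarrow> x = 0"
proof
  assume "h x = 0"
  then have "h (x * inverse x) = 0" by (simp add: mult)
  then show "x = 0" by (cases "x = 0") (simp_all add: one)
qed (simp add: zero)

lemma inj: "h x = h y \<longleftrightarrow> x = y"
  using eq_0_iff [of "x - y"] by (simp add: diff)

lemma inverse: "h (inverse x) = inverse (h x)"
proof (cases "x = 0")
  case False
  then have "h x * h (inverse x) = 1" by (simp add: one flip: mult)
  then show ?thesis by (metis inverse_unique)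
qed (simp add: zero)

lemma divide: "h (x / y) = h x / h y"
  by (simp add: divide_inverse mult inverse)

lemma power_int: "h (x powi n) = h x powi n"
  by (simp add: power_int_def power inverse)

lemma of_int: "h (of_int e) = of_int e"
  by (induction e rule: int_induct [where k = 0]) (simp_all add: zero one add diff)

lemma cov_binom: "h (cov_binom w p n k) = cov_binom (h w) (h p) n k"
  by (simp add: cov_binom_def divide prod diff power mult power_int)

end

lemma ring_map_cov_spec:
  assumes "e * e = 1"
  shows "ring_map (cov_spec e :: 'a :: comm_ring_1 cov \<Rightarrow> 'a)"
proof
  have e: "of_int e * of_int e = (1 :: 'a)"
    using assms by (metis of_int_mult of_int_1)
  then have e': "of_int e * (of_int e * z) = z" for z :: 'a
    by (simp flip: mult.assoc)
  show "cov_spec e (x * y) = cov_spec e x * cov_spec e y" for x y :: "'a cov"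
    by (simp add: cov_spec_def times_cov_def algebra_simps e e')
qed (simp_all add: cov_spec_def plus_cov_def one_cov_def algebra_simps)

lemma sign_cases: "e = 1 \<or> e = - 1" if "e * e = 1" for e :: int
  using that by (simp add: zmult_eq_1_iff)

text \<open>A nonzero element of \<open>k[\<pi>]/(\<pi>\<^sup>2 - 1)\<close> can be a zero divisor. The units, on which \<^const>\<open>inverse\<close> is the
  true inverse, are the elements that do not vanish at \<open>\<pi> = 1\<close> and \<open>\<pi> = -1\<close>.\<close>

definition cov_unit :: "'a :: field cov \<Rightarrow> bool"
  where "cov_unit x \<longleftrightarrow> cov_spec 1 x \<noteq> 0 \<and> cov_spec (- 1) x \<noteq> 0"

lemma cov_spec_unit: "cov_unit x \<Longrightarrow> e * e = 1 \<Longrightarrow> cov_spec e x \<noteq> 0"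
  using sign_cases [of e] by (auto simp: cov_unit_def)

text \<open>The denominator \<open>a\<^sup>2 - b\<^sup>2\<close> in the inverse of \<open>a + b \<pi>\<close> is the product of the values at \<open>\<pi> = 1\<close> and
  \<open>\<pi> = -1\<close>.\<close>

lemma cov_spec_inverse:
  assumes "cov_unit x" "e * e = 1"
  shows "cov_spec e (inverse x) = inverse (cov_spec e x)"
proof -
  interpret ring_map "cov_spec e :: 'a cov \<Rightarrow> 'a" using assms by (intro ring_map_cov_spec)
  have "(cov0 x + cov1 x) * (cov0 x - cov1 x) \<noteq> 0"
    using assms by (simp add: cov_unit_def cov_spec_def)
  then have "(cov0 x)\<^sup>2 \<noteq> (cov1 x)\<^sup>2"
    by (simp add: algebra_simps power2_eq_square)
  then have "x * inverse x = 1" by (rule cov_right_inverse)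
  then have "cov_spec e x * cov_spec e (inverse x) = 1" by (simp add: one flip: mult)
  then show ?thesis by (metis inverse_unique)
qed

lemma cov_spec_divide:
  assumes "cov_unit y" "e * e = 1"
  shows "cov_spec e (x / y) = cov_spec e x / cov_spec e y"
proof -
  interpret ring_map "cov_spec e :: 'a cov \<Rightarrow> 'a" using assms by (intro ring_map_cov_spec)
  show ?thesis by (simp add: divide_cov_def mult cov_spec_inverse assms divide_inverse)
qed

lemma cov_spec_powi:
  assumes "cov_unit x" "e * e = 1"
  shows "cov_spec e (x powi n) = cov_spec e x powi n"
proof -
  interpret ring_map "cov_spec e :: 'a cov \<Rightarrow> 'a" using assms by (intro ring_map_cov_spec)
  show ?thesis by (simp add: power_int_def power cov_spec_inverse assms)
qed

lemma cov_unit_powi: "cov_unit x \<Longrightarrow> cov_unit (x powi n)"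
  unfolding cov_unit_def [of "x powi n"] by (simp add: cov_spec_powi cov_spec_unit)

lemma cov_unit_mult: "cov_unit x \<Longrightarrow> cov_unit y \<Longrightarrow> cov_unit (x * y)"
  using ring_map.mult [OF ring_map_cov_spec [of 1], of x y]
    ring_map.mult [OF ring_map_cov_spec [of "- 1"], of x y]
  by (auto simp: cov_unit_def)

lemma cov_unit_prod: "(\<And>a. a \<in> A \<Longrightarrow> cov_unit (f a)) \<Longrightarrow> cov_unit (prod f A)"
proof (induction A rule: infinite_finite_induct)
  case (insert x F)
  then show ?case by (simp add: cov_unit_mult)
qed (simp_all add: cov_unit_def cov_spec_def one_cov_def)

lemma cov_spec_U_v: "cov_spec e U_v = qv_v"
  by (simp add: cov_spec_def)

lemma cov_spec_pi: "cov_spec e cov_pi = of_int e"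
  by (simp add: cov_spec_def cov_pi_def)

lemma qv_v_nonzero: "qv_v \<noteq> 0"
  by (simp add: qv_v_def Zero_fract_def eq_fract)

lemma qv_v_power: "qv_v ^ n = Fract (monom 1 n) 1"
  by (induction n) (simp_all add: qv_v_def One_fract_def monom_0 monom_Suc one_pCons)

lemma qv_v_powi_eq_1: "qv_v powi n = 1 \<longleftrightarrow> n = 0"
proof -
  have *: "qv_v ^ n = 1 \<longleftrightarrow> n = 0" for n
    by (auto simp: qv_v_power One_fract_def eq_fract monom_eq_1_iff)
  show ?thesis
    by (cases "n \<ge> 0") (simp_all add: power_int_def * power_inverse)
qed

lemma cov_unit_U_v: "cov_unit U_v"
  by (simp add: cov_unit_def cov_spec_U_v qv_v_nonzero)

lemma cov_unit_pi: "cov_unit cov_pi"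
  by (simp add: cov_unit_def cov_spec_pi)

text \<open>Squaring \<open>e v\<^sup>2\<^sup>n = 1\<close> removes the sign and leaves \<open>v\<^sup>4\<^sup>n = 1\<close>.\<close>

lemma powi_eq_minus_neq:
  fixes v :: "'a :: field"
  assumes v: "v \<noteq> 0" "\<And>n. v powi n = 1 \<Longrightarrow> n = 0" and e: "e * e = (1 :: 'a)" and n: "n \<noteq> 0"
  shows "e * v powi n \<noteq> v powi (- n)"
proof
  assume "e * v powi n = v powi (- n)"
  then have "e * v powi n * v powi n = 1" using v(1)
    by (simp add: power_int_minus)
  then have "(e * v powi n * v powi n) * (e * v powi n * v powi n) = 1" by simp
  then have "(e * e) * (v powi n * v powi n * v powi n * v powi n) = 1"
    by (simp only: mult_ac)
  then have "v powi n * v powi n * v powi n * v powi n = 1" using e by simp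
  then have "v powi (4 * n) = 1"
    using v(1) by (simp flip: power_int_add)
  with v(2) n show False by fastforce
qed

lemma sign_powi:
  assumes "e * e = 1"
  shows "of_int e powi n * of_int e powi n = (1 :: 'a :: field)"
  using sign_cases [OF assms] by (auto simp: power_int_minus_one_mult_self simp flip: power_int_mult_distrib)

text \<open>The quantum integer \<open>[n]\<close> in the parameters \<open>w\<close> and \<open>\<pi> = e\<close> at a vertex with \<open>d\<^sub>i = d\<close>.\<close>

definition qint :: "'k :: field \<Rightarrow> int \<Rightarrow> int \<Rightarrow> int \<Rightarrow> 'k"
  where "qint w e d n =
    (of_int e powi (d * n) * w powi (d * n) - w powi (- (d * n))) /
    (of_int e powi d * w powi d - w powi (- d))"

text \<open>Together with the corresponding step for quantum binomials below, this makes the divisions in the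
  defining relations of \<open>U\<close> genuine: the denominators specialise to nonzero elements of \<open>\<rat>(v)\<close>.\<close>

lemma cov_unit_denominator:
  assumes "d \<noteq> 0"
  shows "cov_unit (cov_pi powi d * U_v powi d - U_v powi (- d))"
proof -
  have *: "cov_spec e (cov_pi powi d * U_v powi d - U_v powi (- d)) \<noteq> 0" if "e * e = 1" for e
  proof -
    interpret ring_map "cov_spec e :: qv cov \<Rightarrow> qv" using that by (intro ring_map_cov_spec)
    show ?thesis
      using powi_eq_minus_neq [of qv_v "of_int e powi d" d] assms sign_powi [OF that, of d, where 'a = qv]
      by (simp add: diff mult cov_spec_powi cov_unit_pi cov_unit_U_v that cov_spec_pi cov_spec_U_v
          qv_v_nonzero qv_v_powi_eq_1)
  qed
  show ?thesis by (simp add: cov_unit_def *)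
qed

lemma cov_spec_cov_binom:
  assumes d: "d \<noteq> 0" and e: "e * e = 1"
  shows "cov_spec e (cov_binom (U_v powi d) (cov_pi powi d) n k) =
    cov_binom (qv_v powi d) (of_int e powi d) n k"
proof -
  have u: "cov_unit ((cov_pi powi d * U_v powi d) ^ l - (U_v powi d) powi (- int l))"
    if "l \<in> {1..k}" for l
  proof -
    have *: "cov_spec s ((cov_pi powi d * U_v powi d) ^ l - (U_v powi d) powi (- int l)) \<noteq> 0"
      if s: "s * s = 1" for s
    proof -
      interpret ring_map "cov_spec s :: qv cov \<Rightarrow> qv" using s by (intro ring_map_cov_spec)
      have "(of_int s powi d) ^ l * (of_int s powi d) ^ l = (1 :: qv)"
        by (simp add: sign_powi [OF s] flip: power_mult_distrib)
      moreover have "d * int l \<noteq> 0" using d \<open>l \<in> _\<close> by simp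
      ultimately have "(of_int s powi d) ^ l * qv_v powi (d * int l) \<noteq> qv_v powi (- (d * int l))"
        by (intro powi_eq_minus_neq qv_v_nonzero) (simp_all add: qv_v_powi_eq_1)
      then show ?thesis
        by (simp add: diff mult power cov_spec_powi cov_unit_pi cov_unit_U_v s cov_spec_pi cov_spec_U_v
            cov_unit_powi power_mult_distrib flip: power_int_mult power_int_power')
    qed
    show ?thesis by (simp add: cov_unit_def *)
  qed
  interpret ring_map "cov_spec e :: qv cov \<Rightarrow> qv" using e by (intro ring_map_cov_spec)
  show ?thesis unfolding cov_binom_def
    by (subst cov_spec_divide [OF cov_unit_prod [OF u] e])
      (simp_all add: prod diff mult power cov_spec_powi cov_unit_pi cov_unit_U_v e cov_spec_pi
        cov_spec_U_v cov_unit_powi)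
qed


subsection \<open>The automorphism \<open>v \<mapsto> t\<^sup>\<plusminus>\<^sup>1 v\<close> of \<open>\<rat>(v, t)\<close>\<close>

definition qvt_t :: qvt
  where "qvt_t = Gauss 0 1"

lemma qvt_t_mult: "qvt_t * qvt_t = - 1"
  by (simp add: qvt_t_def gauss_eq_iff times_gauss_def uminus_gauss_def one_gauss_def)

lemma qvt_t_nonzero: "qvt_t \<noteq> 0"
  by (simp add: qvt_t_def gauss_eq_iff zero_gauss_def)

lemma field_map_qvt_of: "field_map qvt_of"
  by unfold_locales (simp_all add: qvt_of_def gauss_eq_iff times_gauss_def plus_gauss_def one_gauss_def)

lemma Gauss_eq: "Gauss a b = qvt_of a + qvt_t * qvt_of b"
  by (simp add: qvt_t_def qvt_of_def gauss_eq_iff times_gauss_def plus_gauss_def)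

text \<open>Evaluation of a polynomial in \<open>v\<close> at \<open>z\<close>, where rational coefficients enter as constant fractions.\<close>

definition poly_at :: "qvt \<Rightarrow> rat poly \<Rightarrow> qvt"
  where "poly_at z p = fold_coeffs (\<lambda>a y. qvt_of (Fract [:a:] 1) + z * y) p 0"

interpretation qvt_of: field_map qvt_of by (rule field_map_qvt_of)

lemma Fract_0_1: "Fract 0 1 = 0"
  by (simp add: Zero_fract_def)

lemma Fract_const_add: "Fract [:a + b:] 1 = Fract [:a:] 1 + Fract [:b:] 1"
  by simp

lemma Fract_const_mult: "Fract [:a * b:] 1 = Fract [:a:] 1 * Fract [:b :: 'a :: idom:] 1"
  by (simp add: mult.commute)

lemma poly_at_0: "poly_at z 0 = 0"
  by (simp add: poly_at_def)

lemma poly_at_pCons: "poly_at z (pCons a p) = qvt_of (Fract [:a:] 1) + z * poly_at z p"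
  by (cases "a = 0 \<and> p = 0") (auto simp: poly_at_def Fract_0_1 qvt_of.zero)

lemma poly_at_1: "poly_at z 1 = 1"
  by (simp add: One_fract_def one_pCons poly_at_pCons poly_at_0 flip: qvt_of.one)

lemma poly_at_add: "poly_at z (p + q) = poly_at z p + poly_at z q"
  by (induction p q rule: poly_induct2)
    (simp_all only: add_pCons poly_at_pCons poly_at_0 Fract_const_add qvt_of.add algebra_simps add_0)

lemma poly_at_smult: "poly_at z (smult a p) = qvt_of (Fract [:a:] 1) * poly_at z p"
  by (induction p) (simp_all only: smult_pCons poly_at_pCons poly_at_0 Fract_const_mult qvt_of.mult
      ac_simps distrib_left smult_0_right mult_zero_right mult_zero_left)

lemma poly_at_mult: "poly_at z (p * q) = poly_at z p * poly_at z q"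
  by (induction p) (simp_all add: mult_pCons_left poly_at_pCons poly_at_0 poly_at_add poly_at_smult
      Fract_0_1 qvt_of.zero algebra_simps)

text \<open>\<open>t\<^sup>\<plusminus>\<^sup>1v\<close> is transcendental: in \<open>p(t\<^sup>\<plusminus>\<^sup>1v)\<close> each coefficient of \<open>p\<close> lands, up to sign, either in the
  real part or in the imaginary part.\<close>

lemma poly_at_twist_parts:
  assumes "e * e = 1"
  shows "\<exists>A B. poly_at (of_int e * qvt_t * qvt_of qv_v) p = Gauss (Fract A 1) (Fract B 1) \<and>
    (\<forall>n. (coeff A n)\<^sup>2 + (coeff B n)\<^sup>2 = (coeff p n)\<^sup>2)"
proof (induction p)
  case 0
  show ?case by (rule exI [of _ 0])+ (simp add: poly_at_0 zero_gauss_def Fract_0_1)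
next
  case (pCons a p)
  then obtain A B where AB: "poly_at (of_int e * qvt_t * qvt_of qv_v) p = Gauss (Fract A 1) (Fract B 1)"
    "\<And>n. (coeff A n)\<^sup>2 + (coeff B n)\<^sup>2 = (coeff p n)\<^sup>2" by blast
  have v: "qv_v * Fract P 1 = Fract (pCons 0 P) 1" for P
    by (simp add: qv_v_def)
  have a: "Fract [:a:] 1 + Fract (pCons 0 P) 1 = Fract (pCons a P) 1" for P by simp
  have m: "- Fract P 1 = Fract (- P) 1" for P :: "rat poly" by simp
  have t: "qvt_t * Gauss x y = Gauss (- y) x" for x y
    by (simp add: qvt_t_def times_gauss_def)
  have w: "qvt_of qv_v * Gauss (Fract P 1) (Fract Q 1) = Gauss (Fract (pCons 0 P) 1) (Fract (pCons 0 Q) 1)"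
    for P Q by (simp add: qvt_of_def times_gauss_def v)
  have s: "qvt_of (Fract [:a:] 1) + Gauss (Fract (pCons 0 P) 1) (Fract (pCons 0 Q) 1) =
      Gauss (Fract (pCons a P) 1) (Fract (pCons 0 Q) 1)" for P Q
    by (simp add: qvt_of_def plus_gauss_def)
  have e: "of_int e * Gauss (Fract P 1) (Fract Q 1) =
      Gauss (Fract (smult (of_int e) P) 1) (Fract (smult (of_int e) Q) 1)" for P Q
    using sign_cases [OF assms]
  proof
    assume "e = - 1"
    then have "of_int e * Gauss (Fract P 1) (Fract Q 1) = - Gauss (Fract P 1) (Fract Q 1)" by simp
    then show ?thesis using \<open>e = - 1\<close> by (simp add: uminus_gauss_def)
  qed simp
  have ee: "(of_int e)\<^sup>2 = (1 :: rat)" using sign_cases [OF assms] by auto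
  have "poly_at (of_int e * qvt_t * qvt_of qv_v) (pCons a p) =
      Gauss (Fract (pCons a (- smult (of_int e) B)) 1) (Fract (pCons 0 (smult (of_int e) A)) 1)"
  proof -
    have "poly_at (of_int e * qvt_t * qvt_of qv_v) (pCons a p) = qvt_of (Fract [:a:] 1) +
        qvt_t * (qvt_of qv_v * (of_int e * Gauss (Fract A 1) (Fract B 1)))"
      by (simp only: poly_at_pCons AB(1)) (simp only: mult_ac)
    then show ?thesis by (simp add: e w t) (simp add: s qvt_of_def plus_gauss_def)
  qed
  moreover have "(coeff (pCons a (- smult (of_int e) B)) n)\<^sup>2 + (coeff (pCons 0 (smult (of_int e) A)) n)\<^sup>2 =
      (coeff (pCons a p) n)\<^sup>2" for n
    by (cases n) (simp_all add: power_mult_distrib ee AB(2) [symmetric])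
  ultimately show ?case by blast
qed

lemma poly_at_twist_eq_0:
  assumes "e * e = 1"
  shows "poly_at (of_int e * qvt_t * qvt_of qv_v) p = 0 \<longleftrightarrow> p = 0"
proof
  assume p: "poly_at (of_int e * qvt_t * qvt_of qv_v) p = 0"
  obtain A B where AB: "poly_at (of_int e * qvt_t * qvt_of qv_v) p = Gauss (Fract A 1) (Fract B 1)"
    "\<And>n. (coeff A n)\<^sup>2 + (coeff B n)\<^sup>2 = (coeff p n)\<^sup>2" using poly_at_twist_parts [OF assms] by blast
  then have "A = 0" "B = 0" using p by (simp_all add: zero_gauss_def Zero_fract_def eq_fract)
  then show "p = 0" using AB(2) by (simp add: poly_eq_iff)
qed (simp add: poly_at_0)

text \<open>The extension of evaluation at a transcendental element to fractions; the value does not depend on the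
  chosen numerator and denominator.\<close>

definition frac_at :: "qvt \<Rightarrow> qv \<Rightarrow> qvt"
  where "frac_at z a = (SOME y. \<exists>p q. q \<noteq> 0 \<and> a = Fract p q \<and> y = poly_at z p / poly_at z q)"

text \<open>The automorphism that fixes \<open>t\<close> and sends \<open>v\<close> to \<open>t\<^sup>e v\<close>, where \<open>e = \<plusminus>1\<close> and so \<open>t\<^sup>e = e t\<close>.\<close>

definition twist_scal :: "int \<Rightarrow> qvt \<Rightarrow> qvt"
  where "twist_scal e x = frac_at (of_int e * qvt_t * qvt_of qv_v) (gauss0 x) +
    qvt_t * frac_at (of_int e * qvt_t * qvt_of qv_v) (gauss1 x)"

context
  fixes z :: qvt
  assumes z: "\<And>p. poly_at z p = 0 \<longleftrightarrow> p = 0"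
begin

lemma frac_at_Fract:
  assumes q: "q \<noteq> 0"
  shows "frac_at z (Fract p q) = poly_at z p / poly_at z q"
proof -
  have "\<exists>y. \<exists>p' q'. q' \<noteq> 0 \<and> Fract p q = Fract p' q' \<and> y = poly_at z p' / poly_at z q'"
    using q by blast
  from someI_ex [OF this] obtain p' q' where
    *: "q' \<noteq> 0" "Fract p q = Fract p' q'" "frac_at z (Fract p q) = poly_at z p' / poly_at z q'"
    unfolding frac_at_def by blast
  then have "p * q' = p' * q" using q by (simp add: eq_fract)
  then have "poly_at z p * poly_at z q' = poly_at z p' * poly_at z q" by (metis poly_at_mult)
  then show ?thesis using * q by (simp add: frac_eq_eq z)
qed

lemma field_map_frac_at: "field_map (frac_at z)"
proof
  fix x y :: qv
  obtain a b c d where xy: "x = Fract a b" "b \<noteq> 0" "y = Fract c d" "d \<noteq> 0"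
    by (metis Fract_cases)
  then show "frac_at z (x + y) = frac_at z x + frac_at z y"
    by (simp add: frac_at_Fract poly_at_add poly_at_mult add_frac_eq z)
  show "frac_at z (x * y) = frac_at z x * frac_at z y"
    using xy by (simp add: frac_at_Fract poly_at_mult)
next
  show "frac_at z 1 = 1" by (simp add: One_fract_def frac_at_Fract poly_at_1)
qed

lemma frac_at_v: "frac_at z qv_v = z"
  by (simp add: qv_v_def frac_at_Fract poly_at_1 poly_at_pCons poly_at_0 Fract_0_1 qvt_of.zero qvt_of.one
    flip: One_fract_def one_pCons)

lemma frac_at_const: "frac_at z (Fract [:a:] 1) = qvt_of (Fract [:a:] 1)"
  by (simp add: frac_at_Fract poly_at_1 poly_at_pCons poly_at_0)

end

lemma twist_scal_qvt_of:
  assumes "e * e = 1"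
  shows "twist_scal e (qvt_of a) = frac_at (of_int e * qvt_t * qvt_of qv_v) a"
proof -
  interpret f: field_map "frac_at (of_int e * qvt_t * qvt_of qv_v)"
    by (rule field_map_frac_at) (rule poly_at_twist_eq_0 [OF assms])
  have "gauss0 (qvt_of a) = a" "gauss1 (qvt_of a) = 0" by (simp_all add: qvt_of_def)
  then show ?thesis by (simp add: twist_scal_def f.zero)
qed

lemma field_map_twist_scal:
  assumes "e * e = 1"
  shows "field_map (twist_scal e)"
proof -
  define \<phi> where "\<phi> = frac_at (of_int e * qvt_t * qvt_of qv_v)"
  interpret f: field_map \<phi>
    unfolding \<phi>_def by (rule field_map_frac_at) (rule poly_at_twist_eq_0 [OF assms])
  have t: "qvt_t * (qvt_t * x) = - x" for x by (simp add: qvt_t_mult flip: mult.assoc)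
  have *: "twist_scal e x = \<phi> (gauss0 x) + qvt_t * \<phi> (gauss1 x)" for x
    by (simp add: twist_scal_def \<phi>_def)
  have g: "gauss0 (x + y) = gauss0 x + gauss0 y" "gauss1 (x + y) = gauss1 x + gauss1 y"
    "gauss0 (x * y) = gauss0 x * gauss0 y - gauss1 x * gauss1 y"
    "gauss1 (x * y) = gauss0 x * gauss1 y + gauss1 x * gauss0 y"
    "gauss0 (1 :: qvt) = 1" "gauss1 (1 :: qvt) = 0" for x y :: qvt
    by (simp_all add: plus_gauss_def times_gauss_def one_gauss_def)
  show ?thesis
    by unfold_locales (simp_all add: * g f.add f.diff f.mult f.one f.zero distrib_left distrib_right t mult_ac)
qed

lemma twist_scal_t:
  assumes "e * e = 1"
  shows "twist_scal e qvt_t = qvt_t"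
proof -
  interpret f: field_map "frac_at (of_int e * qvt_t * qvt_of qv_v)"
    by (rule field_map_frac_at) (rule poly_at_twist_eq_0 [OF assms])
  have "gauss0 qvt_t = 0" "gauss1 qvt_t = 1" by (simp_all add: qvt_t_def)
  then show ?thesis by (simp add: twist_scal_def f.zero f.one)
qed

lemma twist_scal_v:
  assumes "e * e = 1"
  shows "twist_scal e (qvt_of qv_v) = of_int e * qvt_t * qvt_of qv_v"
  by (simp add: twist_scal_qvt_of assms frac_at_v poly_at_twist_eq_0)

text \<open>An endomorphism of \<open>\<rat>(v, t)\<close> is determined by the images of \<open>v\<close> and \<open>t\<close>.\<close>

lemma twist_scal_inverse:
  assumes e: "e * e = 1"
  shows "twist_scal (- e) (twist_scal e x) = x"
proof -
  have e': "(- e) * (- e) = 1" using e by simp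
  interpret f: field_map "twist_scal e" by (rule field_map_twist_scal [OF e])
  interpret g: field_map "twist_scal (- e)" by (rule field_map_twist_scal [OF e'])
  define s where "s x = twist_scal (- e) (twist_scal e x)" for x
  have s: "s (x + y) = s x + s y" "s (x * y) = s x * s y" "s (x / y) = s x / s y" "s 0 = 0" for x y
    by (simp_all add: s_def f.add g.add f.mult g.mult f.divide g.divide f.zero g.zero)
  have int: "twist_scal (- e) (of_int e) = of_int e"
    using sign_cases [OF e] g.one g.minus [of 1] by auto
  have st: "s qvt_t = qvt_t" by (simp add: s_def twist_scal_t e)
  have ee: "of_int e * of_int e = (1 :: qvt)" using e by (metis of_int_mult of_int_1)
  have "s (qvt_of qv_v) = of_int e * qvt_t * (- of_int e * qvt_t * qvt_of qv_v)"
    using twist_scal_v [OF e'] by (simp add: s_def twist_scal_v e g.mult twist_scal_t [OF e'] int)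
  also have "\<dots> = - (of_int e * of_int e) * (qvt_t * qvt_t) * qvt_of qv_v" by (simp add: mult_ac)
  finally have sv: "s (qvt_of qv_v) = qvt_of qv_v" by (simp add: ee qvt_t_mult)
  have sc: "s (qvt_of (Fract [:a:] 1)) = qvt_of (Fract [:a:] 1)" for a
  proof -
    have *: "twist_scal d (qvt_of (Fract [:a:] 1)) = qvt_of (Fract [:a:] 1)" if d: "d * d = 1" for d
    proof -
      have "frac_at (of_int d * qvt_t * qvt_of qv_v) (Fract [:a:] 1) = qvt_of (Fract [:a:] 1)"
        by (rule frac_at_const) (rule poly_at_twist_eq_0 [OF d])
      then show ?thesis by (simp add: twist_scal_qvt_of d)
    qed
    show ?thesis by (simp add: s_def * e)
  qed
  have sp: "s (qvt_of (Fract p 1)) = qvt_of (Fract p 1)" for p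
  proof (induction p)
    case (pCons a p)
    have "Fract (pCons a p) 1 = Fract [:a:] 1 + qv_v * Fract p 1" by (simp add: qv_v_def)
    then show ?case by (simp add: qvt_of.add qvt_of.mult s sc sv pCons)
  qed (simp add: Fract_0_1 qvt_of.zero s)
  have sq: "s (qvt_of a) = qvt_of a" for a
  proof -
    obtain p q where "a = Fract p q" "q \<noteq> 0" by (metis Fract_cases)
    then have "qvt_of a = qvt_of (Fract p 1) / qvt_of (Fract q 1)" by (simp flip: qvt_of.divide)
    then show ?thesis by (simp only: s sp)
  qed
  have "s (Gauss a b) = Gauss a b" for a b
    by (simp add: Gauss_eq s sq st)
  then have "s x = x" by (metis gauss.collapse)
  then show ?thesis by (simp add: s_def)
qed


section \<open>Actions of rings on abelian groups\<close>

text \<open>The conditions of \<^const>\<open>left_module\<close> with the action as a separate argument, so that several rings can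
  act on one abelian group without being packed into its record.\<close>

definition action :: "('a, 'z) ring_scheme \<Rightarrow> ('m, 'w) ring_scheme \<Rightarrow> ('a \<Rightarrow> 'm \<Rightarrow> 'm) \<Rightarrow> bool"
  where "action A M \<alpha> \<longleftrightarrow>
    (\<forall>a \<in> carrier A. \<forall>m \<in> carrier M. \<alpha> a m \<in> carrier M) \<and>
    (\<forall>a \<in> carrier A. \<forall>b \<in> carrier A. \<forall>m \<in> carrier M. \<alpha> (a \<oplus>\<^bsub>A\<^esub> b) m = \<alpha> a m \<oplus>\<^bsub>M\<^esub> \<alpha> b m) \<and>
    (\<forall>a \<in> carrier A. \<forall>m \<in> carrier M. \<forall>n \<in> carrier M. \<alpha> a (m \<oplus>\<^bsub>M\<^esub> n) = \<alpha> a m \<oplus>\<^bsub>M\<^esub> \<alpha> a n) \<and>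
    (\<forall>a \<in> carrier A. \<forall>b \<in> carrier A. \<forall>m \<in> carrier M. \<alpha> (a \<otimes>\<^bsub>A\<^esub> b) m = \<alpha> a (\<alpha> b m)) \<and>
    (\<forall>m \<in> carrier M. \<alpha> \<one>\<^bsub>A\<^esub> m = m)"

lemma left_module_iff_action: "left_module A M \<longleftrightarrow> abelian_group M \<and> action A M (module.smult M)"
  by (simp add: left_module_def action_def)

lemma action_as_algebra: "action (as_algebra A h) M \<alpha> \<longleftrightarrow> action A M \<alpha>"
  by (simp add: action_def as_algebra_def)

lemma actionD:
  assumes "action A M \<alpha>"
  shows "a \<in> carrier A \<Longrightarrow> m \<in> carrier M \<Longrightarrow> \<alpha> a m \<in> carrier M"
    and "a \<in> carrier A \<Longrightarrow> b \<in> carrier A \<Longrightarrow> m \<in> carrier M \<Longrightarrow> \<alpha> (a \<oplus>\<^bsub>A\<^esub> b) m = \<alpha> a m \<oplus>\<^bsub>M\<^esub> \<alpha> b m"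
    and "a \<in> carrier A \<Longrightarrow> m \<in> carrier M \<Longrightarrow> n \<in> carrier M \<Longrightarrow> \<alpha> a (m \<oplus>\<^bsub>M\<^esub> n) = \<alpha> a m \<oplus>\<^bsub>M\<^esub> \<alpha> a n"
    and "a \<in> carrier A \<Longrightarrow> b \<in> carrier A \<Longrightarrow> m \<in> carrier M \<Longrightarrow> \<alpha> (a \<otimes>\<^bsub>A\<^esub> b) m = \<alpha> a (\<alpha> b m)"
    and "m \<in> carrier M \<Longrightarrow> \<alpha> \<one>\<^bsub>A\<^esub> m = m"
  using assms by (simp_all add: action_def)

definition add_hom :: "('m, 'w) ring_scheme \<Rightarrow> ('n, 'v) ring_scheme \<Rightarrow> ('m \<Rightarrow> 'n) \<Rightarrow> bool"
  where "add_hom M N f \<longleftrightarrow> (\<forall>x \<in> carrier M. f x \<in> carrier N) \<and>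
    (\<forall>x \<in> carrier M. \<forall>y \<in> carrier M. f (x \<oplus>\<^bsub>M\<^esub> y) = f x \<oplus>\<^bsub>N\<^esub> f y)"

lemma add_homD:
  assumes "add_hom M N f"
  shows "x \<in> carrier M \<Longrightarrow> f x \<in> carrier N"
    and "x \<in> carrier M \<Longrightarrow> y \<in> carrier M \<Longrightarrow> f (x \<oplus>\<^bsub>M\<^esub> y) = f x \<oplus>\<^bsub>N\<^esub> f y"
  using assms by (simp_all add: add_hom_def)

lemma add_hom_zero:
  assumes "abelian_group M" "abelian_group N" "add_hom M N f"
  shows "f \<zero>\<^bsub>M\<^esub> = \<zero>\<^bsub>N\<^esub>"
proof -
  interpret M: abelian_group M by fact
  interpret N: abelian_group N by fact
  have "f \<zero>\<^bsub>M\<^esub> = f \<zero>\<^bsub>M\<^esub> \<oplus>\<^bsub>N\<^esub> f \<zero>\<^bsub>M\<^esub>"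
    using add_homD (2) [OF assms(3), of "\<zero>\<^bsub>M\<^esub>" "\<zero>\<^bsub>M\<^esub>"] by simp
  then show ?thesis using add_homD (1) [OF assms(3), of "\<zero>\<^bsub>M\<^esub>"]
    by (metis M.zero_closed N.add.r_cancel_one')
qed

lemma add_hom_minus:
  assumes "abelian_group M" "abelian_group N" "add_hom M N f" "x \<in> carrier M"
  shows "f (\<ominus>\<^bsub>M\<^esub> x) = \<ominus>\<^bsub>N\<^esub> f x"
proof -
  interpret M: abelian_group M by fact
  interpret N: abelian_group N by fact
  have "f (\<ominus>\<^bsub>M\<^esub> x) \<oplus>\<^bsub>N\<^esub> f x = \<zero>\<^bsub>N\<^esub>"
    using add_homD (2) [OF assms(3), of "\<ominus>\<^bsub>M\<^esub> x" x] add_hom_zero [OF assms(1-3)] assms(4) by (simp add: M.l_neg)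
  then show ?thesis using add_homD (1) [OF assms(3)] assms(4)
    by (simp add: N.minus_equality)
qed

lemma add_hom_finsum:
  assumes "abelian_group M" "abelian_group N" "add_hom M N f" "finite A" "g \<in> A \<rightarrow> carrier M"
  shows "f (finsum M g A) = finsum N (\<lambda>a. f (g a)) A"
proof -
  interpret M: abelian_group M by fact
  interpret N: abelian_group N by fact
  show ?thesis using assms(4,5)
  proof (induction A rule: finite_induct)
    case empty
    then show ?case by (simp add: add_hom_zero [OF assms(1-3)])
  next
    case (insert a A)
    then have "g \<in> A \<rightarrow> carrier M" "g a \<in> carrier M" by auto
    moreover have "(\<lambda>a. f (g a)) \<in> A \<rightarrow> carrier N" "f (g a) \<in> carrier N"
      using insert.prems add_homD (1) [OF assms(3)] by auto
    ultimately show ?case using insert by (simp add: add_homD [OF assms(3)])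
  qed
qed

lemma action_add_hom: "action A M \<alpha> \<Longrightarrow> a \<in> carrier A \<Longrightarrow> add_hom M M (\<alpha> a)"
  by (simp add: action_def add_hom_def)

lemma action_add_hom_left:
  "ring A \<Longrightarrow> action A M \<alpha> \<Longrightarrow> m \<in> carrier M \<Longrightarrow> add_hom A M (\<lambda>a. \<alpha> a m)"
  by (simp add: action_def add_hom_def)

lemma action_zero:
  assumes "abelian_group M" "ring A" "action A M \<alpha>" "m \<in> carrier M"
  shows "\<alpha> \<zero>\<^bsub>A\<^esub> m = \<zero>\<^bsub>M\<^esub>"
  using add_hom_zero [OF ring.is_abelian_group [OF assms(2)] assms(1) action_add_hom_left [OF assms(2-4)]] .

lemma action_minus:
  assumes "abelian_group M" "ring A" "action A M \<alpha>" "m \<in> carrier M" "a \<in> carrier A"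
  shows "\<alpha> (\<ominus>\<^bsub>A\<^esub> a) m = \<ominus>\<^bsub>M\<^esub> \<alpha> a m"
  using add_hom_minus [OF ring.is_abelian_group [OF assms(2)] assms(1) action_add_hom_left [OF assms(2-4)] assms(5)] .

lemma annihilator_ideal:
  assumes M: "abelian_group M" and R: "ring R" and act: "action R M \<alpha>"
  shows "ideal {r \<in> carrier R. \<forall>m \<in> carrier M. \<alpha> r m = \<zero>\<^bsub>M\<^esub>} R"
proof -
  interpret M: abelian_group M by fact
  interpret R: ring R by fact
  note D = actionD [OF act]
  have z: "\<alpha> a \<zero>\<^bsub>M\<^esub> = \<zero>\<^bsub>M\<^esub>" if "a \<in> carrier R" for a
    by (rule add_hom_zero [OF M M action_add_hom [OF act that]])
  show ?thesis
  proof (rule idealI [OF R])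
    show "subgroup {r \<in> carrier R. \<forall>m\<in>carrier M. \<alpha> r m = \<zero>\<^bsub>M\<^esub>} (add_monoid R)"
      by (rule R.add.subgroupI)
        (auto simp: D action_minus [OF M R act] intro!: exI [of _ "\<zero>\<^bsub>R\<^esub>"] simp flip: a_inv_def
          intro: action_zero [OF M R act])
  qed (auto simp: D z)
qed

text \<open>The annihilator is an ideal, so it contains an ideal as soon as it contains generators of it.\<close>

lemma action_quotient:
  assumes M: "abelian_group M" and R: "ring R" and act: "action R M \<alpha>"
    and S: "S \<subseteq> carrier R" "\<And>r m. r \<in> S \<Longrightarrow> m \<in> carrier M \<Longrightarrow> \<alpha> r m = \<zero>\<^bsub>M\<^esub>"
  shows "\<exists>\<beta>. action (R Quot (Idl\<^bsub>R\<^esub> S)) M \<beta> \<and>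
    (\<forall>r \<in> carrier R. \<forall>m \<in> carrier M. \<beta> (Idl\<^bsub>R\<^esub> S +>\<^bsub>R\<^esub> r) m = \<alpha> r m)"
proof -
  interpret M: abelian_group M by fact
  interpret R: ring R by fact
  note D = actionD [OF act]
  define I where "I = Idl\<^bsub>R\<^esub> S"
  interpret ideal I R unfolding I_def by (rule R.genideal_ideal) fact
  have I0: "\<alpha> i m = \<zero>\<^bsub>M\<^esub>" if "i \<in> I" "m \<in> carrier M" for i m
    using R.genideal_minimal [OF annihilator_ideal [OF M R act], of S] S that by (auto simp: I_def)
  define \<beta> where "\<beta> X m = \<alpha> (SOME r. r \<in> carrier R \<and> X = I +>\<^bsub>R\<^esub> r) m" for X m
  have \<beta>: "\<beta> (I +>\<^bsub>R\<^esub> r) m = \<alpha> r m" if "r \<in> carrier R" "m \<in> carrier M" for r m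
  proof -
    \<comment> \<open>the chosen representative differs from \<open>r\<close> by an element of \<open>I\<close>, which acts as zero\<close>
    define s where "s = (SOME s. s \<in> carrier R \<and> I +>\<^bsub>R\<^esub> r = I +>\<^bsub>R\<^esub> s)"
    have s: "s \<in> carrier R \<and> I +>\<^bsub>R\<^esub> r = I +>\<^bsub>R\<^esub> s"
      unfolding s_def by (rule someI [of _ r]) (simp add: that)
    then have "s \<in> I +>\<^bsub>R\<^esub> r"
      using a_rcos_self by metis
    then obtain i where i: "i \<in> I" "s = i \<oplus>\<^bsub>R\<^esub> r" by (auto simp: a_r_coset_def' )
    then show ?thesis using that a_subset
      by (simp add: \<beta>_def D I0 subset_iff flip: s_def)
  qed
  have "action (R Quot I) M \<beta>"
    unfolding action_def
    by (auto simp: FactRing_simps rcoset_mult_add a_rcos_sum \<beta> D)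
  then show ?thesis using \<beta> unfolding I_def by blast
qed

text \<open>Generation is phrased as an induction principle, since it serves only to extend closure properties from
  the generators to the whole algebra.\<close>

definition generates :: "('r, 'a) module \<Rightarrow> 'a set \<Rightarrow> bool"
  where "generates A G \<longleftrightarrow> (\<forall>Q. (\<forall>r. Q (r \<odot>\<^bsub>A\<^esub> \<one>\<^bsub>A\<^esub>)) \<and> (\<forall>g \<in> G. Q g) \<and>
    (\<forall>a \<in> carrier A. \<forall>b \<in> carrier A. Q a \<and> Q b \<longrightarrow> Q (a \<otimes>\<^bsub>A\<^esub> b) \<and> Q (a \<ominus>\<^bsub>A\<^esub> b)) \<longrightarrow>
    (\<forall>a \<in> carrier A. Q a))"

lemma generatesI:
  assumes "\<And>Q a. (\<And>r. Q (r \<odot>\<^bsub>A\<^esub> \<one>\<^bsub>A\<^esub>)) \<Longrightarrow> (\<And>g. g \<in> G \<Longrightarrow> Q g) \<Longrightarrow>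
    (\<And>a b. a \<in> carrier A \<Longrightarrow> b \<in> carrier A \<Longrightarrow> Q a \<Longrightarrow> Q b \<Longrightarrow> Q (a \<otimes>\<^bsub>A\<^esub> b)) \<Longrightarrow>
    (\<And>a b. a \<in> carrier A \<Longrightarrow> b \<in> carrier A \<Longrightarrow> Q a \<Longrightarrow> Q b \<Longrightarrow> Q (a \<ominus>\<^bsub>A\<^esub> b)) \<Longrightarrow>
    a \<in> carrier A \<Longrightarrow> Q a"
  shows "generates A G"
  unfolding generates_def
proof (intro allI impI ballI)
  fix Q a
  assume "(\<forall>r. Q (r \<odot>\<^bsub>A\<^esub> \<one>\<^bsub>A\<^esub>)) \<and> (\<forall>g \<in> G. Q g) \<and>
    (\<forall>a \<in> carrier A. \<forall>b \<in> carrier A. Q a \<and> Q b \<longrightarrow> Q (a \<otimes>\<^bsub>A\<^esub> b) \<and> Q (a \<ominus>\<^bsub>A\<^esub> b))"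
    and "a \<in> carrier A"
  then show "Q a" by (intro assms [of Q a]) simp_all
qed

lemma generates_induct [consumes 2, case_names scal gen mult diff]:
  assumes "generates A G" "a \<in> carrier A"
    and "\<And>r. Q (r \<odot>\<^bsub>A\<^esub> \<one>\<^bsub>A\<^esub>)" "\<And>g. g \<in> G \<Longrightarrow> Q g"
    and "\<And>a b. a \<in> carrier A \<Longrightarrow> b \<in> carrier A \<Longrightarrow> Q a \<Longrightarrow> Q b \<Longrightarrow> Q (a \<otimes>\<^bsub>A\<^esub> b)"
    and "\<And>a b. a \<in> carrier A \<Longrightarrow> b \<in> carrier A \<Longrightarrow> Q a \<Longrightarrow> Q b \<Longrightarrow> Q (a \<ominus>\<^bsub>A\<^esub> b)"
  shows "Q a"
  using assms(1) [unfolded generates_def, rule_format, of Q a] assms(2-) by simp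

section \<open>Additive maps out of groups of finitely supported functions\<close>

text \<open>The additive map that sends the point mass \<open>c\<close> at \<open>b\<close> to \<open>g b c\<close>. It serves for free abelian groups (integer
  coefficients) and for free algebras (coefficients in the base ring) alike.\<close>

definition pm_extend :: "('m, 'w) ring_scheme \<Rightarrow> ('b \<Rightarrow> 'c :: zero \<Rightarrow> 'm) \<Rightarrow> ('b \<Rightarrow>\<^sub>0 'c) \<Rightarrow> 'm"
  where "pm_extend M g p = finsum M (\<lambda>b. g b (Poly_Mapping.lookup p b)) (Poly_Mapping.keys p)"

locale pm_extension = abelian_group M
  for M (structure) and g :: "'b \<Rightarrow> 'c :: ab_group_add \<Rightarrow> 'm" +
  assumes closed [simp]: "g b c \<in> carrier M"
    and add: "g b (c + d) = g b c \<oplus> g b d"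
begin

lemma zero [simp]: "g b 0 = \<zero>"
  using add [of b 0 0] by (metis add_0 closed local.add.r_cancel_one')

lemma extend_superset:
  assumes "finite B" "Poly_Mapping.keys p \<subseteq> B"
  shows "pm_extend M g p = (\<Oplus>b\<in>B. g b (Poly_Mapping.lookup p b))"
  unfolding pm_extend_def
  by (rule add.finprod_mono_neutral_cong_left) (use assms in \<open>auto simp: in_keys_iff\<close>)

lemma extend_closed [simp]: "pm_extend M g p \<in> carrier M"
  by (simp add: pm_extend_def)

lemma extend_add: "pm_extend M g (p + q) = pm_extend M g p \<oplus> pm_extend M g q"
proof -
  have "Poly_Mapping.keys (p + q) \<subseteq> Poly_Mapping.keys p \<union> Poly_Mapping.keys q"
    by (rule Poly_Mapping.keys_add)
  then show ?thesis
    by (simp add: extend_superset [of "Poly_Mapping.keys p \<union> Poly_Mapping.keys q"] lookup_add add finsum_addf)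
qed

lemma extend_single: "pm_extend M g (Poly_Mapping.single b c) = g b c"
  by (cases "c = 0") (simp_all add: pm_extend_def)

lemma extend_0: "pm_extend M g 0 = \<zero>"
  by (simp add: pm_extend_def)

lemma extend_diff: "pm_extend M g (p - q) = pm_extend M g p \<ominus> pm_extend M g q"
  using extend_add [of "p - q" q] by (simp add: minus_eq add.inv_solve_right)

end

lemma pm_induct [case_names single add]:
  fixes p :: "'b \<Rightarrow>\<^sub>0 'c :: comm_monoid_add"
  assumes "\<And>b c. P (Poly_Mapping.single b c)" "\<And>p q. P p \<Longrightarrow> P q \<Longrightarrow> P (p + q)"
  shows "P p"
proof (induction p rule: update_induct)
  case const
  show ?case using assms(1) [of undefined 0] by simp
next
  case (update f a b)
  have "Poly_Mapping.update a b f = f + Poly_Mapping.single a b"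
    using update(1) by (intro poly_mapping_eqI) (auto simp: lookup_update lookup_add lookup_single in_keys_iff)
  then show ?case using assms update by metis
qed


section \<open>Modules over an extension of scalars\<close>

locale scalar_extension =
  fixes f :: "'r \<Rightarrow> 's :: comm_ring_1" and A :: "('r, 'a) module"
  assumes ring: "ring A"
    and smult_closed: "a \<in> carrier A \<Longrightarrow> r \<odot>\<^bsub>A\<^esub> a \<in> carrier A"
begin

sublocale A: ring A by (rule ring)

sublocale P: ring "pair_ring A :: ('s \<times> 'a \<Rightarrow>\<^sub>0 int) ring" by (rule ring_pair_ring) (rule ring)

lemma tensor_rels_carrier: "tensor_rels f A \<subseteq> carrier (pair_ring A)"
  by (rule tensor_rels_closed) (use ring smult_closed in auto)

sublocale I: ideal "tensor_ideal f A" "pair_ring A"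
  unfolding tensor_ideal_def by (rule P.genideal_ideal) (rule tensor_rels_carrier)

lemma ring_base: "ring (base_change f A)"
  by (rule ring_base_change) (use ring smult_closed in auto)

sublocale B: ring "base_change f A" by (rule ring_base)

lemma frag_closed: "a \<in> carrier A \<Longrightarrow> frag_of (s, a) \<in> carrier (pair_ring A)"
  by (simp add: pair_ring_def)

abbreviation coset where "coset p \<equiv> tensor_ideal f A +>\<^bsub>pair_ring A\<^esub> p"

lemma coset_hom:
  assumes "p \<in> carrier (pair_ring A)" "q \<in> carrier (pair_ring A)"
  shows "coset p \<in> carrier (base_change f A)"
    and "coset (p + q) = coset p \<oplus>\<^bsub>base_change f A\<^esub> coset q"
    and "coset (pair_mult A p q) = coset p \<otimes>\<^bsub>base_change f A\<^esub> coset q"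
    and "coset (p - q) = coset p \<ominus>\<^bsub>base_change f A\<^esub> coset q"
proof -
  note h = I.rcos_ring_hom [unfolded ring_hom_def, simplified]
  have add: "coset (p + q) = coset p \<oplus>\<^bsub>base_change f A\<^esub> coset q"
    if "p \<in> carrier (pair_ring A)" "q \<in> carrier (pair_ring A)" for p q
    using h that by (simp add: base_change_def as_algebra_def) (simp add: pair_ring_def)
  have closed: "coset p \<in> carrier (base_change f A)" if "p \<in> carrier (pair_ring A)" for p
    using h that by (auto simp: base_change_def as_algebra_def)
  show "coset p \<in> carrier (base_change f A)" using closed assms(1) .
  show "coset (p + q) = coset p \<oplus>\<^bsub>base_change f A\<^esub> coset q" using add assms .
  show "coset (pair_mult A p q) = coset p \<otimes>\<^bsub>base_change f A\<^esub> coset q"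
    using h assms by (simp add: base_change_def as_algebra_def) (simp add: pair_ring_def)
  have pq: "p - q \<in> carrier (pair_ring A)"
    using assms keys_diff [of p q] by (auto simp: pair_ring_def)
  have "coset p = coset (p - q) \<oplus>\<^bsub>base_change f A\<^esub> coset q"
    using add [OF pq assms(2)] by simp
  then show "coset (p - q) = coset p \<ominus>\<^bsub>base_change f A\<^esub> coset q"
    using closed [OF pq] closed [OF assms(2)] closed [OF assms(1)]
    by (simp add: a_minus_def B.add.inv_solve_right)
qed

lemma tens_closed [simp]: "a \<in> carrier A \<Longrightarrow> tens f A s a \<in> carrier (base_change f A)"
  unfolding tens_def by (rule coset_hom) (auto intro: frag_closed)

lemma coset_rel: "p \<in> tensor_rels f A \<Longrightarrow> coset p = \<zero>\<^bsub>base_change f A\<^esub>"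
  using P.genideal_self [OF tensor_rels_carrier] I.a_rcos_const [of p]
  by (auto simp: tensor_ideal_def base_change_def as_algebra_def FactRing_def)

lemma coset_rel_eq:
  assumes "p - q \<in> tensor_rels f A" "p \<in> carrier (pair_ring A)" "q \<in> carrier (pair_ring A)"
  shows "coset p = coset q"
proof -
  note c = coset_hom (1) [OF assms(2,2)] coset_hom (1) [OF assms(3,3)]
  then have "coset p = (coset p \<ominus>\<^bsub>base_change f A\<^esub> coset q) \<oplus>\<^bsub>base_change f A\<^esub> coset q"
    by (simp add: a_minus_def B.a_assoc B.l_neg)
  then show ?thesis using c coset_rel [OF assms(1)] coset_hom (4) [OF assms(2,3)] by simp
qed

lemma add_carrier:
  "p \<in> carrier (pair_ring A) \<Longrightarrow> q \<in> carrier (pair_ring A) \<Longrightarrow> p + q \<in> carrier (pair_ring A)"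
  using keys_add [of p q] by (auto simp: pair_ring_def)

lemma tens_add_left:
  assumes "a \<in> carrier A"
  shows "tens f A (s + s') a = tens f A s a \<oplus>\<^bsub>base_change f A\<^esub> tens f A s' a"
proof -
  have "coset (frag_of (s + s', a)) = coset (frag_of (s, a) + frag_of (s', a))"
    by (rule coset_rel_eq)
      (use assms in \<open>auto simp: tensor_rels_def algebra_simps intro!: frag_closed add_carrier\<close>)
  then show ?thesis using assms by (simp add: tens_def coset_hom frag_closed)
qed

lemma tens_add_right:
  assumes "a \<in> carrier A" "a' \<in> carrier A"
  shows "tens f A s (a \<oplus>\<^bsub>A\<^esub> a') = tens f A s a \<oplus>\<^bsub>base_change f A\<^esub> tens f A s a'"
proof -
  have "frag_of (s, a \<oplus>\<^bsub>A\<^esub> a') - (frag_of (s, a) + frag_of (s, a')) \<in> tensor_rels f A"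
    using assms by (auto simp: tensor_rels_def diff_diff_add)
  then have "coset (frag_of (s, a \<oplus>\<^bsub>A\<^esub> a')) = coset (frag_of (s, a) + frag_of (s, a'))"
    by (rule coset_rel_eq) (use assms in \<open>auto intro!: frag_closed add_carrier\<close>)
  then show ?thesis using assms by (simp add: tens_def coset_hom frag_closed)
qed

lemma tens_smult: "a \<in> carrier A \<Longrightarrow> tens f A (s * f r) a = tens f A s (r \<odot>\<^bsub>A\<^esub> a)"
  unfolding tens_def
  by (rule coset_rel_eq) (auto simp: tensor_rels_def intro!: frag_closed smult_closed)

lemma tens_mult:
  "a \<in> carrier A \<Longrightarrow> a' \<in> carrier A \<Longrightarrow>
    tens f A s a \<otimes>\<^bsub>base_change f A\<^esub> tens f A s' a' = tens f A (s * s') (a \<otimes>\<^bsub>A\<^esub> a')"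
  using coset_hom (3) [OF frag_closed frag_closed, of a a' s s'] by (simp add: tens_def)

lemma base_one: "\<one>\<^bsub>base_change f A\<^esub> = tens f A 1 \<one>\<^bsub>A\<^esub>"
  by (simp add: base_change_def as_algebra_def FactRing_def tens_def) (simp add: pair_ring_def)

lemma base_smult: "c \<odot>\<^bsub>base_change f A\<^esub> X = tens f A c \<one>\<^bsub>A\<^esub> \<otimes>\<^bsub>base_change f A\<^esub> X"
  by (simp add: base_change_def as_algebra_def)

lemma base_smult_tens:
  "a \<in> carrier A \<Longrightarrow> c \<odot>\<^bsub>base_change f A\<^esub> tens f A s a = tens f A (c * s) a"
  by (simp add: base_smult tens_mult)

lemma base_smult_closed:
  "X \<in> carrier (base_change f A) \<Longrightarrow> c \<odot>\<^bsub>base_change f A\<^esub> X \<in> carrier (base_change f A)"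
  by (simp add: base_smult)

lemma base_smult_one: "c \<odot>\<^bsub>base_change f A\<^esub> \<one>\<^bsub>base_change f A\<^esub> = tens f A c \<one>\<^bsub>A\<^esub>"
  by (simp add: base_one base_smult_tens)

text \<open>Every element is the class of an integral combination of pairs.\<close>

lemma base_induct [consumes 1, case_names tens diff]:
  assumes X: "X \<in> carrier (base_change f A)"
    and tens: "\<And>s a. a \<in> carrier A \<Longrightarrow> Q (tens f A s a)"
    and diff: "\<And>X Y. X \<in> carrier (base_change f A) \<Longrightarrow> Y \<in> carrier (base_change f A) \<Longrightarrow>
      Q X \<Longrightarrow> Q Y \<Longrightarrow> Q (X \<ominus>\<^bsub>base_change f A\<^esub> Y)"
  shows "Q X"
proof -
  obtain p where p: "p \<in> carrier (pair_ring A)" "X = coset p"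
    using X by (auto simp: base_change_def as_algebra_def FactRing_def A_RCOSETS_def')
  have z: "Q (coset 0)"
  proof -
    have t: "tens f A 0 \<one>\<^bsub>A\<^esub> \<in> carrier (base_change f A)" by simp
    then have "\<zero>\<^bsub>base_change f A\<^esub> = tens f A 0 \<one>\<^bsub>A\<^esub> \<ominus>\<^bsub>base_change f A\<^esub> tens f A 0 \<one>\<^bsub>A\<^esub>"
      by (simp add: a_minus_def B.r_neg)
    moreover have "coset 0 = \<zero>\<^bsub>base_change f A\<^esub>"
      using coset_hom (4) [of "frag_of (0, \<one>\<^bsub>A\<^esub>)" "frag_of (0, \<one>\<^bsub>A\<^esub>)"]
        coset_hom (1) [of "frag_of (0, \<one>\<^bsub>A\<^esub>)" "frag_of (0, \<one>\<^bsub>A\<^esub>)"]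
      by (simp add: frag_closed a_minus_def B.r_neg)
    ultimately show ?thesis using diff [OF t t tens tens] by simp
  qed
  have "Poly_Mapping.keys p \<subseteq> UNIV \<times> carrier A" using p by (simp add: pair_ring_def)
  then have "Poly_Mapping.keys p \<subseteq> UNIV \<times> carrier A \<and> Q (coset p)"
  proof (induction p rule: frag_induction)
    case (one x)
    then show ?case using tens [of "snd x" "fst x"] by (cases x) (simp add: tens_def)
  next
    case (diff p q)
    have "p \<in> carrier (pair_ring A)" "q \<in> carrier (pair_ring A)"
      using diff by (simp_all add: pair_ring_def)
    then have "Q (coset (p - q))" using diff
      by (simp add: coset_hom assms(3))
    then show ?case using diff keys_diff [of p q] by blast
  qed (use z in simp)
  then show ?thesis using p by simp
qed

lemma tens_diff:
  assumes "a \<in> carrier A" "a' \<in> carrier A"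
  shows "tens f A s (a \<ominus>\<^bsub>A\<^esub> a') = tens f A s a \<ominus>\<^bsub>base_change f A\<^esub> tens f A s a'"
proof -
  have "add_hom A (base_change f A) (tens f A s)"
    by (simp add: add_hom_def tens_add_right)
  then have "tens f A s (\<ominus>\<^bsub>A\<^esub> a') = \<ominus>\<^bsub>base_change f A\<^esub> tens f A s a'"
    by (rule add_hom_minus [OF A.is_abelian_group B.is_abelian_group]) fact
  then show ?thesis using assms by (simp add: a_minus_def tens_add_right)
qed

lemma generates_base:
  assumes G: "generates A G"
  shows "generates (base_change f A) (tens f A 1 ` G)"
proof (rule generatesI)
  fix Q :: "('s \<times> 'a \<Rightarrow>\<^sub>0 int) set \<Rightarrow> bool" and X
  let ?B = "base_change f A"
  assume sca: "\<And>c. Q (c \<odot>\<^bsub>?B\<^esub> \<one>\<^bsub>?B\<^esub>)" and ge: "\<And>g. g \<in> tens f A 1 ` G \<Longrightarrow> Q g"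
    and mul: "\<And>X Y. X \<in> carrier ?B \<Longrightarrow> Y \<in> carrier ?B \<Longrightarrow> Q X \<Longrightarrow> Q Y \<Longrightarrow> Q (X \<otimes>\<^bsub>?B\<^esub> Y)"
    and dif: "\<And>X Y. X \<in> carrier ?B \<Longrightarrow> Y \<in> carrier ?B \<Longrightarrow> Q X \<Longrightarrow> Q Y \<Longrightarrow> Q (X \<ominus>\<^bsub>?B\<^esub> Y)"
  have one: "Q (tens f A 1 a)" if "a \<in> carrier A" for a
    using G that
  proof (induction a rule: generates_induct)
    case (scal r)
    then show ?case
      using sca [of "f r"] tens_smult [OF A.one_closed, of 1 r] by (metis base_smult_one mult_1)
  next
    case (gen g)
    then show ?case by (intro ge imageI)
  next
    case (mult a b)
    then have "Q (tens f A 1 a \<otimes>\<^bsub>?B\<^esub> tens f A 1 b)" by (intro mul tens_closed)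
    then show ?case using mult by (simp add: tens_mult)
  next
    case (diff a b)
    then show ?case unfolding tens_diff [OF diff(1,2)] by (intro dif tens_closed)
  qed
  assume "X \<in> carrier ?B"
  then show "Q X"
  proof (induction X rule: base_induct)
    case (tens s a)
    have "Q (tens f A s \<one>\<^bsub>A\<^esub> \<otimes>\<^bsub>?B\<^esub> tens f A 1 a)"
      using sca [of s, unfolded base_smult_one] one [OF tens] tens by (intro mul tens_closed A.one_closed)
    then show ?case using tens by (simp add: tens_mult)
  qed (rule dif)
qed

text \<open>The universal property of \<open>S \<otimes>\<^sub>R A\<close>. The free abelian group on the pairs acts by additivity; the commutation
  of the two actions makes this multiplicative, and their compatibility over \<open>R\<close> kills the balancing relations.\<close>

lemma action_base:
  fixes M :: "('m, 'w) ring_scheme"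
  assumes M: "abelian_group M" and act: "action A M \<alpha>"
    and sc: "action type_ring M sc"
    and comm: "\<And>s a m. a \<in> carrier A \<Longrightarrow> m \<in> carrier M \<Longrightarrow> sc s (\<alpha> a m) = \<alpha> a (sc s m)"
    and compat: "\<And>r a m. a \<in> carrier A \<Longrightarrow> m \<in> carrier M \<Longrightarrow> \<alpha> (r \<odot>\<^bsub>A\<^esub> a) m = sc (f r) (\<alpha> a m)"
  shows "\<exists>\<beta>. action (base_change f A) M \<beta> \<and>
    (\<forall>s. \<forall>a \<in> carrier A. \<forall>m \<in> carrier M. \<beta> (tens f A s a) m = sc s (\<alpha> a m))"
proof -
  interpret M: abelian_group M by fact
  note D = actionD [OF act] and S = actionD [OF sc, unfolded type_ring_def, simplified]
  define g where "g m p n = (if snd p \<in> carrier A \<and> m \<in> carrier M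
    then add_pow M n (sc (fst p) (\<alpha> (snd p) m)) else \<zero>\<^bsub>M\<^esub>)"
    for m and p :: "'s \<times> 'a" and n :: int
  have ext: "pm_extension M (g m)" for m
    by unfold_locales (auto simp: g_def D S M.add.int_pow_mult)
  define \<beta> where "\<beta> p m = pm_extend M (g m) p" for p m
  have \<beta>one: "\<beta> (frag_of p) m = sc (fst p) (\<alpha> (snd p) m)" if "snd p \<in> carrier A" "m \<in> carrier M" for p m
    using that by (simp add: \<beta>_def pm_extension.extend_single [OF ext] g_def D S)
  have \<beta>diff: "\<beta> (p - q) m = \<beta> p m \<ominus>\<^bsub>M\<^esub> \<beta> q m" for p q m
    by (simp add: \<beta>_def pm_extension.extend_diff [OF ext])
  have zero: "\<beta> 0 m = \<zero>\<^bsub>M\<^esub>" for m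
    by (simp add: \<beta>_def pm_extension.extend_0 [OF ext])
  have closed: "\<beta> p m \<in> carrier M" for p m
    by (simp add: \<beta>_def pm_extension.extend_closed [OF ext])
  have add: "\<beta> p (m \<oplus>\<^bsub>M\<^esub> n) = \<beta> p m \<oplus>\<^bsub>M\<^esub> \<beta> p n"
    if p: "Poly_Mapping.keys p \<subseteq> UNIV \<times> carrier A" and m: "m \<in> carrier M" "n \<in> carrier M" for p m n
    using p
  proof (induction p rule: frag_induction)
    case (one p)
    then show ?case using m by (auto simp: \<beta>one D S)
  next
    case (diff p q)
    then show ?case
      by (simp add: \<beta>diff closed m M.minus_add M.a_ac a_minus_def)
  qed (simp add: zero)
  have minus: "\<beta> p (m \<ominus>\<^bsub>M\<^esub> n) = \<beta> p m \<ominus>\<^bsub>M\<^esub> \<beta> p n"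
    if p: "Poly_Mapping.keys p \<subseteq> UNIV \<times> carrier A" and m: "m \<in> carrier M" "n \<in> carrier M" for p m n
  proof -
    have "add_hom M M (\<beta> p)" using add [OF p] closed by (simp add: add_hom_def)
    then show ?thesis using add_hom_minus [OF M M, of "\<beta> p" n] m by (simp add: a_minus_def add_homD)
  qed
  have \<beta>0: "\<beta> p \<zero>\<^bsub>M\<^esub> = \<zero>\<^bsub>M\<^esub>" if p: "Poly_Mapping.keys p \<subseteq> UNIV \<times> carrier A" for p
    using minus [OF p, of "\<zero>\<^bsub>M\<^esub>" "\<zero>\<^bsub>M\<^esub>"] closed by (simp add: a_minus_def M.r_neg)
  have mult: "\<beta> (pair_mult A p q) m = \<beta> p (\<beta> q m)"
    if p: "Poly_Mapping.keys p \<subseteq> UNIV \<times> carrier A" and q: "Poly_Mapping.keys q \<subseteq> UNIV \<times> carrier A"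
      and m: "m \<in> carrier M" for p q m
    using p
  proof (induction p rule: frag_induction)
    case p: (one p)
    show ?case using q
    proof (induction q rule: frag_induction)
      case q: (one q)
      have "sc (fst p * fst q) (\<alpha> (snd p \<otimes>\<^bsub>A\<^esub> snd q) m) = sc (fst p) (\<alpha> (snd p) (sc (fst q) (\<alpha> (snd q) m)))"
        using p q m by (auto simp: D S comm)
      then show ?case using p q m by (auto simp: \<beta>one D S)
    next
      case (diff q r)
      have "Poly_Mapping.keys (frag_of p) \<subseteq> UNIV \<times> carrier A" using p by simp
      with diff show ?case
        by (simp add: pair_mult_diff_right \<beta>diff minus closed del: keys_single)
    qed (use p in \<open>simp add: zero \<beta>0\<close>)
  next
    case (diff p r)
    then show ?case by (simp add: pair_mult_diff_left \<beta>diff)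
  qed (simp add: zero)
  have \<beta>: "action (pair_ring A) M \<beta>"
    unfolding action_def
    by (auto simp: pair_ring_def closed add mult \<beta>one D S \<beta>_def [symmetric])
      (simp add: \<beta>_def pm_extension.extend_add [OF ext])
  have cancel: "x \<oplus>\<^bsub>M\<^esub> y \<ominus>\<^bsub>M\<^esub> x \<ominus>\<^bsub>M\<^esub> y = \<zero>\<^bsub>M\<^esub>" if "x \<in> carrier M" "y \<in> carrier M" for x y
    using that by (subst M.a_comm) (simp_all add: a_minus_def M.a_assoc M.r_neg M.r_neg2)
  have rel: "\<beta> r m = \<zero>\<^bsub>M\<^esub>" if r: "r \<in> tensor_rels f A" and m: "m \<in> carrier M" for r m
    using r m by (auto simp: tensor_rels_def \<beta>diff \<beta>one D S compat smult_closed cancel)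
      (simp add: a_minus_def M.r_neg D S flip: comm)
  from action_quotient [OF M P.ring_axioms \<beta> tensor_rels_carrier rel]
  obtain \<gamma> where \<gamma>: "action (pair_ring A Quot tensor_ideal f A) M \<gamma>"
    "\<And>r m. r \<in> carrier (pair_ring A) \<Longrightarrow> m \<in> carrier M \<Longrightarrow> \<gamma> (coset r) m = \<beta> r m"
    unfolding tensor_ideal_def by blast
  show ?thesis
    by (rule exI [of _ \<gamma>]) (auto simp: base_change_def action_as_algebra \<gamma> tens_def frag_closed \<beta>one)
qed


text \<open>The converse: pulling back along \<open>a \<mapsto> 1 \<otimes> a\<close> and \<open>s \<mapsto> s \<otimes> 1\<close> recovers the two actions.\<close>

lemma action_restrict:
  assumes act: "action (base_change f A) M \<beta>"
  shows "action A M (\<lambda>a. \<beta> (tens f A 1 a))" "action type_ring M (\<lambda>s. \<beta> (tens f A s \<one>\<^bsub>A\<^esub>))"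
    and "a \<in> carrier A \<Longrightarrow> m \<in> carrier M \<Longrightarrow>
      \<beta> (tens f A s \<one>\<^bsub>A\<^esub>) (\<beta> (tens f A 1 a) m) = \<beta> (tens f A 1 a) (\<beta> (tens f A s \<one>\<^bsub>A\<^esub>) m)"
    and "a \<in> carrier A \<Longrightarrow> m \<in> carrier M \<Longrightarrow>
      \<beta> (tens f A 1 (r \<odot>\<^bsub>A\<^esub> a)) m = \<beta> (tens f A (f r) \<one>\<^bsub>A\<^esub>) (\<beta> (tens f A 1 a) m)"
proof -
  note D = actionD [OF act]
  show "action A M (\<lambda>a. \<beta> (tens f A 1 a))"
    using D(5) by (auto simp: action_def D(1-3) tens_add_right simp flip: base_one)
      (simp add: tens_mult flip: D(4))
  show "action type_ring M (\<lambda>s. \<beta> (tens f A s \<one>\<^bsub>A\<^esub>))"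
    using D(5) by (auto simp: action_def type_ring_def D(1-3) tens_add_left simp flip: base_one)
      (simp add: tens_mult flip: D(4))
  assume a: "a \<in> carrier A" and m: "m \<in> carrier M"
  then show "\<beta> (tens f A s \<one>\<^bsub>A\<^esub>) (\<beta> (tens f A 1 a) m) = \<beta> (tens f A 1 a) (\<beta> (tens f A s \<one>\<^bsub>A\<^esub>) m)"
    by (simp add: tens_mult flip: D(4))
  have "tens f A 1 (r \<odot>\<^bsub>A\<^esub> a) = tens f A (f r) a" using tens_smult [OF a, of 1 r] by simp
  then show "\<beta> (tens f A 1 (r \<odot>\<^bsub>A\<^esub> a)) m = \<beta> (tens f A (f r) \<one>\<^bsub>A\<^esub>) (\<beta> (tens f A 1 a) m)"
    using a m by (simp add: tens_mult flip: D(4))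
qed

end


section \<open>Modules over the covering quantum group\<close>

lemma type_ring_simps [simp]:
  "carrier type_ring = UNIV" "x \<oplus>\<^bsub>type_ring\<^esub> y = x + y" "x \<otimes>\<^bsub>type_ring\<^esub> y = x * y"
  "\<one>\<^bsub>type_ring\<^esub> = 1" "\<zero>\<^bsub>type_ring\<^esub> = 0"
  by (simp_all add: type_ring_def)

lemma type_ring_minus: "\<ominus>\<^bsub>type_ring\<^esub> x = - x" for x :: "'a :: ring_1"
proof -
  interpret ring "type_ring :: 'a ring" by (rule ring_type_ring)
  show ?thesis using minus_equality [of "- x" x] by simp
qed

lemma fscal_1: "fscal 1 = 1"
  by (simp add: fscal_def)

lemma single_word: "Poly_Mapping.single (Word gs) c = fscal c * prod_list (map fgen gs)"
proof -
  have "prod_list (map fgen gs) = (Poly_Mapping.single (Word gs) 1 :: 'a word \<Rightarrow>\<^sub>0 'b)"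
    by (induction gs) (simp_all add: fgen_def mult_single plus_word_def flip: zero_word_def)
  then show ?thesis by (simp add: fscal_def mult_single zero_word_def plus_word_def)
qed

lemma free_induct [case_names scal gen add mult]:
  fixes p :: "'g word \<Rightarrow>\<^sub>0 'r :: comm_ring_1"
  assumes "\<And>r. Q (fscal r)" "\<And>g. Q (fgen g)"
    "\<And>p q. Q p \<Longrightarrow> Q q \<Longrightarrow> Q (p + q)" "\<And>p q. Q p \<Longrightarrow> Q q \<Longrightarrow> Q (p * q)"
  shows "Q p"
proof (induction p rule: pm_induct)
  case (single w c)
  have "Q (prod_list (map fgen gs))" for gs
    by (induction gs) (use assms fscal_1 in \<open>auto simp flip: fscal_1\<close>)
  then show ?case using assms single_word [of "letters w" c] by simp
qed (rule assms)

definition word_op :: "('g \<Rightarrow> 'm \<Rightarrow> 'm) \<Rightarrow> 'g word \<Rightarrow> 'm \<Rightarrow> 'm"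
  where "word_op op w = foldr op (letters w)"

lemma word_op_simps:
  "word_op op 0 = (\<lambda>m. m)" "word_op op (Word [g]) = op g" "word_op op (u + w) m = word_op op u (word_op op w m)"
  by (simp_all add: word_op_def zero_word_def plus_word_def fun_eq_iff)

text \<open>The universal property of the free algebra: a word acts as the composite of its letters, and a coefficient
  \<open>r\<close> acts as the scalar \<open>\<psi> r\<close>.\<close>

lemma action_free:
  fixes M :: "('m, 'w) ring_scheme" and \<psi> :: "'r :: comm_ring_1 \<Rightarrow> 'k :: comm_ring_1"
    and op :: "'g \<Rightarrow> 'm \<Rightarrow> 'm"
  assumes M: "abelian_group M" and \<psi>: "ring_map \<psi>" and sc: "action type_ring M sc"
    and op: "\<And>g. add_hom M M (op g)" "\<And>c g m. m \<in> carrier M \<Longrightarrow> sc c (op g m) = op g (sc c m)"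
  shows "\<exists>\<rho>. action type_ring M \<rho> \<and>
    (\<forall>r. \<forall>m \<in> carrier M. \<rho> (fscal r) m = sc (\<psi> r) m) \<and>
    (\<forall>g. \<forall>m \<in> carrier M. \<rho> (fgen g) m = op g m) \<and>
    (\<forall>c p. \<forall>m \<in> carrier M. sc c (\<rho> p m) = \<rho> p (sc c m))"
proof -
  interpret M: abelian_group M by fact
  interpret \<psi>: ring_map \<psi> by fact
  note S = actionD [OF sc, simplified]
  have w: "add_hom M M (word_op op w)" for w
  proof -
    have "add_hom M M (foldr op gs)" for gs
      by (induction gs) (use op in \<open>auto simp: add_hom_def\<close>)
    then show ?thesis by (simp add: word_op_def)
  qed
  note W = add_homD [OF w]
  have ws: "sc c (word_op op w m) = word_op op w (sc c m)" if "m \<in> carrier M" for c w m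
  proof -
    have *: "foldr op gs m \<in> carrier M" for gs
      using add_homD (1) [OF w, of m "Word gs"] that by (simp add: word_op_def)
    have "sc c (foldr op gs m) = foldr op gs (sc c m)" for gs
      by (induction gs) (simp_all add: op * )
    then show ?thesis by (simp add: word_op_def)
  qed
  define g where "g m u c = (if m \<in> carrier M then sc (\<psi> c) (word_op op u m) else \<zero>\<^bsub>M\<^esub>)" for m u c
  have ext: "pm_extension M (g m)" for m
    by unfold_locales (auto simp: g_def S W \<psi>.add)
  define \<rho> where "\<rho> p m = pm_extend M (g m) p" for p m
  have \<rho>s: "\<rho> (Poly_Mapping.single u c) m = sc (\<psi> c) (word_op op u m)" if "m \<in> carrier M" for u c m
    using that by (simp add: \<rho>_def pm_extension.extend_single [OF ext] g_def)
  have \<rho>a: "\<rho> (p + q) m = \<rho> p m \<oplus>\<^bsub>M\<^esub> \<rho> q m" for p q m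
    by (simp add: \<rho>_def pm_extension.extend_add [OF ext])
  have closed: "\<rho> p m \<in> carrier M" for p m
    by (simp add: \<rho>_def pm_extension.extend_closed [OF ext])
  have \<rho>r: "\<rho> p (m \<oplus>\<^bsub>M\<^esub> n) = \<rho> p m \<oplus>\<^bsub>M\<^esub> \<rho> p n" if "m \<in> carrier M" "n \<in> carrier M" for p m n
    by (induction p rule: pm_induct) (use that in \<open>simp_all add: \<rho>s \<rho>a S W closed M.a_ac\<close>)
  have \<rho>m: "\<rho> (p * q) m = \<rho> p (\<rho> q m)" if m: "m \<in> carrier M" for p q m
  proof (induction p rule: pm_induct)
    case (single u c)
    show ?case
    proof (induction q rule: pm_induct)
      case (single w d)
      show ?case using m by (simp add: mult_single \<rho>s \<psi>.mult S W word_op_simps ws)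
    qed (simp add: distrib_left \<rho>a \<rho>r closed)
  qed (simp add: distrib_right \<rho>a)
  have \<rho>c: "sc c (\<rho> p m) = \<rho> p (sc c m)" if m: "m \<in> carrier M" for c p m
    by (induction p rule: pm_induct)
      (use m in \<open>simp_all add: \<rho>s \<rho>a S W closed mult.commute flip: ws S(4)\<close>)
  have "action type_ring M \<rho>"
    using \<rho>s [of _ 0 1] by (auto simp: action_def closed \<rho>a \<rho>r \<rho>m \<psi>.one S word_op_simps)
  then show ?thesis
    by (intro exI [of _ \<rho>]) (auto simp: fscal_def fgen_def \<rho>s word_op_simps \<psi>.one S add_homD [OF op(1)] \<rho>c)
qed

subsection \<open>The algebra \<open>U\<close> and its specialisations\<close>

lemma ring_U: "ring (U D)"
  unfolding U_def U_ideal_def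
  by (intro ring_as_algebra ideal.quotient_is_ring ring.genideal_ideal ring_type_ring) simp

lemma ideal_U: "ideal (U_ideal D) type_ring"
  unfolding U_ideal_def by (intro ring.genideal_ideal ring_type_ring) simp

lemma U_class_hom:
  "U_class D x \<in> carrier (U D)"
  "U_class D (x + y) = U_class D x \<oplus>\<^bsub>U D\<^esub> U_class D y"
  "U_class D (x * y) = U_class D x \<otimes>\<^bsub>U D\<^esub> U_class D y"
  "U_class D 1 = \<one>\<^bsub>U D\<^esub>"
  using ideal.rcos_ring_hom [OF ideal_U, of D, unfolded ring_hom_def]
  by (auto simp: U_class_def U_def as_algebra_def)

lemma U_class_surj: "a \<in> carrier (U D) \<Longrightarrow> \<exists>x. a = U_class D x"
  by (auto simp: U_class_def U_def as_algebra_def FactRing_def A_RCOSETS_def')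

lemma U_smult: "r \<odot>\<^bsub>U D\<^esub> a = U_class D (fscal r) \<otimes>\<^bsub>U D\<^esub> a"
  by (simp add: U_def as_algebra_def)

lemma U_smult_closed: "a \<in> carrier (U D) \<Longrightarrow> r \<odot>\<^bsub>U D\<^esub> a \<in> carrier (U D)"
proof -
  interpret ring "U D" by (rule ring_U)
  show "a \<in> carrier (U D) \<Longrightarrow> r \<odot>\<^bsub>U D\<^esub> a \<in> carrier (U D)" by (simp add: U_smult U_class_hom)
qed

lemma U_class_rel: "x \<in> U_rels D \<Longrightarrow> U_class D x = \<zero>\<^bsub>U D\<^esub>"
proof -
  interpret ideal "U_ideal D" type_ring by (rule ideal_U)
  show "x \<in> U_rels D \<Longrightarrow> U_class D x = \<zero>\<^bsub>U D\<^esub>"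
    using ring.genideal_self [OF ring_type_ring, of "U_rels D"] a_rcos_const [of x]
    by (auto simp: U_class_def U_ideal_def U_def as_algebra_def FactRing_def)
qed

lemma scalar_extension_U: "scalar_extension (U D)"
  by (intro scalar_extension.intro ring_U U_smult_closed)

lemma scalar_extension_Ut: "scalar_extension (Ut D)"
proof -
  interpret scalar_extension cov_qvt_of "U D" by (rule scalar_extension_U)
  show ?thesis unfolding Ut_def by (intro scalar_extension.intro ring_base base_smult_closed)
qed

lemma generates_U: "generates (U D) (range (\<lambda>g. U_class D (fgen g)))"
proof (rule generatesI)
  interpret ring "U D" by (rule ring_U)
  fix Q :: "('a, 'b) freeU set \<Rightarrow> bool" and a
  assume sca: "\<And>c. Q (c \<odot>\<^bsub>U D\<^esub> \<one>\<^bsub>U D\<^esub>)" and gen: "\<And>g. g \<in> range (\<lambda>g. U_class D (fgen g)) \<Longrightarrow> Q g"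
    and mul: "\<And>X Y. X \<in> carrier (U D) \<Longrightarrow> Y \<in> carrier (U D) \<Longrightarrow> Q X \<Longrightarrow> Q Y \<Longrightarrow> Q (X \<otimes>\<^bsub>U D\<^esub> Y)"
    and dif: "\<And>X Y. X \<in> carrier (U D) \<Longrightarrow> Y \<in> carrier (U D) \<Longrightarrow> Q X \<Longrightarrow> Q Y \<Longrightarrow> Q (X \<ominus>\<^bsub>U D\<^esub> Y)"
    and a: "a \<in> carrier (U D)"
  \<comment> \<open>sums as iterated differences: \<open>X + Y = X - (0 - Y)\<close>\<close>
  have sum: "Q (X \<oplus>\<^bsub>U D\<^esub> Y)" if "X \<in> carrier (U D)" "Y \<in> carrier (U D)" "Q X" "Q Y" for X Y
  proof -
    have "X \<ominus>\<^bsub>U D\<^esub> X = \<zero>\<^bsub>U D\<^esub>" using that by (simp add: a_minus_def r_neg)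
    then have "Q \<zero>\<^bsub>U D\<^esub>" using dif [OF that(1,1,3,3)] by simp
    then have "Q (X \<ominus>\<^bsub>U D\<^esub> (\<zero>\<^bsub>U D\<^esub> \<ominus>\<^bsub>U D\<^esub> Y))" using that by (intro dif) simp_all
    then show ?thesis using that by (simp add: a_minus_def)
  qed
  have "Q (U_class D p)" for p
  proof (induction p rule: free_induct)
    case (scal r)
    then show ?case using sca [of r] by (simp add: U_smult U_class_hom)
  qed (simp_all add: gen U_class_hom sum mul)
  then show "Q a" using U_class_surj [OF a] by blast
qed

lemma generates_U_at: "generates (U_at e D) (range (U_at_gen e D))"
proof -
  interpret scalar_extension "cov_spec e" "U D" by (rule scalar_extension_U)
  show ?thesis using generates_base [OF generates_U]
    by (simp add: U_at_def U_at_gen_def [abs_def] image_image)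
qed

lemma generates_Ut_at: "generates (Ut_at e D) (range (Ut_at_gen e D))"
proof -
  interpret U: scalar_extension cov_qvt_of "U D" by (rule scalar_extension_U)
  interpret Ut: scalar_extension "cov_spec e" "Ut D" by (rule scalar_extension_Ut)
  show ?thesis using Ut.generates_base [of "tens cov_qvt_of (U D) 1 ` range (\<lambda>g. U_class D (fgen g))"]
      U.generates_base [OF generates_U]
    by (simp add: Ut_at_def Ut_def Ut_at_gen_def [abs_def] image_image)
qed

text \<open>A module over \<open>k \<otimes> U\<close> is an action of the free algebra on the generators of \<open>U\<close>, together with a
  commuting action of \<open>k\<close>, where \<open>qk : \<rat>(v) \<rightarrow> k\<close> and \<open>\<pi>\<close> acts as \<open>e\<close>. This covers both
  \<open>U|\<^bsub>\<pi>=e\<^esub>\<close> and \<open>U[t]|\<^bsub>\<pi>=e\<^esub>\<close>, and hides the tensor products.\<close>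

locale free_rep = abelian_group M
  for D :: "('i :: finite, 'y :: ab_group_add, 'x :: ab_group_add) root_datum"
    and e :: int and qk :: "qv \<Rightarrow> 'k :: field" and M :: "('m, 'w) ring_scheme" (structure)
    and sc :: "'k \<Rightarrow> 'm \<Rightarrow> 'm" and \<rho> :: "('i, 'y) freeU \<Rightarrow> 'm \<Rightarrow> 'm" +
  assumes sign: "e * e = 1" and field_map: "field_map qk"
    and sc: "action type_ring M sc" and \<rho>: "action type_ring M \<rho>"
    and \<rho>_scal: "m \<in> carrier M \<Longrightarrow> \<rho> (fscal r) m = sc (qk (cov_spec e r)) m"
    and sc_\<rho>: "m \<in> carrier M \<Longrightarrow> sc c (\<rho> p m) = \<rho> p (sc c m)"

locale covering_rep = free_rep D e qk M sc \<rho>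
  for D :: "('i :: finite, 'y :: ab_group_add, 'x :: ab_group_add) root_datum"
    and e :: int and qk :: "qv \<Rightarrow> 'k :: field" and M :: "('m, 'w) ring_scheme" (structure)
    and sc :: "'k \<Rightarrow> 'm \<Rightarrow> 'm" and \<rho> :: "('i, 'y) freeU \<Rightarrow> 'm \<Rightarrow> 'm" +
  assumes rels: "p \<in> U_rels D \<Longrightarrow> m \<in> carrier M \<Longrightarrow> \<rho> p m = \<zero>"

lemma covering_rep_action:
  fixes D :: "('i :: finite, 'y :: ab_group_add, 'x :: ab_group_add) root_datum"
  assumes M: "abelian_group M" and e: "e * e = 1" and qk: "field_map qk"
    and \<alpha>: "action (U D) M \<alpha>" and sc: "action type_ring M sc"
    and comm: "\<And>a m c. a \<in> carrier (U D) \<Longrightarrow> m \<in> carrier M \<Longrightarrow> sc c (\<alpha> a m) = \<alpha> a (sc c m)"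
    and compat: "\<And>r a m. a \<in> carrier (U D) \<Longrightarrow> m \<in> carrier M \<Longrightarrow>
      \<alpha> (r \<odot>\<^bsub>U D\<^esub> a) m = sc (qk (cov_spec e r)) (\<alpha> a m)"
  shows "covering_rep D e qk M sc (\<lambda>p. \<alpha> (U_class D p))"
proof -
  interpret M: abelian_group M by (rule M)
  interpret U: ring "U D" by (rule ring_U)
  note A = actionD [OF \<alpha>]
  have "\<alpha> (U_class D (fscal r)) m = sc (qk (cov_spec e r)) m" if "m \<in> carrier M" for r m
    using compat [OF U.one_closed that, of r] that by (simp add: U_smult U_class_hom A)
  moreover have "action type_ring M (\<lambda>p. \<alpha> (U_class D p))"
    using A(5) by (auto simp: action_def U_class_hom A(1-4))
  moreover have "\<alpha> (U_class D p) m = \<zero>\<^bsub>M\<^esub>" if "p \<in> U_rels D" "m \<in> carrier M" for p m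
    using action_zero [OF M ring_U \<alpha>] that by (simp add: U_class_rel)
  moreover have "sc c (\<alpha> (U_class D p) m) = \<alpha> (U_class D p) (sc c m)" if "m \<in> carrier M" for c p m
    by (rule comm [OF U_class_hom(1) that])
  ultimately show ?thesis
    by (intro covering_rep.intro free_rep.intro covering_rep_axioms.intro free_rep_axioms.intro M e qk sc)
qed

lemma left_module_U_at:
  fixes D :: "('i :: finite, 'y :: ab_group_add, 'x :: ab_group_add) root_datum"
  assumes L: "left_module (U_at e D) M" and e: "e * e = 1"
  shows "covering_rep D e (\<lambda>x. x) M (scal_act (U_at e D) M)
    (\<lambda>p m. tens (cov_spec e) (U D) 1 (U_class D p) \<odot>\<^bsub>M\<^esub> m)"
proof -
  interpret U: scalar_extension "cov_spec e" "U D" by (rule scalar_extension_U)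
  have act: "action (base_change (cov_spec e) (U D)) M (module.smult M)"
    using L by (simp add: left_module_iff_action U_at_def)
  have sc: "scal_act (U_at e D) M = (\<lambda>c. module.smult M (tens (cov_spec e) (U D) c \<one>\<^bsub>U D\<^esub>))"
    by (simp add: scal_act_def [abs_def] U_at_def U.base_smult_one)
  have "field_map (\<lambda>x :: qv. x)" by unfold_locales simp_all
  then show ?thesis unfolding sc
    using covering_rep_action [OF _ e _ U.action_restrict(1,2) [OF act] U.action_restrict(3,4) [OF act]] L
    by (simp add: left_module_iff_action)
qed

lemma cov_qvt_of_spec: "cov_spec e (cov_qvt_of r) = qvt_of (cov_spec e r)"
  by (simp add: cov_spec_def cov_qvt_of_def qvt_of.add qvt_of.mult qvt_of.of_int)

lemma left_module_Ut_at:
  fixes D :: "('i :: finite, 'y :: ab_group_add, 'x :: ab_group_add) root_datum"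
  assumes L: "left_module (Ut_at e D) M" and e: "e * e = 1"
  shows "covering_rep D e qvt_of M (scal_act (Ut_at e D) M)
    (\<lambda>p m. tens (cov_spec e) (Ut D) 1 (tens cov_qvt_of (U D) 1 (U_class D p)) \<odot>\<^bsub>M\<^esub> m)"
proof -
  interpret U: scalar_extension cov_qvt_of "U D" by (rule scalar_extension_U)
  interpret Ut: scalar_extension "cov_spec e" "Ut D" by (rule scalar_extension_Ut)
  let ?t = "tens (cov_spec e) (Ut D)" and ?u = "tens cov_qvt_of (U D)"
  have M: "abelian_group M" using L by (simp add: left_module_iff_action)
  have act: "action (base_change (cov_spec e) (Ut D)) M (module.smult M)"
    using L by (simp add: left_module_iff_action Ut_at_def)
  note t = Ut.action_restrict [OF act]
  note u = U.action_restrict [OF t(1) [unfolded Ut_def], folded Ut_def]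
  have sc: "scal_act (Ut_at e D) M = (\<lambda>c. module.smult M (?t c \<one>\<^bsub>Ut D\<^esub>))"
    by (simp add: scal_act_def [abs_def] Ut_at_def Ut.base_smult_one)
  have u1: "?u c a \<in> carrier (Ut D)" if "a \<in> carrier (U D)" for c a
    using U.tens_closed [OF that] by (simp add: Ut_def)
  have uc: "?u c \<one>\<^bsub>U D\<^esub> = c \<odot>\<^bsub>Ut D\<^esub> \<one>\<^bsub>Ut D\<^esub>" for c
    by (simp add: Ut_def U.base_smult_one)
  show ?thesis unfolding sc
  proof (rule covering_rep_action [OF M e field_map_qvt_of u(1) t(2)])
    fix a m
    assume a: "a \<in> carrier (U D)" and m: "m \<in> carrier M"
    then have n: "?t 1 (?u 1 a) \<odot>\<^bsub>M\<^esub> m \<in> carrier M" by (intro actionD (1) [OF u(1)])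
    show "?t c \<one>\<^bsub>Ut D\<^esub> \<odot>\<^bsub>M\<^esub> (?t 1 (?u 1 a) \<odot>\<^bsub>M\<^esub> m) =
        ?t 1 (?u 1 a) \<odot>\<^bsub>M\<^esub> (?t c \<one>\<^bsub>Ut D\<^esub> \<odot>\<^bsub>M\<^esub> m)" for c
      by (rule t(3) [OF u1 [OF a] m])
    show "?t 1 (?u 1 (r \<odot>\<^bsub>U D\<^esub> a)) \<odot>\<^bsub>M\<^esub> m =
        ?t (qvt_of (cov_spec e r)) \<one>\<^bsub>Ut D\<^esub> \<odot>\<^bsub>M\<^esub> (?t 1 (?u 1 a) \<odot>\<^bsub>M\<^esub> m)" for r
      using t(4) [OF Ut.A.one_closed n, of "cov_qvt_of r"] n
      unfolding u(4) [OF a m] uc by (simp add: cov_qvt_of_spec actionD (5) [OF t(1)])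
  qed
qed

text \<open>The way back, by the universal properties of the quotient and of the two tensor products. Twisted modules are
  obtained from here.\<close>

lemma covering_rep_Ut_at:
  fixes M :: "(('i :: finite, 'y :: ab_group_add) Ut_elt, 'm) module"
  assumes "covering_rep D e qvt_of M sc \<rho>"
  shows "\<exists>\<alpha>. action (Ut_at e D) M \<alpha> \<and> (\<forall>m \<in> carrier M.
    (\<forall>c. \<alpha> (c \<odot>\<^bsub>Ut_at e D\<^esub> \<one>\<^bsub>Ut_at e D\<^esub>) m = sc c m) \<and> (\<forall>g. \<alpha> (Ut_at_gen e D g) m = \<rho> (fgen g) m))"
proof -
  interpret covering_rep D e qvt_of M sc \<rho> by fact
  interpret U: scalar_extension cov_qvt_of "U D" by (rule scalar_extension_U)
  interpret Ut: scalar_extension "cov_spec e" "Ut D" by (rule scalar_extension_Ut)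
  interpret e: ring_map "cov_spec e :: qvt cov \<Rightarrow> qvt" by (rule ring_map_cov_spec [OF sign])
  note S = actionD [OF sc, simplified] and R = actionD [OF \<rho>, simplified]
  let ?t = "tens (cov_spec e) (Ut D)" and ?u = "tens cov_qvt_of (U D)"
  note M = abelian_group_axioms
  obtain \<beta> where \<beta>: "action (type_ring Quot U_ideal D) M \<beta>"
    "\<And>p m. m \<in> carrier M \<Longrightarrow> \<beta> (U_class D p) m = \<rho> p m"
    using action_quotient [OF M ring_type_ring \<rho>, of "U_rels D"] rels
    by (auto simp: U_class_def U_ideal_def)
  have \<beta>U: "action (U D) M \<beta>" using \<beta>(1) by (simp add: U_def action_as_algebra)
  have "action type_ring M (\<lambda>c. sc (cov_spec e c))"
    by (simp add: action_def S e.add e.mult e.one)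
  moreover have "sc (cov_spec e s) (\<beta> a m) = \<beta> a (sc (cov_spec e s) m)"
    if "a \<in> carrier (U D)" "m \<in> carrier M" for s a m
    using U_class_surj [OF that(1)] that(2) by (auto simp: \<beta>(2) S sc_\<rho>)
  moreover have "\<beta> (r \<odot>\<^bsub>U D\<^esub> a) m = sc (cov_spec e (cov_qvt_of r)) (\<beta> a m)"
    if "a \<in> carrier (U D)" "m \<in> carrier M" for r a m
    using U_class_surj [OF that(1)] that(2)
    by (auto simp: U_smult cov_qvt_of_spec actionD [OF \<beta>U] U_class_hom \<beta>(2) R \<rho>_scal)
  ultimately obtain \<gamma> where \<gamma>: "action (Ut D) M \<gamma>"
    "\<And>s a m. a \<in> carrier (U D) \<Longrightarrow> m \<in> carrier M \<Longrightarrow> \<gamma> (?u s a) m = sc (cov_spec e s) (\<beta> a m)"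
    using U.action_base [OF M \<beta>U, of "\<lambda>c. sc (cov_spec e c)"] unfolding Ut_def by blast
  have \<gamma>1: "\<gamma> (c \<odot>\<^bsub>Ut D\<^esub> \<one>\<^bsub>Ut D\<^esub>) m = sc (cov_spec e c) m" if "m \<in> carrier M" for c m
    using that by (simp add: Ut_def U.base_smult_one \<gamma>(2) actionD [OF \<beta>U])
  have c1: "c \<odot>\<^bsub>Ut D\<^esub> \<one>\<^bsub>Ut D\<^esub> \<in> carrier (Ut D)" for c
    by (rule Ut.smult_closed) simp
  have "sc s (\<gamma> a m) = \<gamma> a (sc s m)" if "a \<in> carrier (Ut D)" "m \<in> carrier M" for s a m
    using that(1) unfolding Ut_def
  proof (induction a rule: U.base_induct)
    case (tens s' a)
    obtain p where "a = U_class D p" using U_class_surj [OF tens] by blast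
    then show ?case using that(2) tens
      by (simp add: \<gamma>(2) S \<beta>(2) R sc_\<rho>) (simp add: mult.commute flip: S(4))
  next
    case (diff X Y)
    then have XY: "X \<in> carrier (Ut D)" "Y \<in> carrier (Ut D)" by (simp_all add: Ut_def)
    have "add_hom M M (sc s)" using S by (simp add: add_hom_def)
    note m = add_hom_minus [OF M M this]
    show ?case using diff XY that(2) unfolding Ut_def [symmetric]
      by (simp add: a_minus_def actionD [OF \<gamma>(1)] action_minus [OF M Ut.ring \<gamma>(1)] S m)
  qed
  moreover have "\<gamma> (r \<odot>\<^bsub>Ut D\<^esub> a) m = sc (cov_spec e r) (\<gamma> a m)" if "a \<in> carrier (Ut D)" "m \<in> carrier M" for r a m
  proof -
    have "r \<odot>\<^bsub>Ut D\<^esub> a = (r \<odot>\<^bsub>Ut D\<^esub> \<one>\<^bsub>Ut D\<^esub>) \<otimes>\<^bsub>Ut D\<^esub> a"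
      using that by (simp add: Ut_def U.base_smult)
    then show ?thesis using that c1 by (simp add: actionD [OF \<gamma>(1)] \<gamma>1)
  qed
  ultimately obtain \<delta> where \<delta>: "action (Ut_at e D) M \<delta>"
    "\<And>s a m. a \<in> carrier (Ut D) \<Longrightarrow> m \<in> carrier M \<Longrightarrow> \<delta> (?t s a) m = sc s (\<gamma> a m)"
    using Ut.action_base [OF M \<gamma>(1) sc] unfolding Ut_at_def by blast
  have u: "?u 1 (U_class D p) \<in> carrier (Ut D)" for p
    using U.tens_closed [OF U_class_hom(1)] by (simp add: Ut_def)
  show ?thesis
  proof (intro exI [of _ \<delta>] conjI ballI allI \<delta>(1))
    fix m c g
    assume "m \<in> carrier M"
    then show "\<delta> (c \<odot>\<^bsub>Ut_at e D\<^esub> \<one>\<^bsub>Ut_at e D\<^esub>) m = sc c m"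
      by (simp add: Ut_at_def Ut.base_smult_one \<delta>(2) actionD [OF \<gamma>(1)])
    show "\<delta> (Ut_at_gen e D g) m = \<rho> (fgen g) m"
      using \<open>m \<in> carrier M\<close> by (simp add: Ut_at_gen_def \<delta>(2) u \<gamma>(2) U_class_hom e.one S R \<beta>(2))
  qed
qed


section \<open>Weight spaces\<close>

text \<open>The \<open>k\<close>-th coefficient of the Serre relation at \<open>\<pi> = e\<close>, with \<open>v = w\<close>.\<close>

definition scoef :: "('i, 'y, 'x) root_datum \<Rightarrow> int \<Rightarrow> 'k :: field \<Rightarrow> 'i \<Rightarrow> 'i \<Rightarrow> nat \<Rightarrow> 'k"
  where "scoef D e w i j k =
    (-1) ^ k * of_int e ^ ((k choose 2) * sr_p D i + k * sr_p D i * sr_p D j) *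
    cov_binom (w powi sr_d D i) (of_int e powi sr_d D i) (sr_b D i j) k"

lemma sr_d_nonzero: "super_root_datum D \<Longrightarrow> sr_d D i \<noteq> 0"
  unfolding super_root_datum_def super_cartan_datum_def by (metis less_irrefl)

lemma sr_pair_add:
  assumes "super_root_datum D"
  shows "sr_pair D (y + y') l = sr_pair D y l + sr_pair D y' l"
    "sr_pair D y (l + l') = sr_pair D y l + sr_pair D y l'"
  using assms unfolding super_root_datum_def perfect_pairing_def biadditive_def by blast+

lemma sr_pair_diff:
  assumes "super_root_datum D"
  shows "sr_pair D y (l - l') = sr_pair D y l - sr_pair D y l'"
  using sr_pair_add (2) [OF assms, of y "l - l'" l'] by simp

lemma sr_pair_zero: "super_root_datum D \<Longrightarrow> sr_pair D 0 l = 0"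
  using sr_pair_add (1) [of D 0 0 l] by simp

lemma sr_pair_minus: "super_root_datum D \<Longrightarrow> sr_pair D (- y) l = - sr_pair D y l"
  using sr_pair_add (1) [of D y "- y" l] by (simp add: sr_pair_zero)

lemma sr_pair_zscale:
  assumes "super_root_datum D"
  shows "sr_pair D (zscale n y) l = n * sr_pair D y l"
proof -
  have "sr_pair D (zscale (n + 1) y) l = sr_pair D (zscale n y) l + sr_pair D y l" for n
    by (simp add: zscale_succ sr_pair_add [OF assms])
  from this [of "_ - 1"] this show ?thesis
    by (induction n rule: int_induct [where k = 0])
      (simp_all add: zscale_0 sr_pair_zero [OF assms] algebra_simps)
qed

context free_rep
begin

sublocale qk: field_map qk by (rule field_map)

lemmas sc_simps [simp] = actionD [OF sc, simplified]
lemmas \<rho>_simps [simp] = actionD [OF \<rho>, simplified]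

lemma eq_iff_minus: "a \<in> carrier M \<Longrightarrow> b \<in> carrier M \<Longrightarrow> a \<ominus> b = \<zero> \<longleftrightarrow> a = b"
  by (metis a_minus_def add.inv_closed add.inv_inv minus_equality r_neg)

lemma sc_zero [simp]: "sc c \<zero> = \<zero>"
  by (rule add_hom_zero [OF abelian_group_axioms abelian_group_axioms action_add_hom [OF sc]]) simp

lemma \<rho>_zero [simp]: "\<rho> p \<zero> = \<zero>"
  by (rule add_hom_zero [OF abelian_group_axioms abelian_group_axioms action_add_hom [OF \<rho>]]) simp

lemma sc_0 [simp]: "m \<in> carrier M \<Longrightarrow> sc 0 m = \<zero>"
  using action_zero [OF abelian_group_axioms ring_type_ring sc] by simp

lemma sc_minus: "m \<in> carrier M \<Longrightarrow> sc c (\<ominus> m) = \<ominus> sc c m"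
  by (rule add_hom_minus [OF abelian_group_axioms abelian_group_axioms action_add_hom [OF sc]]) simp_all

lemma sc_neg: "m \<in> carrier M \<Longrightarrow> sc (- c) m = \<ominus> sc c m"
  using action_minus [OF abelian_group_axioms ring_type_ring sc] by (simp add: type_ring_minus)

lemma sc_diff: "m \<in> carrier M \<Longrightarrow> sc (c - d) m = sc c m \<ominus> sc d m"
  using sc_simps(2) [of m c "- d"] by (simp add: sc_neg a_minus_def)

lemma sc_eq_0: "m \<in> carrier M \<Longrightarrow> sc c m = \<zero> \<longleftrightarrow> c = 0 \<or> m = \<zero>"
  by (metis sc_simps(4) sc_simps(5) left_inverse sc_0 sc_zero)

lemma \<rho>_diff: "m \<in> carrier M \<Longrightarrow> \<rho> (p - q) m = \<rho> p m \<ominus> \<rho> q m"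
  using \<rho>_simps (2) [of m p "- q"] action_minus [OF abelian_group_axioms ring_type_ring \<rho>, of m q]
  by (simp add: type_ring_minus a_minus_def)

lemma \<rho>_sum: "finite A \<Longrightarrow> m \<in> carrier M \<Longrightarrow> \<rho> (sum f A) m = (\<Oplus>a\<in>A. \<rho> (f a) m)"
proof (induction A rule: finite_induct)
  case empty
  then show ?case using action_zero [OF abelian_group_axioms ring_type_ring \<rho>, of m] by simp
next
  case (insert a A)
  then show ?case by (simp add: Pi_def)
qed

lemma of_sign_nonzero [simp]: "of_int e \<noteq> (0 :: 'k)"
  using sign by (metis of_int_1 of_int_mult mult_zero_left zero_neq_one)

lemma qk_sign: "qk (of_int e) = of_int e"
  using sign_cases [OF sign] by (auto simp: qk.one qk.minus)

definition w :: 'k where "w = qk qv_v"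

lemma w_nonzero [simp]: "w \<noteq> 0"
  by (simp add: w_def qk.eq_0_iff qv_v_nonzero)

lemma w_powi_eq_1: "w powi n = 1 \<longleftrightarrow> n = 0"
  unfolding w_def qk.power_int [symmetric]
  by (metis qk.inj qk.one qv_v_powi_eq_1)

sublocale spec: ring_map "\<lambda>r. qk (cov_spec e r)"
  by (rule ring_map_comp [OF qk.ring_map_axioms ring_map_cov_spec [OF sign]])

lemma spec_pi: "qk (cov_spec e (cov_pi powi n)) = of_int e powi n"
  by (simp add: cov_spec_powi cov_unit_pi sign cov_spec_pi qk.power_int qk_sign)

lemma spec_v: "qk (cov_spec e (U_v powi n)) = w powi n"
  by (simp add: cov_spec_powi cov_unit_U_v sign cov_spec_U_v qk.power_int w_def)

abbreviation E where "E i \<equiv> \<rho> (fgen (GE i))"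
abbreviation F where "F i \<equiv> \<rho> (fgen (GF i))"

lemma \<rho>_power: "m \<in> carrier M \<Longrightarrow> \<rho> (p ^ k) m = (\<rho> p ^^ k) m \<and> (\<rho> p ^^ k) m \<in> carrier M"
  by (induction k) simp_all

lemma \<rho>_serre:
  assumes D: "super_root_datum D" and m: "m \<in> carrier M"
  shows "\<rho> (serre D G i j) m = (\<Oplus>k\<in>{0..sr_b D i j}. sc (scoef D e w i j k)
    ((\<rho> (fgen (G i)) ^^ (sr_b D i j - k)) (\<rho> (fgen (G j)) ((\<rho> (fgen (G i)) ^^ k) m))))"
proof -
  have "qk (cov_spec e ((-1) ^ k * cov_pi ^ ((k choose 2) * sr_p D i + k * sr_p D i * sr_p D j) *
              cov_binom (U_v powi sr_d D i) (cov_pi powi sr_d D i) (sr_b D i j) k)) = scoef D e w i j k" for k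
    using sr_d_nonzero [OF D, of i]
    by (simp add: spec.mult spec.power spec.minus spec.one cov_spec_cov_binom sign qk.cov_binom qk.power_int
        scoef_def w_def qk_sign cov_spec_pi)
  then show ?thesis unfolding serre_def using m
    by (simp add: \<rho>_sum \<rho>_scal \<rho>_power mult.assoc del: funpow.simps)
qed

lemma \<rho>_EF_coef:
  assumes D: "super_root_datum D"
  shows "qk (cov_spec e (1 / (cov_pi powi sr_d D i * U_v powi sr_d D i - U_v powi (- sr_d D i)))) =
    1 / (of_int e powi sr_d D i * w powi sr_d D i - w powi (- sr_d D i))"
  using cov_unit_denominator [OF sr_d_nonzero [OF D], of i] sign
  by (simp add: cov_spec_divide qk.divide qk.diff spec.one spec.diff spec.mult spec_pi spec_v)

definition wsp :: "'x \<Rightarrow> 'm set"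
  where "wsp l = {m \<in> carrier M. \<forall>n. \<rho> (fgen (GK n)) m = sc (w powi sr_pair D n l) m \<and>
    \<rho> (fgen (GJ n)) m = sc (of_int e powi sr_pair D n l) m}"

lemma wsp_carrier: "m \<in> wsp l \<Longrightarrow> m \<in> carrier M"
  by (simp add: wsp_def)

lemma wsp_zero [simp]: "\<zero> \<in> wsp l"
  by (simp add: wsp_def)

lemma wsp_add: "m \<in> wsp l \<Longrightarrow> n \<in> wsp l \<Longrightarrow> m \<oplus> n \<in> wsp l"
  by (simp add: wsp_def)

lemma wsp_sc: "m \<in> wsp l \<Longrightarrow> sc c m \<in> wsp l"
  by (simp add: wsp_def flip: sc_\<rho> sc_simps(4)) (simp add: mult.commute)

text \<open>Since \<open>\<langle>d i, l\<rangle> = d \<langle>i, l\<rangle>\<close>, the Cartan part of the commutation relation acts on weight \<open>l\<close> by a quantum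
  integer.\<close>

lemma cartan_wsp:
  assumes D: "super_root_datum D"
    and K: "\<And>n. \<rho> (fgen (GK n)) m = sc (w powi sr_pair D n l) m"
    and J: "\<And>n. \<rho> (fgen (GJ n)) m = sc (of_int e powi sr_pair D n l) m"
    and m: "m \<in> carrier M"
  shows "\<rho> (fscal (1 / (cov_pi powi sr_d D i * U_v powi sr_d D i - U_v powi (- sr_d D i))) *
      (fgen (GJ (zscale (sr_d D i) (sr_iY D i))) * fgen (GK (zscale (sr_d D i) (sr_iY D i))) -
       fgen (GK (zscale (- sr_d D i) (sr_iY D i))))) m = sc (qint w e (sr_d D i) (sr_pair D (sr_iY D i) l)) m"
  using m by (simp add: \<rho>_scal \<rho>_EF_coef [OF D] \<rho>_diff K J sr_pair_zscale [OF D] sr_pair_minus [OF D] qint_def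
      flip: sc_\<rho> sc_simps(4) sc_diff) (simp add: mult.commute)

text \<open>On a sum of weight spaces the defining relations only have to be tested on weight vectors, where the
  Cartan part acts by scalars.\<close>

lemma rels_from_weights:
  assumes D: "super_root_datum D"
    and W: "\<And>l. W l \<subseteq> carrier M"
    and span: "\<And>m. m \<in> carrier M \<Longrightarrow> \<exists>c A. finite A \<and> (\<forall>l. c l \<in> W l) \<and> m = finsum M c A"
    and K: "\<And>m l n. m \<in> W l \<Longrightarrow> \<rho> (fgen (GK n)) m = sc (w powi sr_pair D n l) m"
    and J: "\<And>m l n. m \<in> W l \<Longrightarrow> \<rho> (fgen (GJ n)) m = sc (of_int e powi sr_pair D n l) m"
    and E: "\<And>m l i. m \<in> W l \<Longrightarrow> E i m \<in> W (l + sr_iX D i)"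
    and F: "\<And>m l i. m \<in> W l \<Longrightarrow> F i m \<in> W (l - sr_iX D i)"
    and EF: "\<And>m l i j. m \<in> W l \<Longrightarrow> E i (F j m) = sc (of_int e ^ (sr_p D i * sr_p D j)) (F j (E i m)) \<oplus>
      (if i = j then sc (qint w e (sr_d D i) (sr_pair D (sr_iY D i) l)) m else \<zero>)"
    and SE: "\<And>m l i j. m \<in> W l \<Longrightarrow> i \<noteq> j \<Longrightarrow> \<rho> (serre D GE i j) m = \<zero>"
    and SF: "\<And>m l i j. m \<in> W l \<Longrightarrow> i \<noteq> j \<Longrightarrow> \<rho> (serre D GF i j) m = \<zero>"
  shows "covering_rep D e qk M sc \<rho>"
proof unfold_locales
  fix r m
  assume r: "r \<in> U_rels D" and m: "m \<in> carrier M"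
  note A = sr_pair_add [OF D] sr_pair_diff [OF D]
  have C: "m \<in> carrier M" if "m \<in> W l" for m l using that W by blast
  have *: "\<rho> r m = \<zero>" if m: "m \<in> W l" for m l
    using r
  proof cases
    case (EF i j)
    have "\<rho> r m = E i (F j m) \<ominus> sc (of_int e ^ (sr_p D i * sr_p D j)) (F j (E i m)) \<ominus>
        (if i = j then sc (qint w e (sr_d D i) (sr_pair D (sr_iY D i) l)) m else \<zero>)"
      unfolding EF(1) \<rho>_diff [OF C [OF m]]
    proof (intro arg_cong2 [where f = "\<lambda>x y. x \<ominus> y"])
      show "\<rho> (fgen (GE i) * fgen (GF j)) m = E i (F j m)"
        using C [OF m] by simp
      show "\<rho> (fscal (cov_pi ^ (sr_p D i * sr_p D j)) * fgen (GF j) * fgen (GE i)) m =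
          sc (of_int e ^ (sr_p D i * sr_p D j)) (F j (E i m))"
        using C [OF m] by (simp add: \<rho>_scal spec.power cov_spec_pi qk_sign)
      show "\<rho> (if i = j then
            fscal (1 / (cov_pi powi sr_d D i * U_v powi sr_d D i - U_v powi (- sr_d D i))) *
            (fgen (GJ (zscale (sr_d D i) (sr_iY D i))) * fgen (GK (zscale (sr_d D i) (sr_iY D i))) -
             fgen (GK (zscale (- sr_d D i) (sr_iY D i))))
          else 0) m = (if i = j then sc (qint w e (sr_d D i) (sr_pair D (sr_iY D i) l)) m else \<zero>)"
        using cartan_wsp [OF D K [OF m] J [OF m] C [OF m], of i]
          action_zero [OF abelian_group_axioms ring_type_ring \<rho> C [OF m], simplified]
        by (simp only: if_split) auto
    qed
    then show ?thesis using C [OF m] unfolding assms(8) [OF m]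
      by (simp add: a_minus_def a_ac r_neg r_neg1 r_neg2)
  qed (use m C [OF m] in \<open>simp_all add: \<rho>_diff eq_iff_minus K J E F K [OF E] K [OF F] J [OF E] J [OF F] A
      \<rho>_scal spec_pi spec_v power_int_add power_int_diff sr_pair_zero [OF D] SE SF power2_eq_square mult.assoc
      flip: sc_\<rho> sc_simps(4)\<close>, simp_all add: mult.commute sign_powi [OF sign] divide_inverse power_int_minus)
  obtain c A where "finite A" "\<And>l. c l \<in> W l" "m = finsum M c A" using span [OF m] by blast
  moreover from this have "c l \<in> carrier M" "\<rho> r (c l) = \<zero>" for l
    using C * by blast+
  ultimately show "\<rho> r m = \<zero>"
    using add_hom_finsum [OF abelian_group_axioms abelian_group_axioms action_add_hom [OF \<rho>, of r], of A c] C
    by (simp add: Pi_def)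
qed

end

context covering_rep
begin

lemma rel_eq:
  assumes "p - q \<in> U_rels D" "m \<in> carrier M"
  shows "\<rho> p m = \<rho> q m"
  using rels [OF assms] assms(2) by (simp add: \<rho>_diff eq_iff_minus)

lemma E_wsp:
  assumes D: "super_root_datum D" and m: "m \<in> wsp l"
  shows "E i m \<in> wsp (l + sr_iX D i)"
proof -
  have K: "\<rho> (fgen (GK n)) m = sc (w powi sr_pair D n l) m"
    and J: "\<rho> (fgen (GJ n)) m = sc (of_int e powi sr_pair D n l) m" for n
    using m by (simp_all add: wsp_def)
  have C: "m \<in> carrier M" using m by (rule wsp_carrier)
  show ?thesis
    using C rel_eq [OF U_rels.KE C] rel_eq [OF U_rels.JE C] unfolding wsp_def
    by (simp add: \<rho>_scal spec_pi spec_v K J sr_pair_add [OF D] power_int_add flip: sc_\<rho> sc_simps(4))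
qed

lemma F_wsp:
  assumes D: "super_root_datum D" and m: "m \<in> wsp l"
  shows "F i m \<in> wsp (l - sr_iX D i)"
proof -
  have K: "\<rho> (fgen (GK n)) m = sc (w powi sr_pair D n l) m"
    and J: "\<rho> (fgen (GJ n)) m = sc (of_int e powi sr_pair D n l) m" for n
    using m by (simp_all add: wsp_def)
  have C: "m \<in> carrier M" using m by (rule wsp_carrier)
  show ?thesis
    using C rel_eq [OF U_rels.KF C] rel_eq [OF U_rels.JF C] unfolding wsp_def
    by (simp add: \<rho>_scal spec_pi spec_v K J sr_pair_diff [OF D] power_int_diff power_int_minus
        divide_inverse flip: sc_\<rho> sc_simps(4))
qed

lemma EF_wsp:
  fixes i j :: 'i
  assumes D: "super_root_datum D" and m: "m \<in> wsp l"
  shows "E i (F j m) = sc (of_int e ^ (sr_p D i * sr_p D j)) (F j (E i m)) \<oplus>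
    (if i = j then sc (qint w e (sr_d D i) (sr_pair D (sr_iY D i) l)) m else \<zero>)"
proof -
  have K: "\<rho> (fgen (GK n)) m = sc (w powi sr_pair D n l) m"
    and J: "\<rho> (fgen (GJ n)) m = sc (of_int e powi sr_pair D n l) m" for n
    using m by (simp_all add: wsp_def)
  have C: "m \<in> carrier M" using m by (rule wsp_carrier)
  define c :: "('i, 'y) freeU" where "c = (if i = j then
            fscal (1 / (cov_pi powi sr_d D i * U_v powi sr_d D i - U_v powi (- sr_d D i))) *
            (fgen (GJ (zscale (sr_d D i) (sr_iY D i))) * fgen (GK (zscale (sr_d D i) (sr_iY D i))) -
             fgen (GK (zscale (- sr_d D i) (sr_iY D i))))
          else 0)"
  have c: "\<rho> c m = (if i = j then sc (qint w e (sr_d D i) (sr_pair D (sr_iY D i) l)) m else \<zero>)"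
    using cartan_wsp [OF D K J C, of i] action_zero [OF abelian_group_axioms ring_type_ring \<rho> C, simplified]
    unfolding c_def by (simp only: if_split) auto
  have "fgen (GE i) * fgen (GF j) -
      (fscal (cov_pi ^ (sr_p D i * sr_p D j)) * fgen (GF j) * fgen (GE i) + c) \<in> U_rels D"
    using U_rels.EF [of i j D] unfolding c_def by (simp only: diff_diff_add)
  from rel_eq [OF this C] show ?thesis
    using C by (simp add: c \<rho>_scal spec.power cov_spec_pi qk_sign)
qed

lemma serre_0:
  assumes "m \<in> carrier M" "i \<noteq> j"
  shows "\<rho> (serre D GE i j) m = \<zero>" "\<rho> (serre D GF i j) m = \<zero>"
  using rels [OF U_rels.SE] rels [OF U_rels.SF] assms by auto

end

subsection \<open>Weight modules\<close>

locale weight_rep = covering_rep D e qk M sc \<rho>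
  for D :: "('i :: finite, 'y :: ab_group_add, 'x :: ab_group_add) root_datum"
    and e :: int and qk :: "qv \<Rightarrow> 'k :: field" and M :: "('m, 'w) ring_scheme" (structure)
    and sc :: "'k \<Rightarrow> 'm \<Rightarrow> 'm" and \<rho> :: "('i, 'y) freeU \<Rightarrow> 'm \<Rightarrow> 'm" +
  assumes datum: "super_root_datum D"
    and weights: "m \<in> carrier M \<Longrightarrow> \<exists>!c. (\<forall>l. c l \<in> wsp l) \<and> finite {l. c l \<noteq> \<zero>} \<and>
      m = finsum M c {l. c l \<noteq> \<zero>}"
begin

text \<open>The weight component of weight \<open>l\<close>, well defined by uniqueness of the decomposition.\<close>

definition comp :: "'m \<Rightarrow> 'x \<Rightarrow> 'm"
  where "comp m = (THE c. (\<forall>l. c l \<in> wsp l) \<and> finite {l. c l \<noteq> \<zero>} \<and> m = finsum M c {l. c l \<noteq> \<zero>})"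

definition supp :: "'m \<Rightarrow> 'x set"
  where "supp m = {l. comp m l \<noteq> \<zero>}"

lemma comp_props:
  assumes "m \<in> carrier M"
  shows "comp m l \<in> wsp l" "finite (supp m)" "finsum M (comp m) (supp m) = m"
  using theI' [OF weights [OF assms]] unfolding comp_def supp_def by auto

lemma comp_carrier [simp]: "m \<in> carrier M \<Longrightarrow> comp m l \<in> carrier M"
  using comp_props(1) wsp_carrier by blast

lemma finsum_supp:
  assumes "\<And>l. c l \<in> carrier M" "finite A" "\<And>l. l \<notin> A \<Longrightarrow> c l = \<zero>"
  shows "finsum M c {l. c l \<noteq> \<zero>} = finsum M c A"
  by (rule add.finprod_mono_neutral_cong_left) (use assms in auto)

lemma comp_unique:
  assumes c: "\<And>l. c l \<in> wsp l" and A: "finite A" "\<And>l. l \<notin> A \<Longrightarrow> c l = \<zero>"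
  shows "comp (finsum M c A) = c"
proof -
  have C: "c l \<in> carrier M" for l using c wsp_carrier by blast
  then have M: "finsum M c A \<in> carrier M" by simp
  have "finite {l. c l \<noteq> \<zero>}" by (rule finite_subset [OF _ A(1)]) (use A in auto)
  then have "(\<forall>l. c l \<in> wsp l) \<and> finite {l. c l \<noteq> \<zero>} \<and> finsum M c A = finsum M c {l. c l \<noteq> \<zero>}"
    using c finsum_supp [OF C A] by simp
  then show ?thesis unfolding comp_def by (rule the1_equality [OF weights [OF M]])
qed

lemma comp_eqI:
  assumes "\<And>l. c l \<in> wsp l" "finite A" "\<And>l. l \<notin> A \<Longrightarrow> c l = \<zero>" "m = finsum M c A"
  shows "comp m l = c l"
  using comp_unique [of c A] assms by simp

lemma finsum_superset:
  assumes "m \<in> carrier M" "finite A" "supp m \<subseteq> A" "\<And>l. f l \<zero> = \<zero>" "\<And>l x. x \<in> carrier M \<Longrightarrow> f l x \<in> carrier M"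
  shows "finsum M (\<lambda>l. f l (comp m l)) (supp m) = finsum M (\<lambda>l. f l (comp m l)) A"
  by (rule add.finprod_mono_neutral_cong_left) (use assms in \<open>auto simp: supp_def\<close>)

lemma comp_add:
  assumes m: "m \<in> carrier M" "n \<in> carrier M"
  shows "comp (m \<oplus> n) l = comp m l \<oplus> comp n l"
proof (rule comp_eqI [where A = "supp m \<union> supp n"])
  have "m \<oplus> n = finsum M (comp m) (supp m) \<oplus> finsum M (comp n) (supp n)"
    using m by (simp add: comp_props)
  also have "\<dots> = finsum M (comp m) (supp m \<union> supp n) \<oplus> finsum M (comp n) (supp m \<union> supp n)"
    using finsum_superset [of m "supp m \<union> supp n" "\<lambda>l x. x"] finsum_superset [of n "supp m \<union> supp n" "\<lambda>l x. x"]
      m comp_props by simp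
  finally show "m \<oplus> n = finsum M (\<lambda>l. comp m l \<oplus> comp n l) (supp m \<union> supp n)"
    using m by (simp add: finsum_addf)
qed (use m comp_props wsp_add in \<open>auto simp: supp_def\<close>)

lemma comp_sc:
  assumes m: "m \<in> carrier M"
  shows "comp (sc c m) l = sc c (comp m l)"
proof (rule comp_eqI [where A = "supp m"])
  show "sc c m = finsum M (\<lambda>l. sc c (comp m l)) (supp m)"
    using add_hom_finsum [OF abelian_group_axioms abelian_group_axioms action_add_hom [OF sc, of c], of "supp m" "comp m"]
      comp_props m by simp
qed (use m comp_props wsp_sc in \<open>auto simp: supp_def\<close>)

lemma comp_wsp:
  assumes m: "m \<in> wsp l"
  shows "comp m k = (if k = l then m else \<zero>)"
  by (rule comp_eqI [where A = "{l}"]) (use m wsp_carrier [OF m] in auto)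

lemma weight_ext:
  assumes N: "abelian_group N" and f: "add_hom M N f" and g: "add_hom M N g"
    and eq: "\<And>l m. m \<in> wsp l \<Longrightarrow> f m = g m" and m: "m \<in> carrier M"
  shows "f m = g m"
proof -
  interpret N: abelian_group N by (rule N)
  have "f (finsum M (comp m) (supp m)) = g (finsum M (comp m) (supp m))"
    using add_hom_finsum [OF abelian_group_axioms N f, of "supp m" "comp m"]
      add_hom_finsum [OF abelian_group_axioms N g, of "supp m" "comp m"] m comp_props
      eq [OF comp_props(1) [OF m]] by simp
  then show ?thesis using m by (simp add: comp_props)
qed

text \<open>Diagonal operators are defined through weight components, hence on the whole module. Operators prescribed on
  weight vectors, such as the twisted generators and the projections to weight spaces, are composed of them.\<close>

definition diag :: "('x \<Rightarrow> 'k) \<Rightarrow> 'm \<Rightarrow> 'm"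
  where "diag \<phi> m = finsum M (\<lambda>l. sc (\<phi> l) (comp m l)) (supp m)"

lemma diag_closed [simp]: "m \<in> carrier M \<Longrightarrow> diag \<phi> m \<in> carrier M"
  by (simp add: diag_def Pi_def)

lemma diag_superset:
  assumes "m \<in> carrier M" "finite A" "supp m \<subseteq> A"
  shows "diag \<phi> m = finsum M (\<lambda>l. sc (\<phi> l) (comp m l)) A"
  unfolding diag_def using finsum_superset [OF assms, of "\<lambda>l. sc (\<phi> l)"] by simp

lemma supp_add: "m \<in> carrier M \<Longrightarrow> n \<in> carrier M \<Longrightarrow> supp (m \<oplus> n) \<subseteq> supp m \<union> supp n"
  by (auto simp: supp_def comp_add)

lemma diag_add_hom: "add_hom M M (diag \<phi>)"
proof -
  have "diag \<phi> (m \<oplus> n) = diag \<phi> m \<oplus> diag \<phi> n" if m: "m \<in> carrier M" "n \<in> carrier M" for m n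
    using m comp_props supp_add [OF m]
    by (simp add: diag_superset [where A = "supp m \<union> supp n"] comp_add finsum_addf Pi_def)
  then show ?thesis by (simp add: add_hom_def)
qed

lemma diag_wsp:
  assumes m: "m \<in> wsp l"
  shows "diag \<phi> m = sc (\<phi> l) m"
proof -
  have "supp m \<subseteq> {l}" by (auto simp: supp_def comp_wsp [OF m])
  then show ?thesis using wsp_carrier [OF m]
    by (simp add: diag_superset [where A = "{l}"] comp_wsp [OF m])
qed

lemma diag_sc:
  assumes "m \<in> carrier M"
  shows "diag \<phi> (sc c m) = sc c (diag \<phi> m)"
proof -
  have "supp (sc c m) \<subseteq> supp m" using assms by (auto simp: supp_def comp_sc)
  then show ?thesis
    using assms comp_props
      add_hom_finsum [OF abelian_group_axioms abelian_group_axioms action_add_hom [OF sc, of c], of "supp m"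
        "\<lambda>l. sc (\<phi> l) (comp m l)"]
    by (simp add: diag_superset [where A = "supp m"] comp_sc Pi_def flip: sc_simps(4)) (simp add: mult.commute)
qed

end

text \<open>Perfectness of the pairing, applied to the functional \<open>\<langle>-, l\<rangle>\<close> on \<open>Y\<close>.\<close>

lemma weights_separated:
  assumes D: "super_root_datum D" and eq: "\<And>n. sr_pair D n l = sr_pair D n k"
  shows "l = k"
proof -
  have "perfect_pairing (sr_pair D)" using D by (simp add: super_root_datum_def)
  then have "(\<forall>x y. sr_pair D (x + y) l = sr_pair D x l + sr_pair D y l) \<longrightarrow>
      (\<exists>!b. \<forall>y. sr_pair D y l = sr_pair D y b)"
    unfolding perfect_pairing_def by (elim conjE) (erule spec [where x = "\<lambda>y. sr_pair D y l"])
  then have "\<exists>!b. \<forall>y. sr_pair D y l = sr_pair D y b"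
    using sr_pair_add [OF D] by blast
  then show ?thesis using eq by blast
qed


section \<open>The twistor exponents\<close>

lemma qvt_t_powi_2: "qvt_t powi (2 * n) = (-1) powi n"
proof -
  have "qvt_t powi 2 = - 1" by (simp add: power2_eq_square qvt_t_mult)
  then show ?thesis by (simp add: power_int_mult)
qed

lemma qvt_t_powi_cong:
  assumes "4 dvd a - b"
  shows "qvt_t powi a = qvt_t powi b"
proof -
  obtain k where k: "a = b + 2 * (2 * k)" using assms by (metis dvdE add.commute diff_add_cancel
        mult.assoc mult_2 numeral_Bit0 one_add_one)
  have "qvt_t ^ 4 = 1" by (simp add: power4_eq_xxxx qvt_t_mult)
  then show ?thesis unfolding k by (simp add: power_int_add qvt_t_nonzero qvt_t_powi_2 power_int_mult)
qed

lemma sign_qvt_t: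
  assumes "\<epsilon> * \<epsilon> = (1 :: int)"
  shows "of_int \<epsilon> * qvt_t = qvt_t powi \<epsilon>"
proof -
  have "inverse qvt_t = - qvt_t" by (rule inverse_unique) (simp add: qvt_t_mult)
  then show ?thesis using sign_cases [OF assms] by auto
qed

lemma of_int_neg_powi: "of_int (- e) powi n = (-1) powi n * (of_int e powi n :: 'k :: field)"
  by (simp flip: power_int_mult_distrib)

context
  fixes \<epsilon> e :: int and w z :: qvt
  assumes \<epsilon>: "\<epsilon> * \<epsilon> = 1" and z: "z = qvt_t powi \<epsilon> * w"
begin

text \<open>The identity \<open>(-1) t\<^sup>\<epsilon> = t\<^sup>-\<^sup>\<epsilon>\<close> makes the change of \<open>\<pi>\<close> and the change of \<open>v\<close> compensate.\<close>

lemma twist_powi: "of_int (- e) powi n * z powi n = qvt_t powi (- \<epsilon> * n) * (of_int e powi n * w powi n)"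
proof -
  have "(-1) powi n * qvt_t powi (\<epsilon> * n) = qvt_t powi (2 * n + \<epsilon> * n)"
    by (simp add: power_int_add qvt_t_nonzero qvt_t_powi_2)
  also have "\<dots> = qvt_t powi (- \<epsilon> * n)"
    by (rule qvt_t_powi_cong) (use sign_cases [OF \<epsilon>] in auto)
  finally have *: "(-1) powi n * qvt_t powi (\<epsilon> * n) = qvt_t powi (- \<epsilon> * n)" .
  have "of_int (- e) powi n * z powi n =
      ((-1) powi n * qvt_t powi (\<epsilon> * n)) * (of_int e powi n * w powi n)"
    by (simp only: z power_int_mult_distrib power_int_mult of_int_neg_powi mult_ac)
  then show ?thesis by (simp only: * )
qed

lemma twist_powi_neg: "z powi (- n) = qvt_t powi (- \<epsilon> * n) * w powi (- n)"
  by (simp add: z power_int_mult_distrib flip: power_int_mult)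

lemma twist_powi_diff:
  "of_int (- e) powi n * z powi n - z powi (- n) =
    qvt_t powi (- \<epsilon> * n) * (of_int e powi n * w powi n - w powi (- n))"
  by (simp only: twist_powi twist_powi_neg right_diff_distrib)

lemma qint_twist: "qint z (- e) d n = qvt_t powi (- \<epsilon> * d * (n - 1)) * qint w e d n"
proof -
  have "- \<epsilon> * (d * n) = - \<epsilon> * d * (n - 1) + - \<epsilon> * d" by (simp add: algebra_simps)
  then have p: "qvt_t powi (- \<epsilon> * (d * n)) = qvt_t powi (- \<epsilon> * d * (n - 1)) * qvt_t powi (- \<epsilon> * d)"
    by (simp only: power_int_add qvt_t_nonzero simp_thms)
  have "a * b * x / (b * y) = a * (x / y)" if "b \<noteq> 0" for a b x y :: qvt
    using that by simp
  moreover have "qvt_t powi (- \<epsilon> * d) \<noteq> 0" by (simp add: qvt_t_nonzero)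
  ultimately show ?thesis unfolding qint_def twist_powi_diff p by blast
qed

text \<open>The exponents \<open>- \<epsilon> d l\<close> over the numerator exceed those over the denominator by \<open>- \<epsilon> d (n - k)\<close> in each of the
  \<open>k\<close> factors.\<close>

lemma cov_binom_twist:
  assumes k: "k \<le> n"
  shows "cov_binom (z powi d) (of_int (- e) powi d) n k =
    qvt_t powi (- \<epsilon> * d * int k * int (n - k)) * cov_binom (w powi d) (of_int e powi d) n k"
proof -
  let ?\<tau> = "\<lambda>l. qvt_t powi (- \<epsilon> * d * int l)"
  have f: "(of_int (- e) powi d * z powi d) ^ l - (z powi d) powi (- int l) =
      ?\<tau> l * ((of_int e powi d * w powi d) ^ l - (w powi d) powi (- int l))" for l
    using twist_powi_diff [of "d * int l"]
    by (simp add: power_mult_distrib mult.assoc flip: power_int_mult power_int_power')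
  have s: "{n - k + 1..n} = {1 + (n - k)..k + (n - k)}" using k by simp
  have "prod ?\<tau> {n - k + 1..n} = (\<Prod>l = 1..k. ?\<tau> (l + (n - k)))"
    unfolding s by (rule prod.shift_bounds_cl_nat_ivl)
  also have "\<dots> = (\<Prod>l = 1..k. ?\<tau> l * ?\<tau> (n - k))"
  proof (rule prod.cong [OF refl])
    fix l
    have "- \<epsilon> * d * int (l + (n - k)) = - \<epsilon> * d * int l + - \<epsilon> * d * int (n - k)"
      by (simp only: of_nat_add distrib_left)
    then show "?\<tau> (l + (n - k)) = ?\<tau> l * ?\<tau> (n - k)"
      by (simp only: power_int_add qvt_t_nonzero simp_thms)
  qed
  also have "\<dots> = prod ?\<tau> {1..k} * ?\<tau> (n - k) ^ k"
    by (simp add: prod.distrib)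
  also have "?\<tau> (n - k) ^ k = qvt_t powi (- \<epsilon> * d * int k * int (n - k))"
    by (simp only: power_int_of_nat [symmetric] power_int_mult [symmetric]) (simp only: mult_ac)
  finally have p: "prod ?\<tau> {n - k + 1..n} = prod ?\<tau> {1..k} * qvt_t powi (- \<epsilon> * d * int k * int (n - k))" .
  have "b * a * x / (b * y) = a * (x / y)" if "b \<noteq> 0" for a b x y :: qvt
    using that by simp
  moreover have "prod ?\<tau> {1..k} \<noteq> 0" by (simp add: qvt_t_nonzero)
  ultimately show ?thesis
    unfolding cov_binom_def f prod.distrib p by blast
qed

lemma scoef_twist:
  assumes k: "k \<le> sr_b D i j"
  shows "scoef D (- e) z i j k = qvt_t powi (int k * (int k - 1) * int (sr_p D i) +
      2 * int k * int (sr_p D i) * int (sr_p D j) - \<epsilon> * sr_d D i * int k * int (sr_b D i j - k)) *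
    scoef D e w i j k"
proof -
  define n where "n = (k choose 2) * sr_p D i + k * sr_p D i * sr_p D j"
  have "even (k * (k - 1))" by (cases k) simp_all
  then have "2 * (k choose 2) = k * (k - 1)" by (simp only: choose_two dvd_mult_div_cancel)
  then have "2 * int (k choose 2) = int (k * (k - 1))" by (metis of_nat_mult of_nat_numeral)
  also have "\<dots> = int k * (int k - 1)" by (cases k) (simp_all add: algebra_simps)
  finally have c: "int k * (int k - 1) = 2 * int (k choose 2)" ..
  have n: "2 * int n = int k * (int k - 1) * int (sr_p D i) + 2 * int k * int (sr_p D i) * int (sr_p D j)"
    unfolding n_def c by (simp add: algebra_simps)
  have "of_int (- e) ^ n = qvt_t powi (2 * int n) * of_int e ^ n"
    by (simp add: qvt_t_powi_2 power_mult_distrib flip: power_mult_distrib)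
  moreover have "int k * (int k - 1) * int (sr_p D i) + 2 * int k * int (sr_p D i) * int (sr_p D j) -
      \<epsilon> * sr_d D i * int k * int (sr_b D i j - k) =
      2 * int n + - \<epsilon> * sr_d D i * int k * int (sr_b D i j - k)" by (simp add: n)
  ultimately show ?thesis
    by (simp only: scoef_def n_def [symmetric] cov_binom_twist [OF k] power_int_add qvt_t_nonzero simp_thms)
      (simp only: mult_ac)
qed

end

lemma (in field_map) scoef: "h (scoef D e w i j k) = scoef D e (h w) i j k"
  by (simp add: scoef_def mult power minus one cov_binom power_int of_int)

lemma (in field_map) qint: "h (qint w e d n) = qint (h w) e d n"
  by (simp add: qint_def divide diff mult power_int of_int)

text \<open>On weight \<open>l\<close> the twisted \<open>E\<^sub>i\<close> is \<open>t\<close> to the power \<open>f i l\<close> times the old one, and \<open>F\<^sub>i\<close> likewise with \<open>g\<close>; only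
  exponents modulo \<open>4\<close> matter. Affine dependence on the root lattice, with slopes \<open>u\<close> and \<open>u'\<close>, makes every word
  contribute an exponent that is easy to compute. The third condition turns the commutator \<open>[E\<^sub>i, F\<^sub>i]\<close> into the
  quantum integer for \<open>-\<pi>\<close>, the fourth accounts for the sign \<open>\<pi>\<^sup>p\<^sup>(\<^sup>i\<^sup>)\<^sup>p\<^sup>(\<^sup>j\<^sup>)\<close>, and the last two are the Serre relations
  for \<open>E\<close> and \<open>F\<close>.\<close>

definition twist_exponents ::
    "('i, 'y, 'x :: ab_group_add) root_datum \<Rightarrow> int \<Rightarrow> ('i \<Rightarrow> 'x \<Rightarrow> int) \<Rightarrow> ('i \<Rightarrow> 'x \<Rightarrow> int) \<Rightarrow>
     ('i \<Rightarrow> 'i \<Rightarrow> int) \<Rightarrow> ('i \<Rightarrow> 'i \<Rightarrow> int) \<Rightarrow> bool"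
  where "twist_exponents D \<epsilon> f g u u' \<longleftrightarrow>
    (\<forall>i j l. f i (l + sr_iX D j) = f i l + u i j) \<and>
    (\<forall>i j l. g i (l - sr_iX D j) = g i l + u' i j) \<and>
    (\<forall>i l. 4 dvd f i (l - sr_iX D i) + g i l + \<epsilon> * sr_d D i * (sr_pair D (sr_iY D i) l - 1)) \<and>
    (\<forall>i j. 4 dvd u' j i - u i j - 2 * int (sr_p D i) * int (sr_p D j)) \<and>
    (\<forall>i j. i \<noteq> j \<longrightarrow>
      4 dvd u j i - u i j - (2 * int (sr_p D i) * int (sr_p D j) - \<epsilon> * sr_d D i * sr_a D i j) \<and>
      4 dvd u' j i - u' i j - (2 * int (sr_p D i) * int (sr_p D j) - \<epsilon> * sr_d D i * sr_a D i j))"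

text \<open>The conditions are odd in \<open>(\<epsilon>, f, g, u, u')\<close> up to the terms \<open>2 p(i) p(j)\<close>, which equal their own negatives modulo
  \<open>4\<close>.\<close>

lemma twist_exponents_neg:
  assumes "twist_exponents D 1 f g u u'"
  shows "twist_exponents D (- 1) (\<lambda>i l. - f i l) (\<lambda>i l. - g i l) (\<lambda>i j. - u i j) (\<lambda>i j. - u' i j)"
proof -
  have neg: "4 dvd - a - - b - (2 * p * q - - 1 * d * c)" if "4 dvd a - b - (2 * p * q - 1 * d * c)"
    for a b p q d c :: int
  proof -
    from that have "4 dvd - (a - b - (2 * p * q - 1 * d * c)) - 4 * p * q"
      by (metis dvd_diff dvd_minus_iff dvd_triv_left mult.assoc)
    then show ?thesis by (simp add: algebra_simps)
  qed
  have neg': "4 dvd - a - - b - 2 * p * q" if "4 dvd a - b - 2 * p * q" for a b p q :: int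
    using neg [of a b p q 0 0] that by simp
  have neg'': "4 dvd - a + - b + - 1 * d * c" if "4 dvd a + b + 1 * d * c" for a b c d :: int
  proof -
    have "- a + - b + - 1 * d * c = - (a + b + 1 * d * c)" by simp
    then show ?thesis using that by (metis dvd_minus_iff)
  qed
  show ?thesis unfolding twist_exponents_def
    by (intro conjI allI impI neg neg' neg'') (use assms in \<open>simp_all add: twist_exponents_def\<close>)
qed

text \<open>The weight lattice is a free set under translation by the root lattice: a choice of coset
  representatives gives every weight coordinates with respect to the simple roots.\<close>

lemma root_coordinates:
  fixes D :: "('i :: finite, 'y :: ab_group_add, 'x :: ab_group_add) root_datum"
  assumes D: "super_root_datum D"
  shows "\<exists>c :: 'x \<Rightarrow> 'i \<Rightarrow> int. \<forall>l i j. c (l + sr_iX D i) j = c l j + (if i = j then 1 else 0)"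
proof -
  let ?B = "range (sr_iX D)"
  have ind: "Zmod.independent ?B" and inj: "inj (sr_iX D)"
    using D by (simp_all add: super_root_datum_def)
  \<comment> \<open>a representative of the coset of \<open>l\<close>, hence unchanged under translation by roots\<close>
  define r where "r l = (SOME k. l - k \<in> Zmod.span ?B)" for l
  have r: "l - r l \<in> Zmod.span ?B" for l
    unfolding r_def by (rule someI [of _ l]) (simp add: Zmod.span_zero)
  have shift: "r (l + sr_iX D i) = r l" for l i
  proof -
    have b: "sr_iX D i \<in> Zmod.span ?B" by (rule Zmod.span_base) simp
    have "(l + sr_iX D i) - k \<in> Zmod.span ?B \<longleftrightarrow> l - k \<in> Zmod.span ?B" for k
    proof
      assume "l + sr_iX D i - k \<in> Zmod.span ?B"
      from Zmod.span_diff [OF this b] show "l - k \<in> Zmod.span ?B" by (simp add: algebra_simps)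
    next
      assume "l - k \<in> Zmod.span ?B"
      from Zmod.span_add [OF this b] show "l + sr_iX D i - k \<in> Zmod.span ?B" by (simp add: algebra_simps)
    qed
    then show ?thesis by (simp add: r_def)
  qed
  define c where "c l j = Zmod.representation ?B (l - r l) (sr_iX D j)" for l j
  have "c (l + sr_iX D i) j = c l j + (if i = j then 1 else 0)" for l i j
  proof -
    have e: "l + sr_iX D i - r l = sr_iX D i + (l - r l)" by simp
    have "Zmod.representation ?B (l + sr_iX D i - r l) =
        (\<lambda>b. Zmod.representation ?B (sr_iX D i) b + Zmod.representation ?B (l - r l) b)"
      unfolding e by (rule Zmod.representation_add [OF ind r Zmod.span_base]) simp
    then show ?thesis
      using inj by (auto simp: c_def shift Zmod.representation_basis [OF ind] inj_eq)
  qed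
  then show ?thesis by blast
qed

text \<open>With root coordinates \<open>c\<close>, the choice \<open>g i l = (\<Sum>k. h i k * c l k)\<close> has slopes \<open>- h i j\<close>, and \<open>f\<close> is then determined by the
  condition on the commutator \<open>[E\<^sub>i, F\<^sub>i]\<close>. What remains is to prescribe \<open>h i j - h j i\<close> for \<open>i \<noteq> j\<close> as
  \<open>2 p(i) p(j) - i \<cdot> j\<close> modulo \<open>4\<close>. Since \<open>i \<cdot> j\<close> is even, by the parity conditions of the datum, this is
  antisymmetric modulo \<open>4\<close>, and a triangular \<open>h\<close> with respect to any ordering of \<open>I\<close> solves it.\<close>

lemma twist_exponents_exist:
  fixes D :: "('i :: finite, 'y :: ab_group_add, 'x :: ab_group_add) root_datum"
  assumes D: "super_root_datum D"
  shows "\<exists>f g u u'. twist_exponents D 1 f g u u'"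
proof -
  obtain c :: "'x \<Rightarrow> 'i \<Rightarrow> int" where c: "\<And>l i j. c (l + sr_iX D i) j = c l j + (if i = j then 1 else 0)"
    using root_coordinates [OF D] by blast
  obtain ord :: "'i \<Rightarrow> nat" where ord: "inj ord"
    using finite_imp_inj_to_nat_seg [of "UNIV :: 'i set"] by auto
  let ?p = "\<lambda>i. int (sr_p D i)"
  have car: "super_cartan_datum D" and pair: "sr_pair D (sr_iY D i) (sr_iX D j) = sr_a D i j" for i j
    using D by (simp_all add: super_root_datum_def)
  have da: "sr_d D i * sr_a D i j = sr_dot D i j" for i j
  proof -
    have "2 * sr_d D i = sr_dot D i i" "sr_dot D i i * sr_a D i j = 2 * sr_dot D i j"
      using car by (simp_all add: super_cartan_datum_def sr_d_def sr_a_def)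
    then show ?thesis by (metis mult.assoc mult_cancel_left zero_neq_numeral)
  qed
  have sym: "sr_dot D i j = sr_dot D j i" for i j
    using car unfolding super_cartan_datum_def sr_dot_def by blast
  have par: "even (sr_d D i - ?p i)" for i
    using car unfolding super_cartan_datum_def by (metis mod_eq_dvd_iff)
  have ev: "even (sr_dot D i j)" if "i \<noteq> j" for i j
  proof (cases "i \<in> sr_odd D")
    case True
    then have "even (sr_a D i j)" using car by (simp add: super_cartan_datum_def)
    then show ?thesis by (simp flip: da)
  next
    case False
    then have "even (sr_d D i)" using par [of i] by (simp add: sr_p_def)
    then show ?thesis by (simp flip: da)
  qed
  have aii: "sr_dot D i i = 2 * sr_d D i" for i
    using car by (simp add: super_cartan_datum_def sr_d_def)
  define h where "h i j = (if ord i < ord j then 2 * ?p i * ?p j - sr_dot D i j else 0)" for i j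
  have h: "4 dvd h i j - h j i - (2 * ?p i * ?p j - sr_dot D i j)" if ij: "i \<noteq> j" for i j
  proof -
    obtain k where k: "sr_dot D i j = 2 * k" using ev [OF ij] by blast
    have "ord i < ord j \<or> ord j < ord i" using ij ord by (metis injD nat_neq_iff)
    then show ?thesis
    proof
      assume "ord j < ord i"
      then have "h i j - h j i - (2 * ?p i * ?p j - sr_dot D i j) = 4 * (k - ?p i * ?p j)"
        by (simp add: h_def sym [of j i] k algebra_simps)
      then show ?thesis by (metis dvd_triv_left)
    qed (simp add: h_def)
  qed
  define g where "g i l = (\<Sum>k\<in>UNIV. h i k * c l k)" for i l
  define f where "f i l = - sr_d D i * (sr_pair D (sr_iY D i) l + 1) - g i (l + sr_iX D i)" for i l
  have g: "g i (l + sr_iX D j) = g i l + h i j" for i j l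
  proof -
    have "h i k * c (l + sr_iX D j) k = h i k * c l k + (if j = k then h i k else 0)" for k
      by (simp add: c algebra_simps)
    then show ?thesis by (simp add: g_def sum.distrib)
  qed
  have g': "g i (l - sr_iX D j) = g i l - h i j" for i j l
    using g [of i "l - sr_iX D j" j] by simp
  have "f i (l + sr_iX D j) = f i l + (- sr_dot D i j - h i j)" for i j l
  proof -
    have "l + sr_iX D j + sr_iX D i = l + sr_iX D i + sr_iX D j" by (simp add: ac_simps)
    then show ?thesis by (simp only: f_def g) (simp add: sr_pair_add [OF D] pair algebra_simps flip: da)
  qed
  moreover have "f i (l - sr_iX D i) + g i l + 1 * sr_d D i * (sr_pair D (sr_iY D i) l - 1) = 0" for i l
  proof -
    have "sr_a D i i = 2" using da [of i i] aii [of i] sr_d_nonzero [OF D, of i] by simp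
    then show ?thesis by (simp add: f_def sr_pair_diff [OF D] pair algebra_simps)
  qed
  moreover have "4 dvd - h j i - (- sr_dot D i j - h i j) - 2 * ?p i * ?p j" for i j
  proof (cases "i = j")
    case True
    obtain k where k: "sr_d D i = ?p i + 2 * k" using par [of i] by (metis dvdE add.commute diff_add_cancel)
    have p: "?p i * ?p i = ?p i" by (simp add: sr_p_def)
    have "- h j i - (- sr_dot D i j - h i j) - 2 * ?p i * ?p j = 2 * sr_d D i - 2 * (?p i * ?p i)"
      using True by (simp add: aii)
    also have "\<dots> = 4 * k" unfolding p k by simp
    finally show ?thesis by (metis dvd_triv_left)
  next
    case False
    then show ?thesis using h [of i j] by (simp add: algebra_simps)
  qed
  moreover have "4 dvd (- sr_dot D j i - h j i) - (- sr_dot D i j - h i j) -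
        (2 * ?p i * ?p j - 1 * sr_d D i * sr_a D i j)"
      "4 dvd - h j i - - h i j - (2 * ?p i * ?p j - 1 * sr_d D i * sr_a D i j)" if "i \<noteq> j" for i j
    using h [OF that] by (simp_all add: da sym [of j i] algebra_simps)
  ultimately have "twist_exponents D 1 f g (\<lambda>i j. - sr_dot D i j - h i j) (\<lambda>i j. - h i j)"
    unfolding twist_exponents_def by (simp add: g')
  then show ?thesis by blast
qed

text \<open>The exponents make every summand of the Serre relation pick up the same power of \<open>t\<close>: the
  dependence on \<open>k\<close> of the three contributions cancels modulo \<open>4\<close>, because \<open>d\<^sub>i \<equiv> p(i)\<close> modulo \<open>2\<close>.\<close>

lemma serre_exponent:
  assumes D: "super_root_datum D" and \<epsilon>: "\<epsilon> * \<epsilon> = 1" and ij: "i \<noteq> j" and k: "k \<le> sr_b D i j"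
    and u: "4 dvd a - (2 * int (sr_p D i) * int (sr_p D j) - \<epsilon> * sr_d D i * sr_a D i j)"
  shows "4 dvd int k * (int k - 1) * int (sr_p D i) + 2 * int k * int (sr_p D i) * int (sr_p D j) -
    \<epsilon> * sr_d D i * int k * int (sr_b D i j - k) + int k * a"
proof -
  have car: "super_cartan_datum D" using D by (simp add: super_root_datum_def)
  have "sr_a D i j \<le> 0" using car ij unfolding super_cartan_datum_def by blast
  then have b: "int (sr_b D i j) = 1 - sr_a D i j" by (simp add: sr_b_def)
  have "even (sr_d D i - int (sr_p D i))"
    using car unfolding super_cartan_datum_def by (metis mod_eq_dvd_iff)
  then have "even (int (sr_p D i) + \<epsilon> * sr_d D i)" using sign_cases [OF \<epsilon>] by auto
  then obtain q where q: "int (sr_p D i) = 2 * q - \<epsilon> * sr_d D i" by (metis add_diff_cancel_right' dvdE)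
  obtain r where r: "a = 4 * r + (2 * int (sr_p D i) * int (sr_p D j) - \<epsilon> * sr_d D i * sr_a D i j)"
    using u by (metis dvdE diff_add_cancel)
  have "even (int k * (int k - 1))" by simp
  then obtain s where s: "int k * (int k - 1) = 2 * s" by blast
  have "int k * (int k - 1) * int (sr_p D i) + 2 * int k * int (sr_p D i) * int (sr_p D j) -
      \<epsilon> * sr_d D i * int k * int (sr_b D i j - k) + int k * a =
      int k * (int k - 1) * (int (sr_p D i) + \<epsilon> * sr_d D i) + 4 * (int k * int (sr_p D i) * int (sr_p D j) + int k * r)"
    using k by (simp add: of_nat_diff b r algebra_simps)
  also have "\<dots> = 4 * (s * q) + 4 * (int k * int (sr_p D i) * int (sr_p D j) + int k * r)"
    using q by (simp add: s)
  finally have eq: "int k * (int k - 1) * int (sr_p D i) + 2 * int k * int (sr_p D i) * int (sr_p D j) -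
      \<epsilon> * sr_d D i * int k * int (sr_b D i j - k) + int k * a =
      4 * (s * q) + 4 * (int k * int (sr_p D i) * int (sr_p D j) + int k * r)" .
  show ?thesis unfolding eq by (intro dvd_add dvd_triv_left)
qed

text \<open>The sign in the commutator of \<open>E\<^sub>i\<close> and \<open>F\<^sub>j\<close> changes with \<open>\<pi>\<close>; the exponents absorb this.\<close>

lemma exchange_exponent:
  assumes fg: "twist_exponents D \<epsilon> f g u u'"
  shows "qvt_t powi (f i (l - sr_iX D j) + g j l) =
    (-1) ^ (sr_p D i * sr_p D j) * qvt_t powi (g j (l + sr_iX D i) + f i l)"
proof -
  note X = fg [unfolded twist_exponents_def]
  let ?P = "sr_p D i * sr_p D j"
  let ?A = "f i (l - sr_iX D j) + g j l" and ?B = "g j (l + sr_iX D i) + f i l"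
  have "g j (l + sr_iX D i) = g j l - u' j i"
    using X by (metis add_diff_cancel_right' add_diff_cancel)
  moreover have "f i (l - sr_iX D j) = f i l - u i j"
    using X by (metis add_diff_cancel_right' diff_add_cancel)
  ultimately have "?A - (2 * int ?P + ?B) = u' j i - u i j - 2 * int (sr_p D i) * int (sr_p D j)" by simp
  then have "4 dvd ?A - (2 * int ?P + ?B)" using X by (simp only:)
  then have "qvt_t powi ?A = qvt_t powi (2 * int ?P + ?B)" by (rule qvt_t_powi_cong)
  also have "\<dots> = (-1) ^ ?P * qvt_t powi ?B"
    by (simp only: power_int_add qvt_t_nonzero qvt_t_powi_2 power_int_of_nat simp_thms)
  finally show ?thesis .
qed

lemma cartan_exponent:
  assumes \<epsilon>: "\<epsilon> * \<epsilon> = 1" and z: "z = qvt_t powi \<epsilon> * w" and fg: "twist_exponents D \<epsilon> f g u u'"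
  shows "qvt_t powi (f i (l - sr_iX D i) + g i l) * qint w e (sr_d D i) (sr_pair D (sr_iY D i) l) =
    qint z (- e) (sr_d D i) (sr_pair D (sr_iY D i) l)"
proof -
  let ?n = "sr_pair D (sr_iY D i) l"
  have "4 dvd f i (l - sr_iX D i) + g i l - (- \<epsilon> * sr_d D i * (?n - 1))"
    using fg unfolding twist_exponents_def by (simp add: algebra_simps)
  then have "qvt_t powi (f i (l - sr_iX D i) + g i l) = qvt_t powi (- \<epsilon> * sr_d D i * (?n - 1))"
    by (rule qvt_t_powi_cong)
  then show ?thesis by (simp only: qint_twist [OF \<epsilon> z])
qed


section \<open>Twisting weight modules\<close>

lemma shift_zscale: "l + zscale (int (Suc k)) s = (l + zscale (int k) s) + s"
  using zscale_succ [of "int k" s] by (simp add: add.assoc add.commute [of 1])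

context weight_rep
begin

lemma comp_diag:
  assumes m: "m \<in> carrier M"
  shows "comp (diag \<phi> m) k = sc (\<phi> k) (comp m k)"
proof (rule weight_ext [OF abelian_group_axioms _ _ _ m])
  show "add_hom M M (\<lambda>m. comp (diag \<phi> m) k)" "add_hom M M (\<lambda>m. sc (\<phi> k) (comp m k))"
    using add_homD [OF diag_add_hom] by (simp_all add: add_hom_def comp_add)
  fix l m
  assume m: "m \<in> wsp l"
  then show "comp (diag \<phi> m) k = sc (\<phi> k) (comp m k)"
    by (simp add: diag_wsp comp_wsp [OF m] comp_wsp [OF wsp_sc [OF m]])
qed

lemma powers_of_operator:
  assumes X: "\<And>l m. m \<in> wsp l \<Longrightarrow> X m \<in> wsp (l + s)"
    and X': "\<And>l m. m \<in> wsp l \<Longrightarrow> X' m = sc (\<tau> powi \<phi> l) (X m)"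
    and Xsc: "\<And>m c. m \<in> carrier M \<Longrightarrow> X (sc c m) = sc c (X m)"
    and \<phi>: "\<And>l. \<phi> (l + s) = \<phi> l + u" and \<tau>: "\<tau> \<noteq> 0" and m: "m \<in> wsp l"
  shows "(X ^^ k) m \<in> wsp (l + zscale (int k) s) \<and>
    (X' ^^ k) m = sc (\<tau> powi (int k * \<phi> l + int (k choose 2) * u)) ((X ^^ k) m)"
proof (induction k)
  case 0
  then show ?case using m wsp_carrier by (simp add: zscale_0 binomial_eq_0)
next
  case (Suc k)
  let ?x = "(X ^^ k) m"
  have \<phi>k: "\<phi> (l + zscale (int k) s) = \<phi> l + int k * u" for k
    by (induction k) (simp_all only: shift_zscale \<phi> of_nat_0 zscale_0, simp_all add: algebra_simps)
  have x: "?x \<in> wsp (l + zscale (int k) s)" using Suc by simp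
  have a: "int (Suc k) * \<phi> l + int (Suc k choose 2) * u =
      (int k * \<phi> l + int (k choose 2) * u) + (\<phi> l + int k * u)"
    by (simp add: numeral_2_eq_2 algebra_simps)
  have "(X' ^^ Suc k) m = sc (\<tau> powi (\<phi> l + int k * u)) (sc (\<tau> powi (int k * \<phi> l + int (k choose 2) * u)) (X ?x))"
    using Suc X' [OF wsp_sc [OF x]] wsp_carrier [OF x] by (simp add: Xsc \<phi>k)
  also have "\<dots> = sc (\<tau> powi (int (Suc k) * \<phi> l + int (Suc k choose 2) * u)) ((X ^^ Suc k) m)"
    using wsp_carrier [OF X [OF x]] \<tau> unfolding a
    by (simp add: power_int_add mult.commute flip: sc_simps(4))
  moreover have "(X ^^ Suc k) m \<in> wsp (l + zscale (int (Suc k)) s)"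
    using X [OF x] by (simp only: shift_zscale funpow.simps o_apply)
  ultimately show ?case by simp
qed

text \<open>The exponent picked up by the \<open>k\<close>-th word of a Serre relation: passing the \<open>k\<close> right-hand letters \<open>i\<close> across \<open>j\<close>
  costs \<open>k (u j i - u i j)\<close>, and the rest is the same for all \<open>k\<close>.\<close>

lemma serre_word_twist:
  assumes X: "\<And>i l m. m \<in> wsp l \<Longrightarrow> X i m \<in> wsp (l + s i)"
    and X': "\<And>i l m. m \<in> wsp l \<Longrightarrow> X' i m = sc (\<tau> powi \<phi> i l) (X i m)"
    and Xsc: "\<And>i m c. m \<in> carrier M \<Longrightarrow> X i (sc c m) = sc c (X i m)"
    and \<phi>: "\<And>i j l. \<phi> i (l + s j) = \<phi> i l + u i j" and \<tau>: "\<tau> \<noteq> 0" and m: "m \<in> wsp l" and k: "k \<le> b"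
  shows "(X' i ^^ (b - k)) (X' j ((X' i ^^ k) m)) =
    sc (\<tau> powi (int k * (u j i - u i j) +
        (int b * \<phi> i l + \<phi> j l + int b * u i j + int (b choose 2) * u i i)))
      ((X i ^^ (b - k)) (X j ((X i ^^ k) m)))"
proof -
  have P: "(X i ^^ k) m \<in> wsp (l + zscale (int k) (s i)) \<and>
    (X' i ^^ k) m = sc (\<tau> powi (int k * \<phi> i l + int (k choose 2) * u i i)) ((X i ^^ k) m)"
    if "m \<in> wsp l" for k m l
    by (rule powers_of_operator [OF _ _ _ _ \<tau> that]) (rule X X' Xsc \<phi>, assumption?)+
  have \<phi>k: "\<phi> j (l + zscale (int k) (s i)) = \<phi> j l + int k * u j i" for k j l
    by (induction k) (simp_all only: shift_zscale \<phi> of_nat_0 zscale_0, simp_all add: algebra_simps)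
  let ?x = "(X i ^^ k) m" and ?l = "l + zscale (int k) (s i)"
  let ?a = "int k * \<phi> i l + int (k choose 2) * u i i"
  let ?c = "int (b - k) * \<phi> i (?l + s j) + int ((b - k) choose 2) * u i i"
  have x: "?x \<in> wsp ?l" and x': "(X' i ^^ k) m = sc (\<tau> powi ?a) ?x" using P [OF m, of k] by simp_all
  have y: "X j ?x \<in> wsp (?l + s j)" by (rule X [OF x])
  have y': "X' j ((X' i ^^ k) m) = sc (\<tau> powi (\<phi> j ?l + ?a)) (X j ?x)"
    using X' [OF wsp_sc [OF x]] wsp_carrier [OF x] wsp_carrier [OF y] \<tau> unfolding x'
    by (simp add: Xsc power_int_add flip: sc_simps(4))
  have scn: "(X i ^^ n) (sc c z) = sc c ((X i ^^ n) z)" if "z \<in> wsp k" for n c z k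
  proof -
    have "(X i ^^ n) z \<in> carrier M" for n using P [OF that] wsp_carrier by blast
    then show ?thesis by (induction n) (simp_all add: Xsc)
  qed
  have z: "(X i ^^ (b - k)) (X j ?x) \<in> carrier M" using P [OF y] wsp_carrier by blast
  have "(b - k choose 2) + (k choose 2) + k * (b - k) = b choose 2"
  proof -
    have "2 * (n choose 2) = n * (n - 1)" for n :: nat
    proof -
      have "even (n * (n - 1))" by (cases n) simp_all
      then show ?thesis by (simp only: choose_two dvd_mult_div_cancel)
    qed
    note c = this
    obtain r where r: "b = k + r" using k le_Suc_ex by blast
    have "2 * ((r choose 2) + (k choose 2) + k * r) = 2 * (k + r choose 2)"
      unfolding distrib_left c by (cases k; cases r) (simp_all add: algebra_simps)
    then show ?thesis by (simp add: r)
  qed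
  then have bc: "int (b choose 2) = int (b - k choose 2) + int (k choose 2) + int k * int (b - k)"
    by (metis of_nat_add of_nat_mult)
  have e: "?c + (\<phi> j ?l + ?a) = int k * (u j i - u i j) +
        (int b * \<phi> i l + \<phi> j l + int b * u i j + int (b choose 2) * u i i)"
    unfolding bc \<phi> \<phi>k using k by (simp add: of_nat_diff algebra_simps)
  show ?thesis unfolding y'
    using P [OF wsp_sc [OF y], of "b - k" "\<tau> powi (\<phi> j ?l + ?a)"] z \<tau> unfolding e [symmetric]
    by (simp add: scn [OF y] power_int_add flip: sc_simps(4))
qed

end

locale twist_setup = weight_rep D e qvt_of M sc \<rho>
  for D :: "('i :: finite, 'y :: ab_group_add, 'x :: ab_group_add) root_datum"
    and e :: int and M :: "('m, 'w) ring_scheme" (structure)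
    and sc :: "qvt \<Rightarrow> 'm \<Rightarrow> 'm" and \<rho> :: "('i, 'y) freeU \<Rightarrow> 'm \<Rightarrow> 'm" +
  fixes \<epsilon> :: int and f g :: "'i \<Rightarrow> 'x \<Rightarrow> int" and u u' :: "'i \<Rightarrow> 'i \<Rightarrow> int"
  assumes \<epsilon>: "\<epsilon> * \<epsilon> = 1" and fg: "twist_exponents D \<epsilon> f g u u'"
begin

definition sc' :: "qvt \<Rightarrow> 'm \<Rightarrow> 'm"
  where "sc' c = sc (twist_scal \<epsilon> c)"

text \<open>\<open>K\<close> and \<open>J\<close> are given by the values that they must have on weight vectors at \<open>\<pi> = -e\<close>.\<close>

definition op' :: "('i, 'y) gen \<Rightarrow> 'm \<Rightarrow> 'm"
  where "op' x = (case x of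
      GE i \<Rightarrow> \<lambda>m. E i (diag (\<lambda>l. qvt_t powi f i l) m)
    | GF i \<Rightarrow> \<lambda>m. F i (diag (\<lambda>l. qvt_t powi g i l) m)
    | GK n \<Rightarrow> diag (\<lambda>l. twist_scal \<epsilon> (qvt_of qv_v) powi sr_pair D n l)
    | GJ n \<Rightarrow> diag (\<lambda>l. of_int (- e) powi sr_pair D n l))"

sublocale \<sigma>: field_map "twist_scal \<epsilon>" by (rule field_map_twist_scal [OF \<epsilon>])

lemma \<sigma>_w: "twist_scal \<epsilon> w = qvt_t powi \<epsilon> * w"
  unfolding w_def twist_scal_v [OF \<epsilon>] by (simp add: sign_qvt_t [OF \<epsilon>])

lemma sign': "(- e) * (- e) = 1"
  using sign by simp

lemma sc'_action: "action type_ring M sc'"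
  by (simp add: action_def sc'_def \<sigma>.add \<sigma>.mult \<sigma>.one)

lemma op'_add_hom: "add_hom M M (op' x)"
  using add_homD [OF diag_add_hom] by (cases x) (simp_all add: op'_def add_hom_def)

lemma op'_sc: "m \<in> carrier M \<Longrightarrow> sc c (op' x m) = op' x (sc c m)"
  by (cases x) (simp_all add: op'_def diag_sc sc_\<rho>)

text \<open>On weight vectors \<open>K\<close> and \<open>J\<close> are scalars and the relations that involve them hold by additivity of the
  pairing; in the commutation and Serre relations all terms acquire a common power of \<open>t\<close>.\<close>

lemma twisted_rep:
  "\<exists>\<rho>'. covering_rep D (- e) qvt_of M sc' \<rho>' \<and> (\<forall>x. \<forall>m \<in> carrier M. \<rho>' (fgen x) m = op' x m)"
proof -
  have "ring_map (\<lambda>r. qvt_of (cov_spec (- e) r))"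
    by (rule ring_map_comp [OF qvt_of.ring_map_axioms ring_map_cov_spec [OF sign']])
  then have "\<exists>\<rho>'. action type_ring M \<rho>' \<and>
    (\<forall>r. \<forall>m \<in> carrier M. \<rho>' (fscal r) m = sc' (qvt_of (cov_spec (- e) r)) m) \<and>
    (\<forall>x. \<forall>m \<in> carrier M. \<rho>' (fgen x) m = op' x m) \<and>
    (\<forall>c p. \<forall>m \<in> carrier M. sc' c (\<rho>' p m) = \<rho>' p (sc' c m))"
    by (rule action_free [OF abelian_group_axioms _ sc'_action op'_add_hom]) (simp add: sc'_def op'_sc)
  then obtain \<rho>' where "action type_ring M \<rho>' \<and>
    (\<forall>r. \<forall>m \<in> carrier M. \<rho>' (fscal r) m = sc' (qvt_of (cov_spec (- e) r)) m) \<and>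
    (\<forall>x. \<forall>m \<in> carrier M. \<rho>' (fgen x) m = op' x m) \<and>
    (\<forall>c p. \<forall>m \<in> carrier M. sc' c (\<rho>' p m) = \<rho>' p (sc' c m))"
    by (rule exE)
  then have \<rho>': "action type_ring M \<rho>'"
    "\<And>r m. m \<in> carrier M \<Longrightarrow> \<rho>' (fscal r) m = sc' (qvt_of (cov_spec (- e) r)) m"
    "\<And>x m. m \<in> carrier M \<Longrightarrow> \<rho>' (fgen x) m = op' x m"
    "\<And>c p m. m \<in> carrier M \<Longrightarrow> sc' c (\<rho>' p m) = \<rho>' p (sc' c m)"
    by simp_all
  interpret T: free_rep D "- e" qvt_of M sc' \<rho>'
    by unfold_locales (use sign' sc'_action \<rho>' in auto)
  note X = fg [unfolded twist_exponents_def]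
  have C: "m \<in> carrier M" if "m \<in> wsp l" for m l using that by (rule wsp_carrier)
  have E': "T.E i m = sc (qvt_t powi f i l) (E i m)" if "m \<in> wsp l" for i l m
    using that C [OF that] by (simp add: \<rho>'(3) op'_def diag_wsp sc_\<rho>)
  have F': "T.F i m = sc (qvt_t powi g i l) (F i m)" if "m \<in> wsp l" for i l m
    using that C [OF that] by (simp add: \<rho>'(3) op'_def diag_wsp sc_\<rho>)
  have serre: "\<rho>' (serre D G i j) m = \<zero>"
    if s: "\<And>i l m. m \<in> wsp l \<Longrightarrow> \<rho> (fgen (G i)) m \<in> wsp (l + s i)"
      and G: "\<And>i l m. m \<in> wsp l \<Longrightarrow> \<rho>' (fgen (G i)) m = sc (qvt_t powi \<phi> i l) (\<rho> (fgen (G i)) m)"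
      and \<phi>: "\<And>i j l. \<phi> i (l + s j) = \<phi> i l + v i j"
      and v: "4 dvd v j i - v i j - (2 * int (sr_p D i) * int (sr_p D j) - \<epsilon> * sr_d D i * sr_a D i j)"
      and zero: "\<rho> (serre D G i j) m = \<zero>" and m: "m \<in> wsp l" and ij: "i \<noteq> j"
    for G s \<phi> v i j m l
  proof -
    let ?b = "sr_b D i j"
    let ?N = "int ?b * \<phi> i l + \<phi> j l + int ?b * v i j + int (?b choose 2) * v i i"
    define y where "y k = (\<rho> (fgen (G i)) ^^ (?b - k)) (\<rho> (fgen (G j)) ((\<rho> (fgen (G i)) ^^ k) m))" for k
    have y: "y k \<in> carrier M" for k
      unfolding y_def using C [OF m] \<rho>_power by simp
    have "\<rho>' (serre D G i j) m = (\<Oplus>k\<in>{0..?b}. sc' (scoef D (- e) T.w i j k)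
        ((\<rho>' (fgen (G i)) ^^ (?b - k)) (\<rho>' (fgen (G j)) ((\<rho>' (fgen (G i)) ^^ k) m))))"
      by (rule T.\<rho>_serre [OF datum C [OF m]])
    also have "\<dots> = (\<Oplus>k\<in>{0..?b}. sc (qvt_t powi ?N) (sc (scoef D e w i j k) (y k)))"
    proof (rule finsum_cong')
      fix k
      assume "k \<in> {0..?b}"
      then have k: "k \<le> ?b" by simp
      let ?x = "int k * (int k - 1) * int (sr_p D i) +
        2 * int k * int (sr_p D i) * int (sr_p D j) - \<epsilon> * sr_d D i * int k * int (?b - k)"
      let ?K = "int k * (v j i - v i j) + ?N"
      have word: "(\<rho>' (fgen (G i)) ^^ (?b - k)) (\<rho>' (fgen (G j)) ((\<rho>' (fgen (G i)) ^^ k) m)) =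
          sc (qvt_t powi ?K) (y k)"
        unfolding y_def
      proof (rule serre_word_twist [where X = "\<lambda>i. \<rho> (fgen (G i))" and X' = "\<lambda>i. \<rho>' (fgen (G i))" and s = s
              and \<phi> = \<phi> and u = v and l = l])
        show "\<rho> (fgen (G i)) m \<in> wsp (l + s i)" if "m \<in> wsp l" for i l m
          using that by (rule s)
        show "\<rho>' (fgen (G i)) m = sc (qvt_t powi \<phi> i l) (\<rho> (fgen (G i)) m)" if "m \<in> wsp l" for i l m
          using that by (rule G)
        show "\<rho> (fgen (G i)) (sc c m) = sc c (\<rho> (fgen (G i)) m)" if "m \<in> carrier M" for i m c
          using that by (rule sc_\<rho> [symmetric])
      qed (rule \<phi> qvt_t_nonzero m k)+
      have "sc' (scoef D (- e) T.w i j k)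
          ((\<rho>' (fgen (G i)) ^^ (?b - k)) (\<rho>' (fgen (G j)) ((\<rho>' (fgen (G i)) ^^ k) m))) =
          sc (scoef D (- e) (qvt_t powi \<epsilon> * w) i j k) (sc (qvt_t powi ?K) (y k))"
        unfolding word sc'_def \<sigma>.scoef \<sigma>_w ..
      also have "\<dots> = sc (qvt_t powi ?x * qvt_t powi ?K * scoef D e w i j k) (y k)"
        unfolding scoef_twist [OF \<epsilon> refl k] sc_simps(4) [OF y, symmetric] by (simp only: mult_ac)
      also have "qvt_t powi ?x * qvt_t powi ?K = qvt_t powi ?N"
      proof -
        have "qvt_t powi ?x * qvt_t powi ?K = qvt_t powi (?x + ?K)"
          by (simp add: power_int_add qvt_t_nonzero)
        also have "\<dots> = qvt_t powi ?N"
        proof (rule qvt_t_powi_cong)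
          have "?x + ?K - ?N = ?x + int k * (v j i - v i j)" by simp
          then show "4 dvd ?x + ?K - ?N" using serre_exponent [OF datum \<epsilon> ij k v] by (simp only:)
        qed
        finally show ?thesis .
      qed
      finally show "sc' (scoef D (- e) T.w i j k)
          ((\<rho>' (fgen (G i)) ^^ (?b - k)) (\<rho>' (fgen (G j)) ((\<rho>' (fgen (G i)) ^^ k) m))) =
          sc (qvt_t powi ?N) (sc (scoef D e w i j k) (y k))" using y by simp
    qed (use y in auto)
    also have "\<dots> = sc (qvt_t powi ?N) (\<Oplus>k\<in>{0..?b}. sc (scoef D e w i j k) (y k))"
      using y by (intro add_hom_finsum [OF abelian_group_axioms abelian_group_axioms action_add_hom [OF sc], symmetric]) auto
    also have "(\<Oplus>k\<in>{0..?b}. sc (scoef D e w i j k) (y k)) = \<zero>"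
      using zero \<rho>_serre [OF datum C [OF m], of G i j] by (simp add: y_def)
    finally show ?thesis by simp
  qed
  have "covering_rep D (- e) qvt_of M sc' \<rho>'"
  proof (rule T.rels_from_weights [OF datum, where W = wsp])
    show "wsp l \<subseteq> carrier M" for l using C by blast
    show "\<exists>c A. finite A \<and> (\<forall>l. c l \<in> wsp l) \<and> m = finsum M c A" if "m \<in> carrier M" for m
      using comp_props [OF that] by metis
  next
    fix m l
    assume m: "m \<in> wsp l"
    note [simp] = C [OF m]
    show "\<rho>' (fgen (GK n)) m = sc' (T.w powi sr_pair D n l) m" for n
      using m by (simp add: \<rho>'(3) op'_def diag_wsp sc'_def \<sigma>.power_int w_def)
    show "\<rho>' (fgen (GJ n)) m = sc' (of_int (- e) powi sr_pair D n l) m" for n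
      using m by (simp add: \<rho>'(3) op'_def diag_wsp sc'_def \<sigma>.power_int \<sigma>.of_int \<sigma>.minus)
    show "T.E i m \<in> wsp (l + sr_iX D i)" for i
      by (simp add: E' [OF m] wsp_sc E_wsp [OF datum m])
    show "T.F i m \<in> wsp (l - sr_iX D i)" for i
      by (simp add: F' [OF m] wsp_sc F_wsp [OF datum m])
    show "\<rho>' (serre D GE i j) m = \<zero>" if "i \<noteq> j" for i j
      by (rule serre [where s = "sr_iX D" and \<phi> = f and v = u])
        (use X m that in \<open>auto intro: E_wsp [OF datum] serre_0 E'\<close>)
    show "\<rho>' (serre D GF i j) m = \<zero>" if "i \<noteq> j" for i j
      by (rule serre [where s = "\<lambda>i. - sr_iX D i" and \<phi> = g and v = u'])
        (use X m that F_wsp [OF datum] in \<open>auto intro: serre_0 F'\<close>)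
    show "T.E i (T.F j m) = sc' (of_int (- e) ^ (sr_p D i * sr_p D j)) (T.F j (T.E i m)) \<oplus>
        (if i = j then sc' (qint T.w (- e) (sr_d D i) (sr_pair D (sr_iY D i) l)) m else \<zero>)" for i j
    proof -
      let ?P = "sr_p D i * sr_p D j" and ?n = "sr_pair D (sr_iY D i) l"
      let ?A = "f i (l - sr_iX D j) + g j l" and ?B = "g j (l + sr_iX D i) + f i l"
      have EF: "T.E i (T.F j m) = sc (qvt_t powi ?A) (E i (F j m))"
        using E' [OF wsp_sc [OF F_wsp [OF datum m]]]
        by (simp add: F' [OF m] power_int_add qvt_t_nonzero flip: sc_\<rho> sc_simps(4))
      have FE: "T.F j (T.E i m) = sc (qvt_t powi ?B) (F j (E i m))"
        using F' [OF wsp_sc [OF E_wsp [OF datum m]]]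
        by (simp add: E' [OF m] power_int_add qvt_t_nonzero flip: sc_\<rho> sc_simps(4))
      have A: "qvt_t powi ?A = (-1) ^ ?P * qvt_t powi ?B"
        by (rule exchange_exponent [OF fg])
      have q: "qvt_t powi ?A * qint w e (sr_d D i) ?n = twist_scal \<epsilon> (qint w (- e) (sr_d D i) ?n)" if "i = j"
        unfolding that [symmetric] \<sigma>.qint \<sigma>_w by (rule cartan_exponent [OF \<epsilon> refl fg])
      have s: "twist_scal \<epsilon> (of_int (- e) ^ ?P) * qvt_t powi ?B = qvt_t powi ?A * of_int e ^ ?P"
        unfolding A \<sigma>.power \<sigma>.of_int by (simp add: mult_ac flip: power_mult_distrib)
      have "T.E i (T.F j m) = sc (qvt_t powi ?A) (sc (of_int e ^ ?P) (F j (E i m)) \<oplus>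
          (if i = j then sc (qint w e (sr_d D i) ?n) m else \<zero>))"
        unfolding EF by (simp only: EF_wsp [OF datum m])
      also have "\<dots> = sc (qvt_t powi ?A * of_int e ^ ?P) (F j (E i m)) \<oplus>
          (if i = j then sc (qvt_t powi ?A * qint w e (sr_d D i) ?n) m else \<zero>)"
        by simp
      also have "\<dots> = sc' (of_int (- e) ^ ?P) (T.F j (T.E i m)) \<oplus>
          (if i = j then sc' (qint T.w (- e) (sr_d D i) ?n) m else \<zero>)"
        unfolding FE s [symmetric] sc'_def using q by (auto simp del: sc_simps(4) simp: sc_simps(4) [symmetric] simp del: of_int_minus)
      finally show ?thesis .
    qed
  qed
  then show ?thesis using \<rho>'(3) by blast
qed

text \<open>The weight spaces do not change, because the new \<open>K\<close>-eigenvalues still separate weights.\<close>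

lemma twisted_wsp:
  assumes "free_rep (- e) qvt_of M sc' \<rho>'" and op: "\<And>x m. m \<in> carrier M \<Longrightarrow> \<rho>' (fgen x) m = op' x m"
  shows "free_rep.wsp D (- e) qvt_of M sc' \<rho>' l = wsp l"
proof -
  interpret T: free_rep D "- e" qvt_of M sc' \<rho>' by fact
  show ?thesis
  proof (intro equalityI subsetI)
    fix m
    assume m: "m \<in> wsp l"
    then show "m \<in> T.wsp l"
      using wsp_carrier [OF m] unfolding T.wsp_def
      by (simp add: op op'_def diag_wsp sc'_def \<sigma>.power_int \<sigma>.of_int \<sigma>.minus) (simp add: w_def)
  next
    fix m
    assume "m \<in> T.wsp l"
    then have m: "m \<in> carrier M" and K: "\<And>n. op' (GK n) m = sc (twist_scal \<epsilon> w powi sr_pair D n l) m"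
      by (auto simp: T.wsp_def op sc'_def \<sigma>.power_int)
    have "comp m k = \<zero>" if "k \<noteq> l" for k
    proof (rule ccontr)
      assume k: "comp m k \<noteq> \<zero>"
      have "sr_pair D n k = sr_pair D n l" for n
      proof -
        have "sc (twist_scal \<epsilon> w powi sr_pair D n k) (comp m k) = comp (op' (GK n) m) k"
          using m by (simp add: op'_def comp_diag w_def)
        also have "\<dots> = sc (twist_scal \<epsilon> w powi sr_pair D n l) (comp m k)"
          unfolding K using m by (rule comp_sc)
        finally have "sc (twist_scal \<epsilon> w powi sr_pair D n k - twist_scal \<epsilon> w powi sr_pair D n l) (comp m k) = \<zero>"
          using m by (simp add: sc_diff eq_iff_minus)
        then have "twist_scal \<epsilon> (w powi sr_pair D n k) = twist_scal \<epsilon> (w powi sr_pair D n l)"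
          using m k by (simp add: sc_eq_0 \<sigma>.power_int)
        then have "w powi (sr_pair D n k - sr_pair D n l) = 1"
          by (simp add: \<sigma>.inj power_int_diff)
        then show ?thesis by (simp add: w_powi_eq_1)
      qed
      then show False using weights_separated [OF datum] that by blast
    qed
    then have "supp m \<subseteq> {l}" by (auto simp: supp_def)
    then have "m = comp m l"
      using finsum_superset [OF m, of "{l}" "\<lambda>l x. x"] m by (simp add: comp_props)
    then show "m \<in> wsp l" using comp_props(1) [OF m] by metis
  qed
qed

end


section \<open>The equivalence of categories\<close>

abbreviation Ut_weight_module ::
    "('i :: finite, 'y :: ab_group_add, 'x :: ab_group_add) root_datum \<Rightarrow> int \<Rightarrow>
     (('i, 'y) Ut_elt, 'm) module \<Rightarrow> bool"
  where "Ut_weight_module D e M \<equiv> weight_module D (Ut_at e D) (Ut_at_gen e D) (qvt_of qv_v) e M"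

abbreviation Ut_weight_space ::
    "('i :: finite, 'y :: ab_group_add, 'x :: ab_group_add) root_datum \<Rightarrow> int \<Rightarrow>
     (('i, 'y) Ut_elt, 'm) module \<Rightarrow> 'x \<Rightarrow> 'm set"
  where "Ut_weight_space D e M \<equiv> weight_space D (Ut_at e D) (Ut_at_gen e D) (qvt_of qv_v) e M"

definition Ut_free_act ::
    "('i :: finite, 'y :: ab_group_add, 'x :: ab_group_add) root_datum \<Rightarrow> int \<Rightarrow>
     (('i, 'y) Ut_elt, 'm) module \<Rightarrow> ('i, 'y) freeU \<Rightarrow> 'm \<Rightarrow> 'm"
  where "Ut_free_act D e M p m =
    tens (cov_spec e) (Ut D) 1 (tens cov_qvt_of (U D) 1 (U_class D p)) \<odot>\<^bsub>M\<^esub> m"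

lemma Ut_free_act_gen: "Ut_free_act D e M (fgen x) m = Ut_at_gen e D x \<odot>\<^bsub>M\<^esub> m"
  by (simp add: Ut_free_act_def Ut_at_gen_def)

lemma weight_rep_Ut:
  assumes D: "super_root_datum D" and e: "e * e = 1" and M: "Ut_weight_module D e M"
  shows "weight_rep D e qvt_of M (scal_act (Ut_at e D) M) (Ut_free_act D e M)"
    and "free_rep.wsp D e qvt_of M (scal_act (Ut_at e D) M) (Ut_free_act D e M) = Ut_weight_space D e M"
proof -
  have L: "left_module (Ut_at e D) M" using M by (simp add: weight_module_def)
  interpret R: covering_rep D e qvt_of M "scal_act (Ut_at e D) M" "Ut_free_act D e M"
    using left_module_Ut_at [OF L e] by (simp only: Ut_free_act_def [abs_def])
  show wsp: "R.wsp = Ut_weight_space D e M"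
    by (simp add: R.wsp_def weight_space_def fun_eq_iff Ut_free_act_gen R.w_def)
  show "weight_rep D e qvt_of M (scal_act (Ut_at e D) M) (Ut_free_act D e M)"
    by unfold_locales (use M D in \<open>auto simp: wsp weight_module_def\<close>)
qed

text \<open>\<open>U[t]\<close> is generated by scalars, \<open>E\<close>, \<open>F\<close>, \<open>K\<close> and \<open>J\<close>, weight vectors span, and on weight vectors \<open>K\<close> and \<open>J\<close> are
  scalars; so commutation with \<open>E\<close>, \<open>F\<close> and scalars on weight vectors is enough for a homomorphism.\<close>

lemma module_homI:
  fixes M :: "(('i :: finite, 'y :: ab_group_add) Ut_elt, 'm) module"
    and N :: "(('i, 'y) Ut_elt, 'n) module"
    and D :: "('i, 'y, 'x :: ab_group_add) root_datum"
  assumes D: "super_root_datum D" and e: "e * e = 1"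
    and M: "Ut_weight_module D e M" and N: "Ut_weight_module D e N"
    and h: "h \<in> carrier M \<rightarrow>\<^sub>E carrier N"
    and add: "\<And>x y. x \<in> carrier M \<Longrightarrow> y \<in> carrier M \<Longrightarrow> h (x \<oplus>\<^bsub>M\<^esub> y) = h x \<oplus>\<^bsub>N\<^esub> h y"
    and sc: "\<And>c x. x \<in> carrier M \<Longrightarrow> h (scal_act (Ut_at e D) M c x) = scal_act (Ut_at e D) N c (h x)"
    and wsp: "\<And>l x. x \<in> Ut_weight_space D e M l \<Longrightarrow> h x \<in> Ut_weight_space D e N l"
    and E: "\<And>i l x. x \<in> Ut_weight_space D e M l \<Longrightarrow>
      h (Ut_at_gen e D (GE i) \<odot>\<^bsub>M\<^esub> x) = Ut_at_gen e D (GE i) \<odot>\<^bsub>N\<^esub> h x"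
    and F: "\<And>i l x. x \<in> Ut_weight_space D e M l \<Longrightarrow>
      h (Ut_at_gen e D (GF i) \<odot>\<^bsub>M\<^esub> x) = Ut_at_gen e D (GF i) \<odot>\<^bsub>N\<^esub> h x"
  shows "h \<in> module_hom (Ut_at e D) M N"
proof -
  have LM: "left_module (Ut_at e D) M" and LN: "left_module (Ut_at e D) N"
    using M N by (simp_all add: weight_module_def)
  interpret M: weight_rep D e qvt_of M "scal_act (Ut_at e D) M" "Ut_free_act D e M"
    by (rule weight_rep_Ut (1) [OF D e M])
  interpret N: weight_rep D e qvt_of N "scal_act (Ut_at e D) N" "Ut_free_act D e N"
    by (rule weight_rep_Ut (1) [OF D e N])
  interpret Ut: scalar_extension "cov_spec e" "Ut D" by (rule scalar_extension_Ut)
  interpret A: ring "Ut_at e D" unfolding Ut_at_def by (rule Ut.ring_base)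
  have aM: "action (Ut_at e D) M (module.smult M)" and aN: "action (Ut_at e D) N (module.smult N)"
    using LM LN by (simp_all add: left_module_iff_action)
  note AM = actionD [OF aM] and AN = actionD [OF aN]
  have hc: "h x \<in> carrier N" if "x \<in> carrier M" for x using h that by auto
  have he: "add_hom M N h" using add hc by (simp add: add_hom_def)
  have "h (a \<odot>\<^bsub>M\<^esub> x) = a \<odot>\<^bsub>N\<^esub> h x" if "a \<in> carrier (Ut_at e D)" "x \<in> carrier M" for a x
    using generates_Ut_at that
  proof (induction a arbitrary: x rule: generates_induct)
    case (scal r)
    then show ?case using sc [of x r] by (simp add: scal_act_def)
  next
    case (gen y)
    then obtain g where y: "y = Ut_at_gen e D g" by blast
    show ?case
    proof (rule M.weight_ext [OF N.abelian_group_axioms _ _ _ gen(2)])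
      have act: "y \<odot>\<^bsub>M\<^esub> m = Ut_free_act D e M (fgen g) m" "y \<odot>\<^bsub>N\<^esub> n = Ut_free_act D e N (fgen g) n" for m n
        by (simp_all add: y Ut_free_act_gen)
      show "add_hom M N (\<lambda>x. h (y \<odot>\<^bsub>M\<^esub> x))" "add_hom M N (\<lambda>x. y \<odot>\<^bsub>N\<^esub> h x)"
        unfolding act using hc add by (simp_all add: add_hom_def)
      fix l m
      assume "m \<in> M.wsp l"
      then have m: "m \<in> Ut_weight_space D e M l" by (simp add: weight_rep_Ut (2) [OF D e M])
      show "h (y \<odot>\<^bsub>M\<^esub> m) = y \<odot>\<^bsub>N\<^esub> h m"
        using E [OF m] F [OF m] m wsp [OF m] sc
        by (cases g) (auto simp: y weight_space_def)
    qed
  next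
    case (mult a b)
    then show ?case by (simp add: AM AN hc)
  next
    case (diff a b)
    then show ?case
      by (simp add: a_minus_def AM AN hc add action_minus [OF M.abelian_group_axioms A.ring_axioms aM]
          action_minus [OF N.abelian_group_axioms A.ring_axioms aN]
          add_hom_minus [OF M.abelian_group_axioms N.abelian_group_axioms he])
  qed
  then show ?thesis using h add by (simp add: module_hom_def)
qed

lemma module_homD:
  assumes D: "super_root_datum D" and e: "e * e = 1" and h: "h \<in> module_hom (Ut_at e D) M N"
    and M: "Ut_weight_module D e M"
  shows "x \<in> carrier M \<Longrightarrow> h (scal_act (Ut_at e D) M c x) = scal_act (Ut_at e D) N c (h x)"
    and "x \<in> carrier M \<Longrightarrow> h (Ut_at_gen e D g \<odot>\<^bsub>M\<^esub> x) = Ut_at_gen e D g \<odot>\<^bsub>N\<^esub> h x"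
    and "x \<in> Ut_weight_space D e M l \<Longrightarrow> h x \<in> Ut_weight_space D e N l"
proof -
  interpret U: scalar_extension cov_qvt_of "U D" by (rule scalar_extension_U)
  interpret Ut: scalar_extension "cov_spec e" "Ut D" by (rule scalar_extension_Ut)
  have c: "c \<odot>\<^bsub>Ut_at e D\<^esub> \<one>\<^bsub>Ut_at e D\<^esub> \<in> carrier (Ut_at e D)" for c
    by (simp add: Ut_at_def Ut.base_smult_one)
  have "tens cov_qvt_of (U D) 1 (U_class D p) \<in> carrier (Ut D)" for p
    using U.tens_closed [OF U_class_hom(1)] by (simp add: Ut_def)
  then have g: "Ut_at_gen e D g \<in> carrier (Ut_at e D)" for g
    by (simp add: Ut_at_def Ut_at_gen_def)
  have hs: "h (a \<odot>\<^bsub>M\<^esub> x) = a \<odot>\<^bsub>N\<^esub> h x" "h x \<in> carrier N" if "a \<in> carrier (Ut_at e D)" "x \<in> carrier M" for a x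
    using h that by (auto simp: module_hom_def)
  show *: "x \<in> carrier M \<Longrightarrow> h (scal_act (Ut_at e D) M c x) = scal_act (Ut_at e D) N c (h x)" for x c
    by (simp add: scal_act_def hs c)
  show **: "x \<in> carrier M \<Longrightarrow> h (Ut_at_gen e D g \<odot>\<^bsub>M\<^esub> x) = Ut_at_gen e D g \<odot>\<^bsub>N\<^esub> h x" for x g
    by (simp add: hs g)
  show "x \<in> Ut_weight_space D e M l \<Longrightarrow> h x \<in> Ut_weight_space D e N l"
    using hs(2) [OF g] by (auto simp: weight_space_def simp flip: * **)
qed

text \<open>A characterisation instead of a construction: homomorphisms between twisted modules and the comparison of a
  double twist with the original module use only these properties. They leave the action of elements outside the
  carriers open, so that a double twist need not be equal to the original record.\<close>

definition twisted ::
    "('i :: finite, 'y :: ab_group_add, 'x :: ab_group_add) root_datum \<Rightarrow> int \<Rightarrow> int \<Rightarrow>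
     ('i \<Rightarrow> 'x \<Rightarrow> int) \<Rightarrow> ('i \<Rightarrow> 'x \<Rightarrow> int) \<Rightarrow>
     (('i, 'y) Ut_elt, 'm) module \<Rightarrow> (('i, 'y) Ut_elt, 'm) module \<Rightarrow> bool"
  where "twisted D e \<epsilon> f g M N \<longleftrightarrow> Ut_weight_module D (- e) N \<and>
    carrier N = carrier M \<and> add N = add M \<and> zero N = zero M \<and>
    (\<forall>c. \<forall>m \<in> carrier M. scal_act (Ut_at (- e) D) N c m = scal_act (Ut_at e D) M (twist_scal \<epsilon> c) m) \<and>
    (\<forall>l. Ut_weight_space D (- e) N l = Ut_weight_space D e M l) \<and>
    (\<forall>i l. \<forall>m \<in> Ut_weight_space D e M l.
      Ut_at_gen (- e) D (GE i) \<odot>\<^bsub>N\<^esub> m = scal_act (Ut_at e D) M (qvt_t powi f i l) (Ut_at_gen e D (GE i) \<odot>\<^bsub>M\<^esub> m) \<and>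
      Ut_at_gen (- e) D (GF i) \<odot>\<^bsub>N\<^esub> m = scal_act (Ut_at e D) M (qvt_t powi g i l) (Ut_at_gen e D (GF i) \<odot>\<^bsub>M\<^esub> m))"

lemma abelian_group_smult_update:
  "abelian_group (M\<lparr>module.smult := \<alpha>\<rparr>) \<longleftrightarrow> abelian_group M" for M :: "('a, 'm) module"
  by (simp add: abelian_group_def abelian_monoid_def abelian_group_axioms_def)

lemma finsum_smult_update: "finsum (M\<lparr>module.smult := \<alpha>\<rparr>) = finsum M" for M :: "('a, 'm) module"
  by (simp add: finsum_def [abs_def])

lemma twisted_exists:
  fixes M :: "(('i :: finite, 'y :: ab_group_add) Ut_elt, 'm) module"
    and D :: "('i, 'y, 'x :: ab_group_add) root_datum"
  assumes D: "super_root_datum D" and e: "e * e = 1" and \<epsilon>: "\<epsilon> * \<epsilon> = 1"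
    and fg: "twist_exponents D \<epsilon> f g u u'" and M: "Ut_weight_module D e M"
  shows "\<exists>N. twisted D e \<epsilon> f g M N"
proof -
  let ?sc = "scal_act (Ut_at e D) M" and ?\<rho> = "Ut_free_act D e M"
  interpret M: weight_rep D e qvt_of M ?sc ?\<rho>
    by (rule weight_rep_Ut (1) [OF D e M])
  interpret T: twist_setup D e M ?sc ?\<rho> \<epsilon> f g u u'
    by unfold_locales (use \<epsilon> fg in auto)
  have wsp: "M.wsp = Ut_weight_space D e M" by (rule weight_rep_Ut (2) [OF D e M])
  obtain \<rho>' where \<rho>': "covering_rep D (- e) qvt_of M T.sc' \<rho>'"
    "\<And>x m. m \<in> carrier M \<Longrightarrow> \<rho>' (fgen x) m = T.op' x m"
    using T.twisted_rep by blast
  interpret R: covering_rep D "- e" qvt_of M T.sc' \<rho>' by (rule \<rho>')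
  have Rw: "R.wsp l = M.wsp l" for l
    by (rule T.twisted_wsp [OF R.free_rep_axioms \<rho>'(2)])
  obtain \<alpha> where \<alpha>: "action (Ut_at (- e) D) M \<alpha>"
    "\<And>m c. m \<in> carrier M \<Longrightarrow> \<alpha> (c \<odot>\<^bsub>Ut_at (- e) D\<^esub> \<one>\<^bsub>Ut_at (- e) D\<^esub>) m = T.sc' c m"
    "\<And>m x. m \<in> carrier M \<Longrightarrow> \<alpha> (Ut_at_gen (- e) D x) m = \<rho>' (fgen x) m"
    using covering_rep_Ut_at [OF \<rho>'(1)] by blast
  define N where "N = M\<lparr>module.smult := \<alpha>\<rparr>"
  have N [simp]: "carrier N = carrier M" "add N = add M" "zero N = zero M" "module.smult N = \<alpha>" "finsum N = finsum M"
    by (simp_all add: N_def finsum_smult_update)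
  have "action (Ut_at (- e) D) N \<alpha>" using \<alpha>(1) by (simp add: action_def)
  then have L: "left_module (Ut_at (- e) D) N"
    using M.abelian_group_axioms by (simp add: left_module_iff_action N_def abelian_group_smult_update)
  have sc: "scal_act (Ut_at (- e) D) N c m = T.sc' c m" if "m \<in> carrier M" for c m
    using that by (simp add: scal_act_def \<alpha>)
  have "Ut_weight_space D (- e) N l = R.wsp l" for l
    by (auto simp: weight_space_def R.wsp_def sc \<alpha> R.w_def)
  then have w: "Ut_weight_space D (- e) N l = M.wsp l" for l
    by (simp add: Rw)
  have W: "Ut_weight_module D (- e) N"
    using L M.weights by (auto simp: weight_module_def w)
  show ?thesis unfolding twisted_def
  proof (intro exI [of _ N] conjI allI ballI W N(1-3))
    show "scal_act (Ut_at (- e) D) N c m = ?sc (twist_scal \<epsilon> c) m" if "m \<in> carrier M" for c m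
      using that by (simp add: sc T.sc'_def)
    show "Ut_weight_space D (- e) N l = Ut_weight_space D e M l" for l
      using w wsp by simp
  next
    fix i l m
    assume "m \<in> Ut_weight_space D e M l"
    then have m: "m \<in> M.wsp l" by (simp add: wsp)
    then have C [simp]: "m \<in> carrier M" by (rule M.wsp_carrier)
    show "Ut_at_gen (- e) D (GE i) \<odot>\<^bsub>N\<^esub> m = ?sc (qvt_t powi f i l) (Ut_at_gen e D (GE i) \<odot>\<^bsub>M\<^esub> m)"
      "Ut_at_gen (- e) D (GF i) \<odot>\<^bsub>N\<^esub> m = ?sc (qvt_t powi g i l) (Ut_at_gen e D (GF i) \<odot>\<^bsub>M\<^esub> m)"
      by (simp_all add: \<alpha> \<rho>' T.op'_def M.diag_wsp [OF m] M.sc_\<rho> flip: Ut_free_act_gen)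
  qed
qed

text \<open>Twisting does not change the underlying set, so it can act as the identity on morphisms.\<close>

lemma twisted_hom:
  fixes M M' :: "(('i :: finite, 'y :: ab_group_add) Ut_elt, 'm) module"
    and D :: "('i, 'y, 'x :: ab_group_add) root_datum"
  assumes D: "super_root_datum D" and e: "e * e = 1"
    and M: "Ut_weight_module D e M" and M': "Ut_weight_module D e M'"
    and N: "twisted D e \<epsilon> f g M N" and N': "twisted D e \<epsilon> f g M' N'"
    and h: "h \<in> module_hom (Ut_at e D) M M'"
  shows "h \<in> module_hom (Ut_at (- e) D) N N'"
proof -
  note H = module_homD [OF D e h M]
  have hc: "h x \<in> carrier M'" if "x \<in> carrier M" for x using h that by (auto simp: module_hom_def)
  have C: "x \<in> carrier M" if "x \<in> Ut_weight_space D e M l" for x l using that by (simp add: weight_space_def)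
  interpret M: weight_rep D e qvt_of M "scal_act (Ut_at e D) M" "Ut_free_act D e M"
    by (rule weight_rep_Ut (1) [OF D e M])
  have G: "Ut_at_gen e D x \<odot>\<^bsub>M\<^esub> m \<in> carrier M" if "m \<in> carrier M" for x m
    using that unfolding Ut_free_act_gen [symmetric] by simp
  have e': "(- e) * (- e) = 1" using e by simp
  have E: "h (Ut_at_gen (- e) D (GE i) \<odot>\<^bsub>N\<^esub> x) = Ut_at_gen (- e) D (GE i) \<odot>\<^bsub>N'\<^esub> h x"
    and F: "h (Ut_at_gen (- e) D (GF i) \<odot>\<^bsub>N\<^esub> x) = Ut_at_gen (- e) D (GF i) \<odot>\<^bsub>N'\<^esub> h x"
    if x: "x \<in> Ut_weight_space D e M l" for i l x
    using N N' x H(3) [OF x] H(1) H(2) [OF C [OF x]] G [OF C [OF x]] unfolding twisted_def by simp_all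
  show ?thesis
    by (rule module_homI [OF D e'])
      (use N N' h H C hc E F in \<open>auto simp: twisted_def module_hom_def\<close>)
qed

text \<open>The automorphisms of the scalars are inverse to each other and fix \<open>t\<close>, so the two rescalings of \<open>E\<close> and \<open>F\<close>
  cancel and the identity map is an isomorphism.\<close>

lemma twisted_back:
  fixes M :: "(('i :: finite, 'y :: ab_group_add) Ut_elt, 'm) module"
    and D :: "('i, 'y, 'x :: ab_group_add) root_datum"
  assumes D: "super_root_datum D" and e: "e * e = 1" and \<epsilon>: "\<epsilon> * \<epsilon> = 1"
    and M: "Ut_weight_module D e M" and N: "twisted D e \<epsilon> f g M N"
    and L: "twisted D (- e) (- \<epsilon>) (\<lambda>i l. - f i l) (\<lambda>i l. - g i l) N L"
  shows "(\<lambda>x \<in> carrier M. x) \<in> module_hom (Ut_at e D) M L" "(\<lambda>x \<in> carrier M. x) \<in> module_hom (Ut_at e D) L M"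
    and "carrier L = carrier M" "Ut_weight_module D e L"
proof -
  interpret M: weight_rep D e qvt_of M "scal_act (Ut_at e D) M" "Ut_free_act D e M"
    by (rule weight_rep_Ut (1) [OF D e M])
  interpret \<sigma>: field_map "twist_scal \<epsilon>" by (rule field_map_twist_scal [OF \<epsilon>])
  have e': "(- e) * (- e) = 1" and \<epsilon>': "(- \<epsilon>) * (- \<epsilon>) = 1" using e \<epsilon> by simp_all
  have C: "x \<in> carrier M" if "x \<in> Ut_weight_space D e M l" for x l using that by (simp add: weight_space_def)
  have G: "Ut_at_gen e D x \<odot>\<^bsub>M\<^esub> m \<in> carrier M" if "m \<in> carrier M" for x m
    using that unfolding Ut_free_act_gen [symmetric] by simp
  have c: "carrier N = carrier M" "add N = add M" "carrier L = carrier M" "add L = add M"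
    using N L by (simp_all add: twisted_def)
  show "carrier L = carrier M" by (rule c)
  show W: "Ut_weight_module D e L" using L by (simp add: twisted_def)
  have scL: "scal_act (Ut_at e D) L a x = scal_act (Ut_at e D) M a x" if "x \<in> carrier M" for a x
    using N L that twist_scal_inverse [OF \<epsilon>'] by (simp add: twisted_def)
  have wL: "Ut_weight_space D e L l = Ut_weight_space D e M l" for l
    using N L by (simp add: twisted_def)
  have t: "twist_scal \<epsilon> (qvt_t powi n) = qvt_t powi n" for n
    by (simp add: \<sigma>.power_int twist_scal_t [OF \<epsilon>])
  have tt: "scal_act (Ut_at e D) M (qvt_t powi (- n)) (scal_act (Ut_at e D) M (qvt_t powi n) x) = x"
    if "x \<in> carrier M" for x n
    using that qvt_t_nonzero by (simp add: power_int_minus flip: M.sc_simps(4))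
  have E: "Ut_at_gen e D (GE i) \<odot>\<^bsub>L\<^esub> x = Ut_at_gen e D (GE i) \<odot>\<^bsub>M\<^esub> x"
    and F: "Ut_at_gen e D (GF i) \<odot>\<^bsub>L\<^esub> x = Ut_at_gen e D (GF i) \<odot>\<^bsub>M\<^esub> x"
    if "x \<in> Ut_weight_space D e M l" for i l x
  proof -
    have "Ut_at_gen e D (GE i) \<odot>\<^bsub>L\<^esub> x = scal_act (Ut_at e D) M (twist_scal \<epsilon> (qvt_t powi (- f i l)))
        (scal_act (Ut_at e D) M (qvt_t powi f i l) (Ut_at_gen e D (GE i) \<odot>\<^bsub>M\<^esub> x))"
      using N L that G [OF C [OF that]] by (simp add: twisted_def)
    then show "Ut_at_gen e D (GE i) \<odot>\<^bsub>L\<^esub> x = Ut_at_gen e D (GE i) \<odot>\<^bsub>M\<^esub> x"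
      unfolding t by (simp only: tt G C [OF that])
    have "Ut_at_gen e D (GF i) \<odot>\<^bsub>L\<^esub> x = scal_act (Ut_at e D) M (twist_scal \<epsilon> (qvt_t powi (- g i l)))
        (scal_act (Ut_at e D) M (qvt_t powi g i l) (Ut_at_gen e D (GF i) \<odot>\<^bsub>M\<^esub> x))"
      using N L that G [OF C [OF that]] by (simp add: twisted_def)
    then show "Ut_at_gen e D (GF i) \<odot>\<^bsub>L\<^esub> x = Ut_at_gen e D (GF i) \<odot>\<^bsub>M\<^esub> x"
      unfolding t by (simp only: tt G C [OF that])
  qed
  show "(\<lambda>x \<in> carrier M. x) \<in> module_hom (Ut_at e D) M L"
    by (rule module_homI [OF D e M W]) (use C G scL wL E F c in auto)
  show "(\<lambda>x \<in> carrier M. x) \<in> module_hom (Ut_at e D) L M"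
    by (rule module_homI [OF D e W M]) (use C G scL wL E F c in auto)
qed

lemma is_category_Ct:
  fixes D :: "('i, 'y :: ab_group_add, 'x) root_datum"
  shows "is_category (Ct e D :: ((('i, 'y) Ut_elt, 'm) module, 'm \<Rightarrow> 'm) precat)"
proof -
  have L: "left_module (Ut_at e D) M" if "M \<in> Obj (Ct e D)" for M :: "(('i, 'y) Ut_elt, 'm) module"
    using that by (simp add: Ct_def weight_module_def)
  have cl: "a \<odot>\<^bsub>M\<^esub> x \<in> carrier M" if "M \<in> Obj (Ct e D)" "a \<in> carrier (Ut_at e D)" "x \<in> carrier M"
    for M :: "(('i, 'y) Ut_elt, 'm) module" and a x
    using L [OF that(1)] that(2-3) by (auto simp: left_module_iff_action action_def)
  have add: "x \<oplus>\<^bsub>M\<^esub> y \<in> carrier M" if "M \<in> Obj (Ct e D)" "x \<in> carrier M" "y \<in> carrier M"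
    for M :: "(('i, 'y) Ut_elt, 'm) module" and x y
    using L [OF that(1)] that(2-3) by (auto simp: left_module_iff_action abelian_group_def abelian_monoid.a_closed)
  show ?thesis unfolding is_category_def
    using cl add by (auto simp: Ct_def module_hom_def compose_def PiE_iff extensional_def fun_eq_iff)
qed

lemma natural_iso_identity:
  fixes D :: "('i :: finite, 'y :: ab_group_add, 'x :: ab_group_add) root_datum"
    and H :: "(('i, 'y) Ut_elt, 'm) module \<Rightarrow> (('i, 'y) Ut_elt, 'm) module" and e :: int
  defines "C \<equiv> Ct e D"
  assumes H: "\<And>M. Ut_weight_module D e M \<Longrightarrow> carrier (H M) = carrier M"
    and hom: "\<And>M. Ut_weight_module D e M \<Longrightarrow> (\<lambda>x \<in> carrier M. x) \<in> module_hom (Ut_at e D) M (H M)"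
      "\<And>M. Ut_weight_module D e M \<Longrightarrow> (\<lambda>x \<in> carrier M. x) \<in> module_hom (Ut_at e D) (H M) M"
  shows "natural_iso C C (\<lambda>X. X) (\<lambda>X Y f. f) H (\<lambda>X Y f. f) (\<lambda>M. \<lambda>x \<in> carrier M. x)"
    and "natural_iso C C H (\<lambda>X Y f. f) (\<lambda>X. X) (\<lambda>X Y f. f) (\<lambda>M. \<lambda>x \<in> carrier M. x)"
proof -
  have ext: "compose (carrier M) h (\<lambda>x \<in> carrier M. x) = h" "compose (carrier M) (\<lambda>x \<in> carrier N. x) h = h"
    if "h \<in> module_hom (Ut_at e D) M N" for h and M N :: "(('i, 'y) Ut_elt, 'm) module"
    using that by (auto simp: module_hom_def compose_def PiE_iff extensional_def fun_eq_iff)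
  have id: "compose S (\<lambda>x \<in> S. x) (\<lambda>x \<in> S. x) = (\<lambda>x \<in> S. x)" for S :: "'m set"
    by (auto simp: compose_def fun_eq_iff)
  show "natural_iso C C (\<lambda>X. X) (\<lambda>X Y f. f) H (\<lambda>X Y f. f) (\<lambda>M. \<lambda>x \<in> carrier M. x)"
    unfolding natural_iso_def is_iso_def
  proof (intro conjI ballI)
    fix X
    assume "X \<in> Obj C"
    then have X: "Ut_weight_module D e X" by (simp add: C_def Ct_def)
    show "(\<lambda>x\<in>carrier X. x) \<in> Hom C X (H X)" using hom [OF X] by (simp add: C_def Ct_def)
    show "\<exists>g\<in>Hom C (H X) X. Cmp C X (H X) X g (\<lambda>x\<in>carrier X. x) = Idn C X \<and>
        Cmp C (H X) X (H X) (\<lambda>x\<in>carrier X. x) g = Idn C (H X)"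
      by (rule bexI [of _ "\<lambda>x\<in>carrier X. x"]) (use hom [OF X] in \<open>simp_all add: C_def Ct_def id H [OF X]\<close>)
  qed (simp add: C_def Ct_def H ext)
  show "natural_iso C C H (\<lambda>X Y f. f) (\<lambda>X. X) (\<lambda>X Y f. f) (\<lambda>M. \<lambda>x \<in> carrier M. x)"
    unfolding natural_iso_def is_iso_def
  proof (intro conjI ballI)
    fix X
    assume "X \<in> Obj C"
    then have X: "Ut_weight_module D e X" by (simp add: C_def Ct_def)
    show "(\<lambda>x\<in>carrier X. x) \<in> Hom C (H X) X" using hom [OF X] by (simp add: C_def Ct_def)
    show "\<exists>g\<in>Hom C X (H X). Cmp C (H X) X (H X) g (\<lambda>x\<in>carrier X. x) = Idn C (H X) \<and>
        Cmp C X (H X) X (\<lambda>x\<in>carrier X. x) g = Idn C X"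
      by (rule bexI [of _ "\<lambda>x\<in>carrier X. x"]) (use hom [OF X] in \<open>simp_all add: C_def Ct_def id H [OF X]\<close>)
  qed (simp add: C_def Ct_def H ext)
qed

lemma equivalence_Ct:
  fixes D :: "('i :: finite, 'y :: ab_group_add, 'x :: ab_group_add) root_datum"
  assumes D: "super_root_datum D"
  shows "equivalent_categories
    (Ct 1 D :: ((('i, 'y) Ut_elt, 'm) module, 'm \<Rightarrow> 'm) precat)
    (Ct (- 1) D :: ((('i, 'y) Ut_elt, 'm) module, 'm \<Rightarrow> 'm) precat)"
proof -
  obtain f g u u' where fg: "twist_exponents D 1 f g u u'"
    using twist_exponents_exist [OF D] by blast
  note fg' = twist_exponents_neg [OF fg]
  let ?f = "\<lambda>i l. - f i l" and ?g = "\<lambda>i l. - g i l"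
  define Fo where "Fo M = (SOME N. twisted D 1 1 f g M N)" for M :: "(('i, 'y) Ut_elt, 'm) module"
  define Go where "Go M = (SOME N. twisted D (- 1) (- 1) ?f ?g M N)" for M :: "(('i, 'y) Ut_elt, 'm) module"
  have Fo: "twisted D 1 1 f g M (Fo M)" if "Ut_weight_module D 1 M" for M
    unfolding Fo_def by (rule someI_ex) (rule twisted_exists [OF D _ _ fg that]; simp)
  have Go: "twisted D (- 1) (- 1) ?f ?g M (Go M)" if "Ut_weight_module D (- 1) M" for M
    unfolding Go_def by (rule someI_ex) (rule twisted_exists [OF D _ _ fg' that]; simp)
  have FW: "Ut_weight_module D (- 1) (Fo M)" "carrier (Fo M) = carrier M" if "Ut_weight_module D 1 M" for M
    using Fo [OF that] by (simp_all add: twisted_def)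
  have GW: "Ut_weight_module D 1 (Go M)" "carrier (Go M) = carrier M" if "Ut_weight_module D (- 1) M" for M
    using Go [OF that] by (simp_all add: twisted_def)
  have Fh: "h \<in> module_hom (Ut_at (- 1) D) (Fo M) (Fo N)"
    if "Ut_weight_module D 1 M" "Ut_weight_module D 1 N" "h \<in> module_hom (Ut_at 1 D) M N" for h M N
    using twisted_hom [OF D _ that(1,2) Fo [OF that(1)] Fo [OF that(2)] that(3)] by simp
  have Gh: "h \<in> module_hom (Ut_at 1 D) (Go M) (Go N)"
    if "Ut_weight_module D (- 1) M" "Ut_weight_module D (- 1) N" "h \<in> module_hom (Ut_at (- 1) D) M N" for h M N
    using twisted_hom [OF D _ that(1,2) Go [OF that(1)] Go [OF that(2)] that(3)] by simp
  have GF: "(\<lambda>x \<in> carrier M. x) \<in> module_hom (Ut_at 1 D) M (Go (Fo M))"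
    "(\<lambda>x \<in> carrier M. x) \<in> module_hom (Ut_at 1 D) (Go (Fo M)) M" if "Ut_weight_module D 1 M" for M
    using twisted_back [OF D _ _ that Fo [OF that] Go [OF FW(1) [OF that]]] by simp_all
  have FG: "(\<lambda>x \<in> carrier M. x) \<in> module_hom (Ut_at (- 1) D) M (Fo (Go M))"
    "(\<lambda>x \<in> carrier M. x) \<in> module_hom (Ut_at (- 1) D) (Fo (Go M)) M" if "Ut_weight_module D (- 1) M" for M
    using twisted_back [OF D _ _ that Go [OF that], of "Fo (Go M)"] Fo [OF GW(1) [OF that]] by simp_all
  let ?C = "\<lambda>e. Ct e D :: ((('i, 'y) Ut_elt, 'm) module, 'm \<Rightarrow> 'm) precat"
  let ?id = "\<lambda>M :: (('i, 'y) Ut_elt, 'm) module. \<lambda>x \<in> carrier M. x"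
  have F: "is_functor (?C 1) (?C (- 1)) Fo (\<lambda>_ _ h. h)"
    by (simp add: is_functor_def Ct_def FW Fh)
  have G: "is_functor (?C (- 1)) (?C 1) Go (\<lambda>_ _ h. h)"
    by (simp add: is_functor_def Ct_def GW Gh)
  have h: "natural_iso (?C 1) (?C 1) (\<lambda>X. X) (\<lambda>X Y f. f) (\<lambda>X. Go (Fo X)) (\<lambda>X Y f. f) ?id"
    by (rule natural_iso_identity (1)) (simp_all add: GF FW GW)
  have k: "natural_iso (?C (- 1)) (?C (- 1)) (\<lambda>X. Fo (Go X)) (\<lambda>X Y f. f) (\<lambda>X. X) (\<lambda>X Y f. f) ?id"
    by (rule natural_iso_identity (2)) (simp_all add: FG FW GW)
  show ?thesis unfolding equivalent_categories_def
    by (rule conjI [OF is_category_Ct conjI [OF is_category_Ct]], rule exI [of _ Fo],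
        rule exI [of _ "\<lambda>_ _ h. h"], rule exI [of _ Go], rule exI [of _ "\<lambda>_ _ h. h"],
        rule exI [of _ ?id], rule exI [of _ ?id]) (intro conjI F G h k)
qed


section \<open>The contravariant matrix of a highest weight module\<close>

definition wt :: "('i, 'y, 'x :: ab_group_add) root_datum \<Rightarrow> 'i list \<Rightarrow> 'x"
  where "wt D b = sum_list (map (sr_iX D) b)"

lemma wt_simps [simp]: "wt D [] = 0" "wt D (j # b) = sr_iX D j + wt D b" "wt D (a @ b) = wt D a + wt D b"
  by (simp_all add: wt_def)

text \<open>Simple roots are linearly independent, so the weight of a word determines how often each letter occurs.\<close>

lemma wt_count:
  fixes D :: "('i :: finite, 'y :: ab_group_add, 'x :: ab_group_add) root_datum"
  assumes D: "super_root_datum D" and wt: "wt D a = wt D b"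
  shows "length a = length b"
proof -
  obtain c :: "'x \<Rightarrow> 'i \<Rightarrow> int" where c: "\<And>l i j. c (l + sr_iX D i) j = c l j + (if i = j then 1 else 0)"
    using root_coordinates [OF D] by blast
  have w: "c (wt D b) j = c 0 j + int (count_list b j)" for b j
  proof (induction b)
    case (Cons i b)
    have "wt D (i # b) = wt D b + sr_iX D i" by (simp add: add.commute)
    then show ?case using Cons by (simp only: c) simp
  qed simp
  then have "count_list a j = count_list b j" for j
    using w [of a j] w [of b j] wt by simp
  moreover have "length b = (\<Sum>j\<in>UNIV. count_list b j)" for b :: "'i list"
    by (rule sum_count_set [symmetric]) simp_all
  ultimately show ?thesis by simp
qed

text \<open>The terms of \<open>E\<^sub>i F\<^sub>b y\<close> that come from commuting \<open>E\<^sub>i\<close> past a letter of \<open>b\<close>, for \<open>y\<close> of weight \<open>l\<close>.\<close>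

fun EF_terms :: "('i, 'y, 'x :: ab_group_add) root_datum \<Rightarrow> int \<Rightarrow> 'k :: field \<Rightarrow> 'x \<Rightarrow> 'i \<Rightarrow> 'i list \<Rightarrow> ('k \<times> 'i list) list"
  where
    "EF_terms D e w l i [] = []"
  | "EF_terms D e w l i (j # b) =
      map (\<lambda>(c, u). (of_int e ^ (sr_p D i * sr_p D j) * c, j # u)) (EF_terms D e w l i b) @
      (if i = j then [(qint w e (sr_d D i) (sr_pair D (sr_iY D i) (l - wt D b)), b)] else [])"

text \<open>For words of equal length this is the coefficient of the highest weight vector in \<open>E\<^sub>a F\<^sub>b x\<close>, where the first letter
  of \<open>a\<close> acts first and the last letter of \<open>b\<close> acts first.\<close>

fun EF_matrix :: "('i, 'y, 'x :: ab_group_add) root_datum \<Rightarrow> int \<Rightarrow> 'k :: field \<Rightarrow> 'x \<Rightarrow> 'i list \<Rightarrow> 'i list \<Rightarrow> 'k"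
  where
    "EF_matrix D e w l [] b = (if b = [] then 1 else 0)"
  | "EF_matrix D e w l (i # a) b = (\<Sum>(c, u) \<leftarrow> EF_terms D e w l i b. c * EF_matrix D e w l a u)"

lemma EF_terms_word: "(c, u) \<in> set (EF_terms D e w l i b) \<Longrightarrow> wt D b = wt D u + sr_iX D i \<and> length b = Suc (length u)"
proof (induction b arbitrary: c u)
  case (Cons j b)
  then have "(\<exists>c' u'. (c', u') \<in> set (EF_terms D e w l i b) \<and> u = j # u') \<or> i = j \<and> u = b"
    by (auto split: if_splits)
  then show ?case
  proof (elim disjE exE conjE)
    fix c' u'
    assume "(c', u') \<in> set (EF_terms D e w l i b)" "u = j # u'"
    then show ?case using Cons.IH [of c' u'] by (simp add: add.assoc)
  qed (simp add: add.commute)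
qed simp

lemma (in field_map) EF_terms:
  "map (\<lambda>(c, u). (h c, u)) (EF_terms D e w l i b) = EF_terms D e (h w) l i b"
proof (induction b)
  case (Cons j b)
  have *: "map (\<lambda>(c, u). (h c, u)) (map (\<lambda>(c, u). (of_int e ^ k * c, j # u)) L) =
      map (\<lambda>(c, u). (of_int e ^ k * c, j # u)) (map (\<lambda>(c, u). (h c, u)) L)" for k L
    by (induction L) (auto simp: mult power of_int)
  show ?case unfolding EF_terms.simps map_append * Cons by (simp add: qint)
qed simp

lemma (in field_map) EF_matrix: "h (EF_matrix D e w l a b) = EF_matrix D e (h w) l a b"
proof (induction a arbitrary: b)
  case (Cons i a)
  have "h (\<Sum>(c, u) \<leftarrow> L. c * EF_matrix D e w l a u) =
      (\<Sum>(c, u) \<leftarrow> map (\<lambda>(c, u). (h c, u)) L. c * EF_matrix D e (h w) l a u)" for L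
    by (induction L) (auto simp: zero add mult Cons)
  then show ?case by (simp only: EF_matrix.simps EF_terms)
qed (simp add: one zero)

text \<open>The powers of \<open>t\<close> that the twisted generators collect along \<open>F\<^sub>b\<close> applied to weight \<open>l\<close>, and along \<open>E\<^sub>a\<close>.\<close>

fun F_exponent :: "('i, 'y, 'x :: ab_group_add) root_datum \<Rightarrow> ('i \<Rightarrow> 'x \<Rightarrow> int) \<Rightarrow> 'x \<Rightarrow> 'i list \<Rightarrow> int"
  where
    "F_exponent D g l [] = 0"
  | "F_exponent D g l (j # b) = g j (l - wt D b) + F_exponent D g l b"

fun E_exponent :: "('i, 'y, 'x :: ab_group_add) root_datum \<Rightarrow> ('i \<Rightarrow> 'x \<Rightarrow> int) \<Rightarrow> 'x \<Rightarrow> 'i list \<Rightarrow> int"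
  where
    "E_exponent D f l [] = 0"
  | "E_exponent D f l (i # a) = f i l + E_exponent D f (l + sr_iX D i) a"

context
  fixes D :: "('i :: finite, 'y :: ab_group_add, 'x :: ab_group_add) root_datum"
    and \<epsilon> e :: int and f g u u' and w z :: qvt
  assumes \<epsilon>: "\<epsilon> * \<epsilon> = 1" and z: "z = qvt_t powi \<epsilon> * w" and fg: "twist_exponents D \<epsilon> f g u u'"
begin

lemma EF_terms_twist:
  "EF_terms D (- e) z l i b = map (\<lambda>(c, u).
    (qvt_t powi (f i (l - wt D b) + F_exponent D g l b - F_exponent D g l u) * c, u)) (EF_terms D e w l i b)"
proof (induction b)
  case (Cons j b)
  have *: "of_int (- e) ^ (sr_p D i * sr_p D j) *
      (qvt_t powi (f i (l - wt D b) + F_exponent D g l b - F_exponent D g l v) * c) =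
    qvt_t powi (f i (l - wt D (j # b)) + F_exponent D g l (j # b) - F_exponent D g l (j # v)) *
      (of_int e ^ (sr_p D i * sr_p D j) * c)"
    if v: "(c, v) \<in> set (EF_terms D e w l i b)" for c v
  proof -
    let ?l = "l - wt D b"
    have lv: "l - wt D v = ?l + sr_iX D i" using EF_terms_word [OF v] by simp
    have lj: "l - wt D (j # b) = ?l - sr_iX D j" by simp
    have "f i (l - wt D (j # b)) + F_exponent D g l (j # b) - F_exponent D g l (j # v) =
        (f i (?l - sr_iX D j) + g j ?l) + (F_exponent D g l b - F_exponent D g l v - g j (?l + sr_iX D i))"
      unfolding lj by (simp add: lv)
    also have "qvt_t powi \<dots> = (-1) ^ (sr_p D i * sr_p D j) * (qvt_t powi (g j (?l + sr_iX D i) + f i ?l) *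
        qvt_t powi (F_exponent D g l b - F_exponent D g l v - g j (?l + sr_iX D i)))"
      by (simp only: power_int_add qvt_t_nonzero simp_thms exchange_exponent [OF fg] mult.assoc)
    also have "qvt_t powi (g j (?l + sr_iX D i) + f i ?l) *
        qvt_t powi (F_exponent D g l b - F_exponent D g l v - g j (?l + sr_iX D i)) =
        qvt_t powi (f i ?l + F_exponent D g l b - F_exponent D g l v)"
    proof -
      have "(g j (?l + sr_iX D i) + f i ?l) + (F_exponent D g l b - F_exponent D g l v - g j (?l + sr_iX D i)) =
          f i ?l + F_exponent D g l b - F_exponent D g l v" by simp
      then show ?thesis by (metis power_int_add qvt_t_nonzero)
    qed
    finally have e: "qvt_t powi (f i (l - wt D (j # b)) + F_exponent D g l (j # b) - F_exponent D g l (j # v)) =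
        (-1) ^ (sr_p D i * sr_p D j) * qvt_t powi (f i ?l + F_exponent D g l b - F_exponent D g l v)" .
    have m: "of_int (- e) ^ (sr_p D i * sr_p D j) = (-1) ^ (sr_p D i * sr_p D j) * (of_int e ^ (sr_p D i * sr_p D j) :: qvt)"
      by (simp flip: power_mult_distrib)
    show ?thesis unfolding e m by (simp only: mult_ac)
  qed
  have "map (\<lambda>(c, u). (of_int (- e) ^ (sr_p D i * sr_p D j) * c, j # u)) (EF_terms D (- e) z l i b) =
      map (\<lambda>(c, u). (qvt_t powi (f i (l - wt D (j # b)) + F_exponent D g l (j # b) - F_exponent D g l u) * c, u))
        (map (\<lambda>(c, u). (of_int e ^ (sr_p D i * sr_p D j) * c, j # u)) (EF_terms D e w l i b))"
    unfolding Cons map_map by (rule map_cong [OF refl]) (use * in \<open>auto simp del: of_int_minus F_exponent.simps wt_simps\<close>)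
  moreover have "qint z (- e) (sr_d D i) (sr_pair D (sr_iY D i) (l - wt D b)) =
      qvt_t powi (f i (l - wt D (i # b)) + F_exponent D g l (i # b) - F_exponent D g l b) *
        qint w e (sr_d D i) (sr_pair D (sr_iY D i) (l - wt D b))"
  proof -
    have "l - wt D (i # b) = l - wt D b - sr_iX D i" by simp
    then have "f i (l - wt D (i # b)) + F_exponent D g l (i # b) - F_exponent D g l b =
        f i (l - wt D b - sr_iX D i) + g i (l - wt D b)" by (simp only: F_exponent.simps)
    then show ?thesis by (simp only: cartan_exponent [OF \<epsilon> z fg])
  qed
  ultimately show ?case unfolding EF_terms.simps map_append by (cases "i = j") simp_all
qed simp

text \<open>Both sides are the coefficient of \<open>E\<^sub>a F\<^sub>b x\<close> for twisted generators: on the left from their own relations, on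
  the right by collecting the powers of \<open>t\<close>. The factor splits into a part for the row and a part for the column
  when \<open>b\<close> runs over words of one weight.\<close>

lemma EF_matrix_twist:
  "EF_matrix D (- e) z l a b =
    qvt_t powi (E_exponent D f (l - wt D b) a + F_exponent D g l b) * EF_matrix D e w l a b"
proof (induction a arbitrary: b)
  case (Cons i a)
  let ?x = "E_exponent D f (l - wt D b) (i # a) + F_exponent D g l b"
  have s: "(qvt_t powi (f i (l - wt D b) + F_exponent D g l b - F_exponent D g l v) * c) * EF_matrix D (- e) z l a v =
      qvt_t powi ?x * (c * EF_matrix D e w l a v)"
    if "(c, v) \<in> set (EF_terms D e w l i b)" for c v
  proof -
    have lv: "l - wt D b + sr_iX D i = l - wt D v" using EF_terms_word [OF that] by simp
    have "?x = (f i (l - wt D b) + F_exponent D g l b - F_exponent D g l v) +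
        (E_exponent D f (l - wt D v) a + F_exponent D g l v)" unfolding E_exponent.simps lv by simp
    then show ?thesis unfolding Cons by (simp only: power_int_add qvt_t_nonzero simp_thms mult_ac)
  qed
  have "(\<Sum>(c, v) \<leftarrow> L. (qvt_t powi (f i (l - wt D b) + F_exponent D g l b - F_exponent D g l v) * c) * EF_matrix D (- e) z l a v) =
      qvt_t powi ?x * (\<Sum>(c, v) \<leftarrow> L. c * EF_matrix D e w l a v)" if "set L \<subseteq> set (EF_terms D e w l i b)" for L
    using that s by (induction L) (auto simp: distrib_left simp del: E_exponent.simps)
  from this [OF subset_refl] show ?case
    by (simp only: EF_matrix.simps EF_terms_twist map_map o_def case_prod_unfold fst_conv snd_conv)
qed auto

end

subsection \<open>Column ranks\<close>

text \<open>Independence of the family of columns of \<open>P\<close> indexed by \<open>S\<close>, with rows in \<open>W\<close>. A repeated column makes the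
  family dependent.\<close>

definition indep_cols :: "('w \<Rightarrow> 'w \<Rightarrow> 'k :: field) \<Rightarrow> 'w set \<Rightarrow> 'w set \<Rightarrow> bool"
  where "indep_cols P W S \<longleftrightarrow>
    (\<forall>c. (\<forall>a \<in> W. (\<Sum>b \<in> S. c b * P a b) = 0) \<longrightarrow> (\<forall>b \<in> S. c b = 0))"

text \<open>Linear independence of columns survives the extension of scalars to \<open>\<rat>(v, t)\<close>, the field
  automorphism and the rescaling of rows and columns.\<close>

lemma indep_cols_twist:
  fixes D :: "('i :: finite, 'y :: ab_group_add, 'x :: ab_group_add) root_datum"
  assumes \<epsilon>: "\<epsilon> * \<epsilon> = 1" and fg: "twist_exponents D \<epsilon> f g u u'"
    and S: "\<And>b. b \<in> S \<Longrightarrow> l - wt D b = \<mu>"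
    and ind: "indep_cols (EF_matrix D e qv_v l) W S"
  shows "indep_cols (EF_matrix D (- e) qv_v l) W S"
  unfolding indep_cols_def
proof (intro allI impI)
  fix c
  assume c: "\<forall>a\<in>W. (\<Sum>b\<in>S. c b * EF_matrix D (- e) qv_v l a b) = 0"
  interpret \<sigma>: field_map "twist_scal \<epsilon>" by (rule field_map_twist_scal [OF \<epsilon>])
  have \<sigma>v: "twist_scal \<epsilon> (qvt_of qv_v) = qvt_t powi \<epsilon> * qvt_of qv_v"
    by (simp add: twist_scal_v [OF \<epsilon>] sign_qvt_t [OF \<epsilon>])
  \<comment> \<open>the given relation, transported to a relation over \<open>\<rat>(v, t)\<close> between the columns for \<open>\<pi> = e\<close>\<close>
  define y where "y b = twist_scal \<epsilon> (qvt_of (c b)) * qvt_t powi F_exponent D g l b" for b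
  have y: "(\<Sum>b\<in>S. y b * qvt_of (EF_matrix D e qv_v l a b)) = 0" if a: "a \<in> W" for a
  proof -
    have sum: "h (sum k A) = (\<Sum>x\<in>A. h (k x))" if "field_map h" for h :: "'a :: field \<Rightarrow> 'b :: field" and k :: "'c \<Rightarrow> 'a" and A
    proof -
      interpret field_map h by fact
      show ?thesis by (induction A rule: infinite_finite_induct) (simp_all add: zero add)
    qed
    have "0 = twist_scal \<epsilon> (qvt_of (\<Sum>b\<in>S. c b * EF_matrix D (- e) qv_v l a b))"
      using c a by (simp add: qvt_of.zero \<sigma>.zero)
    also have "\<dots> = (\<Sum>b\<in>S. twist_scal \<epsilon> (qvt_of (c b)) * EF_matrix D (- e) (qvt_t powi \<epsilon> * qvt_of qv_v) l a b)"
      by (simp add: sum [OF field_map_qvt_of] sum [OF \<sigma>.field_map_axioms] qvt_of.mult \<sigma>.mult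
          qvt_of.EF_matrix \<sigma>.EF_matrix \<sigma>v)
    also have "\<dots> = (\<Sum>b\<in>S. qvt_t powi E_exponent D f \<mu> a * (y b * qvt_of (EF_matrix D e qv_v l a b)))"
      by (rule sum.cong [OF refl])
        (simp add: EF_matrix_twist [OF \<epsilon> refl fg] S y_def qvt_of.EF_matrix power_int_add qvt_t_nonzero)
    finally show ?thesis by (simp add: qvt_t_nonzero flip: sum_distrib_left)
  qed
  have g: "gauss0 (\<Sum>b\<in>S. y b * qvt_of (k b)) = (\<Sum>b\<in>S. gauss0 (y b) * k b)"
    "gauss1 (\<Sum>b\<in>S. y b * qvt_of (k b)) = (\<Sum>b\<in>S. gauss1 (y b) * k b)" for k
    by (induction S rule: infinite_finite_induct)
      (simp_all add: zero_gauss_def plus_gauss_def times_gauss_def qvt_of_def)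
  have "(\<Sum>b\<in>S. gauss0 (y b) * EF_matrix D e qv_v l a b) = 0"
    "(\<Sum>b\<in>S. gauss1 (y b) * EF_matrix D e qv_v l a b) = 0" if "a \<in> W" for a
    using y [OF that] by (simp_all add: zero_gauss_def flip: g)
  then have "\<forall>b\<in>S. gauss0 (y b) = 0" "\<forall>b\<in>S. gauss1 (y b) = 0"
    using ind [unfolded indep_cols_def, rule_format, of "\<lambda>b. gauss0 (y b)"]
      ind [unfolded indep_cols_def, rule_format, of "\<lambda>b. gauss1 (y b)"] by auto
  then have "y b = 0" if "b \<in> S" for b using that by (simp add: gauss_eq_iff zero_gauss_def)
  then show "\<forall>b\<in>S. c b = 0"
    by (simp add: y_def qvt_t_nonzero \<sigma>.eq_0_iff qvt_of.eq_0_iff)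
qed

lemma indep_cols_sign:
  fixes D :: "('i :: finite, 'y :: ab_group_add, 'x :: ab_group_add) root_datum"
  assumes D: "super_root_datum D" and S: "\<And>b. b \<in> S \<Longrightarrow> l - wt D b = \<mu>"
  shows "indep_cols (EF_matrix D (- 1) qv_v l) W S \<longleftrightarrow> indep_cols (EF_matrix D 1 qv_v l) W S"
proof -
  obtain f g u u' where fg: "twist_exponents D 1 f g u u'"
    using twist_exponents_exist [OF D] by blast
  show ?thesis
    using indep_cols_twist [OF _ fg S, where e = 1 and W = W] indep_cols_twist [OF _ twist_exponents_neg [OF fg] S, where e = "- 1" and W = W]
    by auto
qed

text \<open>Gaussian elimination: a column \<open>p\<close> with nonzero entry in the equation \<open>a\<close> is used to eliminate this equation.\<close>

lemma nontrivial_solution: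
  fixes \<kappa> :: "'b \<Rightarrow> 'a \<Rightarrow> 'k :: field"
  assumes "finite A" "finite B" "card A < card B"
  shows "\<exists>c. (\<exists>b\<in>B. c b \<noteq> 0) \<and> (\<forall>a\<in>A. (\<Sum>b\<in>B. c b * \<kappa> b a) = 0)"
  using assms
proof (induction A arbitrary: B \<kappa> rule: finite_induct)
  case empty
  then have "B \<noteq> {}" by auto
  then show ?case by (intro exI [of _ "\<lambda>_. 1"]) auto
next
  case (insert a A)
  show ?case
  proof (cases "\<forall>b\<in>B. \<kappa> b a = 0")
    case True
    have "card A < card B" using insert by simp
    from insert.IH [OF insert.prems(1) this, of \<kappa>] show ?thesis using True by auto
  next
    case False
    then obtain p where p: "p \<in> B" "\<kappa> p a \<noteq> 0" by blast
    define \<kappa>' where "\<kappa>' b x = \<kappa> b x - \<kappa> b a / \<kappa> p a * \<kappa> p x" for b x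
    have "card A < card (B - {p})" using insert p by (simp add: card_Diff_singleton)
    from insert.IH [OF _ this, of \<kappa>'] insert.prems(1)
    obtain c where c: "\<exists>b\<in>B - {p}. c b \<noteq> 0" "\<And>x. x \<in> A \<Longrightarrow> (\<Sum>b\<in>B - {p}. c b * \<kappa>' b x) = 0"
      by auto
    define d where "d b = (if b = p then - (\<Sum>b\<in>B - {p}. c b * \<kappa> b a) / \<kappa> p a else c b)" for b
    have d: "(\<Sum>b\<in>B. d b * \<kappa> b x) = (\<Sum>b\<in>B - {p}. c b * \<kappa>' b x)" for x
    proof -
      have "(\<Sum>b\<in>B. d b * \<kappa> b x) = d p * \<kappa> p x + (\<Sum>b\<in>B - {p}. d b * \<kappa> b x)"
        using insert.prems(1) p by (simp add: sum.remove)
      also have "(\<Sum>b\<in>B - {p}. d b * \<kappa> b x) = (\<Sum>b\<in>B - {p}. c b * \<kappa> b x)"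
        by (rule sum.cong) (auto simp: d_def)
      also have "d p * \<kappa> p x = - (\<Sum>b\<in>B - {p}. c b * (\<kappa> b a / \<kappa> p a * \<kappa> p x))"
        by (simp add: d_def sum_distrib_right sum_divide_distrib mult.assoc sum_negf)
      finally show ?thesis
        by (simp add: \<kappa>'_def right_diff_distrib sum_subtractf)
    qed
    have "(\<Sum>b\<in>B. d b * \<kappa> b x) = 0" if "x \<in> insert a A" for x
      using that c(2) p(2) unfolding d by (auto simp: \<kappa>'_def)
    moreover have "\<exists>b\<in>B. d b \<noteq> 0" using c(1) by (auto simp: d_def)
    ultimately show ?thesis by blast
  qed
qed


section \<open>Characters of simple highest weight modules\<close>

context free_rep
begin

inductive_set lin :: "'m set \<Rightarrow> 'm set" for S where
  zero: "\<zero> \<in> lin S"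
| step: "m \<in> lin S \<Longrightarrow> x \<in> S \<Longrightarrow> sc c x \<oplus> m \<in> lin S"

lemma lin_carrier: "m \<in> lin S \<Longrightarrow> S \<subseteq> carrier M \<Longrightarrow> m \<in> carrier M"
  by (induction rule: lin.induct) auto

lemma lin_base: "x \<in> S \<Longrightarrow> S \<subseteq> carrier M \<Longrightarrow> x \<in> lin S"
  using lin.step [OF lin.zero, of x S 1] by (auto dest: subsetD)

lemma lin_add: "m \<in> lin S \<Longrightarrow> n \<in> lin S \<Longrightarrow> S \<subseteq> carrier M \<Longrightarrow> m \<oplus> n \<in> lin S"
proof (induction rule: lin.induct)
  case (step m x c)
  then have "sc c x \<oplus> m \<oplus> n = sc c x \<oplus> (m \<oplus> n)"
    using lin_carrier by (intro a_assoc) auto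
  then show ?case using step by (auto intro: lin.step)
qed (simp add: lin_carrier)

lemma lin_map:
  assumes T: "add_hom M M T" "\<And>c m. m \<in> carrier M \<Longrightarrow> T (sc c m) = sc c (T m)"
    and S: "S \<subseteq> carrier M" "S' \<subseteq> carrier M" "\<And>x. x \<in> S \<Longrightarrow> T x \<in> lin S'" and m: "m \<in> lin S"
  shows "T m \<in> lin S'"
proof -
  have sc: "sc c m \<in> lin S'" if "m \<in> lin S'" for c m
    using that
  proof (induction rule: lin.induct)
    case (step m x d)
    then have "x \<in> carrier M" "m \<in> carrier M" using lin_carrier [of m S'] S(2) by auto
    then have "sc c (sc d x \<oplus> m) = sc (c * d) x \<oplus> sc c m" by simp
    then show ?case using step by (auto intro: lin.step)
  qed (simp add: lin.zero)
  from m show ?thesis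
  proof (induction rule: lin.induct)
    case zero
    then show ?case using add_hom_zero [OF abelian_group_axioms abelian_group_axioms T(1)] by (simp add: lin.zero)
  next
    case (step m x c)
    then have "m \<in> carrier M" "x \<in> carrier M" using lin_carrier S by auto
    then have "T (sc c x \<oplus> m) = sc c (T x) \<oplus> T m" using T add_homD (2) [OF T(1)] by simp
    then show ?case using step S sc by (auto intro: lin_add)
  qed
qed

lemma lin_sc: "m \<in> lin S \<Longrightarrow> S \<subseteq> carrier M \<Longrightarrow> sc c m \<in> lin S"
  using lin_map [of "sc c" S S m] lin.step [OF lin.zero, of _ S c]
  by (auto simp: add_hom_def mult.commute subset_iff simp flip: sc_simps(4))

lemma lin_family:
  assumes "m \<in> lin (x ` S)" "finite S" and x: "\<And>b. b \<in> S \<Longrightarrow> x b \<in> carrier M"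
  shows "\<exists>c. m = (\<Oplus>b\<in>S. sc (c b) (x b))"
  using assms(1)
proof (induction rule: lin.induct)
  case zero
  have "(\<Oplus>b\<in>S. sc 0 (x b)) = (\<Oplus>b\<in>S. \<zero>)" by (rule finsum_cong') (use x in auto)
  then show ?case by (intro exI [of _ "\<lambda>_. 0"]) simp
next
  case (step m y a)
  then obtain c b where c: "m = (\<Oplus>b\<in>S. sc (c b) (x b))" and b: "b \<in> S" "y = x b" by auto
  have "(\<Oplus>k\<in>S. sc ((c (b := c b + a)) k) (x k)) =
      (\<Oplus>k\<in>insert b (S - {b}). sc ((c (b := c b + a)) k) (x k))"
    using b by (simp add: insert_absorb)
  also have "\<dots> = sc (c b + a) (x b) \<oplus> (\<Oplus>k\<in>S - {b}. sc (c k) (x k))"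
  proof -
    have "(\<Oplus>k\<in>S - {b}. sc ((c (b := c b + a)) k) (x k)) = (\<Oplus>k\<in>S - {b}. sc (c k) (x k))"
      by (rule finsum_cong' [OF refl]) (use x in \<open>simp_all add: Pi_def\<close>)
    moreover have "(\<Oplus>k\<in>insert b (S - {b}). sc ((c (b := c b + a)) k) (x k)) =
        sc (c b + a) (x b) \<oplus> (\<Oplus>k\<in>S - {b}. sc ((c (b := c b + a)) k) (x k))"
      using x b assms(2) by (subst finsum_insert) auto
    ultimately show ?thesis by (simp only:)
  qed
  also have "\<dots> = sc a (x b) \<oplus> (sc (c b) (x b) \<oplus> (\<Oplus>k\<in>S - {b}. sc (c k) (x k)))"
  proof -
    have "(\<Oplus>k\<in>S - {b}. sc (c k) (x k)) \<in> carrier M" using x by (intro finsum_closed) auto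
    then show ?thesis using x b by (simp add: a_ac)
  qed
  also have "sc (c b) (x b) \<oplus> (\<Oplus>k\<in>S - {b}. sc (c k) (x k)) = (\<Oplus>k\<in>insert b (S - {b}). sc (c k) (x k))"
    using x b assms(2) by (subst finsum_insert) auto
  also have "\<dots> = m" using b by (simp add: c insert_absorb)
  finally show ?case using b by metis
qed

text \<open>The condition of \<^const>\<open>fin_basis\<close> for the scalar action \<open>sc\<close>.\<close>

definition unique_coords :: "'m set \<Rightarrow> 'm set \<Rightarrow> bool"
  where "unique_coords W B \<longleftrightarrow> finite B \<and> B \<subseteq> W \<and>
    (\<forall>x \<in> W. \<exists>!c :: 'm \<Rightarrow> 'k. c \<in> B \<rightarrow>\<^sub>E UNIV \<and> x = finsum M (\<lambda>b. sc (c b) b) B)"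

lemma finsum_combine:
  assumes "finite A" "finite B" and B: "B \<subseteq> carrier M"
  shows "(\<Oplus>a\<in>A. sc (c a) (\<Oplus>b\<in>B. sc (k a b) b)) = (\<Oplus>b\<in>B. sc (\<Sum>a\<in>A. c a * k a b) b)"
  using assms(1)
proof (induction A rule: finite_induct)
  case empty
  have "(\<Oplus>b\<in>B. sc 0 b) = (\<Oplus>b\<in>B. \<zero>)" by (rule finsum_cong') (use B in auto)
  then show ?case by simp
next
  case (insert a A)
  have C: "(\<Oplus>b\<in>B. sc (l b) b) \<in> carrier M" for l using B by (intro finsum_closed) auto
  have "sc (c a) (\<Oplus>b\<in>B. sc (k a b) b) = (\<Oplus>b\<in>B. sc (c a) (sc (k a b) b))"
    using B assms(2) by (intro add_hom_finsum [OF abelian_group_axioms abelian_group_axioms action_add_hom [OF sc]]) auto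
  also have "\<dots> = (\<Oplus>b\<in>B. sc (c a * k a b) b)" by (rule finsum_cong') (use B in auto)
  finally have "(\<Oplus>a\<in>insert a A. sc (c a) (\<Oplus>b\<in>B. sc (k a b) b)) =
      (\<Oplus>b\<in>B. sc (c a * k a b) b) \<oplus> (\<Oplus>b\<in>B. sc (\<Sum>a\<in>A. c a * k a b) b)"
    using insert C by (simp add: Pi_def)
  also have "\<dots> = (\<Oplus>b\<in>B. sc (c a * k a b) b \<oplus> sc (\<Sum>a\<in>A. c a * k a b) b)"
    using B by (intro finsum_addf [symmetric]) auto
  also have "\<dots> = (\<Oplus>b\<in>B. sc (\<Sum>a\<in>insert a A. c a * k a b) b)"
    by (rule finsum_cong') (use B insert in auto)
  finally show ?case .
qed

lemma ex1_unique: "\<exists>!x. Q x \<Longrightarrow> Q y \<Longrightarrow> Q z \<Longrightarrow> y = z"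
  by blast

text \<open>Steinitz: if \<open>B'\<close> were larger than \<open>B\<close>, the coordinate vectors of \<open>B'\<close> with respect to \<open>B\<close> would satisfy a nontrivial
  relation, and \<open>\<zero>\<close> would have two expansions in \<open>B'\<close>.\<close>

lemma unique_coords_card_le:
  assumes B: "unique_coords W B" and B': "unique_coords W B'" and W: "W \<subseteq> carrier M" "\<zero> \<in> W"
  shows "card B' \<le> card B"
proof (rule ccontr)
  assume "\<not> card B' \<le> card B"
  then have lt: "card B < card B'" by simp
  have fin: "finite B" "finite B'" "B \<subseteq> carrier M" "B' \<subseteq> carrier M" "B' \<subseteq> W"
    using B B' W by (auto simp: unique_coords_def)
  have "\<exists>k. x = (\<Oplus>b\<in>B. sc (k b) b)" if "x \<in> B'" for x
    using B that fin(5) unfolding unique_coords_def by blast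
  then obtain \<kappa> where \<kappa>: "\<And>x. x \<in> B' \<Longrightarrow> x = (\<Oplus>b\<in>B. sc (\<kappa> x b) b)" by metis
  obtain c where c: "\<exists>x\<in>B'. c x \<noteq> 0" "\<And>b. b \<in> B \<Longrightarrow> (\<Sum>x\<in>B'. c x * \<kappa> x b) = 0"
    using nontrivial_solution [OF fin(1,2) lt, of \<kappa>] by blast
  have z: "(\<Oplus>x\<in>A. sc 0 x) = \<zero>" if "A \<subseteq> carrier M" for A
  proof -
    have "(\<Oplus>x\<in>A. sc 0 x) = (\<Oplus>x\<in>A. \<zero>)" by (rule finsum_cong') (use that in auto)
    then show ?thesis by simp
  qed
  have "(\<Oplus>x\<in>B'. sc (c x) x) = (\<Oplus>x\<in>B'. sc (c x) (\<Oplus>b\<in>B. sc (\<kappa> x b) b))"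
    by (rule finsum_cong') (use \<kappa> fin in \<open>auto intro!: finsum_closed\<close>)
  also have "\<dots> = (\<Oplus>b\<in>B. sc (\<Sum>x\<in>B'. c x * \<kappa> x b) b)"
    by (rule finsum_combine) (use fin in auto)
  also have "\<dots> = (\<Oplus>b\<in>B. sc 0 b)"
    by (rule finsum_cong') (use c fin in auto)
  finally have c0: "(\<Oplus>x\<in>B'. sc (c x) x) = \<zero>" using z fin by simp
  let ?c = "restrict c B'" and ?z = "\<lambda>x\<in>B'. 0 :: 'k"
  have "(\<Oplus>x\<in>B'. sc (?c x) x) = (\<Oplus>x\<in>B'. sc (c x) x)" "(\<Oplus>x\<in>B'. sc (?z x) x) = (\<Oplus>x\<in>B'. sc 0 x)"
    by (intro finsum_cong' [OF refl]; use fin in auto)+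
  then have r: "(\<Oplus>x\<in>B'. sc (?c x) x) = \<zero>" "(\<Oplus>x\<in>B'. sc (?z x) x) = \<zero>"
    using c0 z [OF fin(4)] by simp_all
  have "\<exists>!d. d \<in> B' \<rightarrow>\<^sub>E UNIV \<and> \<zero> = (\<Oplus>x\<in>B'. sc (d x) x)"
    using B' W unfolding unique_coords_def by blast
  moreover have "?c \<in> B' \<rightarrow>\<^sub>E UNIV \<and> \<zero> = (\<Oplus>x\<in>B'. sc (?c x) x)"
    "?z \<in> B' \<rightarrow>\<^sub>E UNIV \<and> \<zero> = (\<Oplus>x\<in>B'. sc (?z x) x)"
    unfolding r by simp_all
  ultimately have cz: "?c = ?z" by (rule ex1_unique [where Q = "\<lambda>d. d \<in> B' \<rightarrow>\<^sub>E UNIV \<and> \<zero> = (\<Oplus>x\<in>B'. sc (d x) x)"])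
  have "c x = 0" if "x \<in> B'" for x using that fun_cong [OF cz, of x] by simp
  then show False using c(1) by blast
qed

end

text \<open>Simplicity is stated for subsets closed under scalars and generators, which are the same as submodules.\<close>

locale hw_rep = weight_rep D e "\<lambda>x. x" M sc \<rho>
  for D :: "('i :: finite, 'y :: ab_group_add, 'x :: ab_group_add) root_datum"
    and e :: int and M :: "('m, 'w) ring_scheme" (structure)
    and sc :: "qv \<Rightarrow> 'm \<Rightarrow> 'm" and \<rho> :: "('i, 'y) freeU \<Rightarrow> 'm \<Rightarrow> 'm" +
  fixes hw :: 'x and hv :: 'm
  assumes hv: "hv \<in> wsp hw" "hv \<noteq> \<zero>" "E i hv = \<zero>"
    and simple: "H \<subseteq> carrier M \<Longrightarrow> \<zero> \<in> H \<Longrightarrow> (\<And>m n. m \<in> H \<Longrightarrow> n \<in> H \<Longrightarrow> m \<oplus> n \<in> H) \<Longrightarrow>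
      (\<And>c m. m \<in> H \<Longrightarrow> sc c m \<in> H) \<Longrightarrow> (\<And>x m. m \<in> H \<Longrightarrow> \<rho> (fgen x) m \<in> H) \<Longrightarrow>
      H = {\<zero>} \<or> H = carrier M"
begin

lemma w_eq: "w = qv_v"
  by (simp add: w_def)

primrec Fw :: "'i list \<Rightarrow> 'm \<Rightarrow> 'm" where
  "Fw [] m = m" | "Fw (j # b) m = F j (Fw b m)"

primrec Ew :: "'i list \<Rightarrow> 'm \<Rightarrow> 'm" where
  "Ew [] m = m" | "Ew (i # a) m = Ew a (E i m)"

lemma Ew_snoc: "Ew (a @ [i]) m = E i (Ew a m)"
  by (induction a arbitrary: m) simp_all

lemma Fw_closed [simp]: "m \<in> carrier M \<Longrightarrow> Fw b m \<in> carrier M"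
  by (induction b) simp_all

lemma Fw_zero [simp]: "Fw b \<zero> = \<zero>"
  by (induction b) simp_all

lemma Ew_add_hom: "add_hom M M (Ew a)"
  by (induction a) (simp_all add: add_hom_def)

lemma Ew_closed [simp]: "m \<in> carrier M \<Longrightarrow> Ew a m \<in> carrier M"
  using add_homD (1) [OF Ew_add_hom] .

lemma Ew_sc: "m \<in> carrier M \<Longrightarrow> Ew a (sc c m) = sc c (Ew a m)"
  by (induction a arbitrary: m) (simp_all flip: sc_\<rho>)

lemma Ew_zero [simp]: "Ew a \<zero> = \<zero>"
  by (induction a) simp_all

lemma Fw_wsp: "m \<in> wsp l \<Longrightarrow> Fw b m \<in> wsp (l - wt D b)"
proof (induction b)
  case (Cons j b)
  have "l - wt D (j # b) = l - wt D b - sr_iX D j" by simp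
  then show ?case using F_wsp [OF datum Cons.IH [OF Cons.prems], of j] by (simp only: Fw.simps)
qed simp

lemma Ew_wsp: "m \<in> wsp l \<Longrightarrow> Ew a m \<in> wsp (l + wt D a)"
proof (induction a arbitrary: m l)
  case (Cons i a)
  have "l + wt D (i # a) = l + sr_iX D i + wt D a" by (simp add: add.assoc)
  then show ?case using Cons.IH [OF E_wsp [OF datum Cons.prems, of i]] by (simp only: Ew.simps)
qed simp

text \<open>Evaluation of a list of weighted words, as produced by \<^const>\<open>EF_terms\<close>, on the vector \<open>y\<close>.\<close>

definition terms :: "'m \<Rightarrow> (qv \<times> 'i list) list \<Rightarrow> 'm"
  where "terms y L = foldr (\<lambda>(c, u) m. sc c (Fw u y) \<oplus> m) L \<zero>"

lemma terms_simps [simp]: "terms y [] = \<zero>" "terms y ((c, u) # L) = sc c (Fw u y) \<oplus> terms y L"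
  by (simp_all add: terms_def)

lemma terms_closed [simp]: "y \<in> carrier M \<Longrightarrow> terms y L \<in> carrier M"
  by (induction L) auto

lemma terms_append: "y \<in> carrier M \<Longrightarrow> terms y (L @ L') = terms y L \<oplus> terms y L'"
  by (induction L) (auto simp: a_assoc)

lemma terms_map:
  "y \<in> carrier M \<Longrightarrow> terms y (map (\<lambda>(c, u). (k * c, j # u)) L) = sc k (F j (terms y L))"
  by (induction L) (auto simp flip: sc_\<rho>)

lemma E_Fw:
  assumes y: "y \<in> wsp l"
  shows "E i (Fw b y) = sc (\<Prod>j\<leftarrow>b. of_int e ^ (sr_p D i * sr_p D j)) (Fw b (E i y)) \<oplus>
    terms y (EF_terms D e w l i b)"
proof (induction b)
  case Nil
  show ?case using wsp_carrier [OF y] by simp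
next
  case (Cons j b)
  let ?k = "of_int e ^ (sr_p D i * sr_p D j)"
  note [simp] = wsp_carrier [OF y]
  show ?case
    unfolding Fw.simps EF_wsp [OF datum Fw_wsp [OF y], of i j] EF_terms.simps Cons
    by (simp add: terms_append terms_map a_assoc flip: sc_\<rho>)
qed

text \<open>A form of the triangular decomposition: the span of the \<open>F\<^sub>b E\<^sub>a y\<close> is a submodule, because commuting \<open>E\<^sub>i\<close> to the right
  through \<open>F\<^sub>b\<close> only produces terms of the same shape.\<close>

lemma FE_span:
  assumes y: "y \<in> wsp l" "y \<noteq> \<zero>"
  shows "lin {Fw b (Ew a y) | a b. True} = carrier M"
proof -
  let ?S = "{Fw b (Ew a y) | a b. True}"
  note [simp] = wsp_carrier [OF y(1)]
  have S: "?S \<subseteq> carrier M" by auto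
  have base: "Fw b (Ew a y) \<in> lin ?S" for a b by (rule lin_base [OF _ S]) blast
  have gen: "\<rho> (fgen x) s \<in> lin ?S" if s: "s \<in> ?S" for x s
  proof -
    obtain a b where ab: "s = Fw b (Ew a y)" using s by blast
    let ?z = "Ew a y" and ?l = "l + wt D a"
    have z: "?z \<in> wsp ?l" and s': "s \<in> wsp (?l - wt D b)" unfolding ab by (intro Ew_wsp Fw_wsp y)+
    show ?thesis
    proof (cases x)
      case (GE i)
      have "terms ?z L \<in> lin ?S" for L
      proof (induction L)
        case (Cons p L)
        then show ?case by (cases p) (simp only: terms_simps, intro lin_add lin_sc base S)
      qed (simp add: lin.zero)
      moreover have "Fw b (E i ?z) \<in> lin ?S"
        using base [of b "a @ [i]"] by (simp add: Ew_snoc)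
      ultimately show ?thesis
        unfolding GE ab E_Fw [OF z] by (intro lin_add lin_sc S)
    next
      case (GF j)
      then show ?thesis using base [of "j # b" a] by (simp add: ab)
    next
      case (GK n)
      then show ?thesis using s' lin_sc [OF base S] by (simp add: wsp_def ab)
    next
      case (GJ n)
      then show ?thesis using s' lin_sc [OF base S] by (simp add: wsp_def ab)
    qed
  qed
  have "lin ?S = {\<zero>} \<or> lin ?S = carrier M"
  proof (rule simple)
    show "\<rho> (fgen x) m \<in> lin ?S" if "m \<in> lin ?S" for x m
      by (rule lin_map [OF action_add_hom [OF \<rho>] _ S S gen that]) (simp_all add: sc_\<rho>)
  qed (use lin_carrier S in \<open>auto intro: lin.zero lin_add lin_sc\<close>)
  then show ?thesis using base [of "[]" "[]"] y(2) by auto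
qed

lemma F_span: "lin (range (\<lambda>b. Fw b hv)) = carrier M"
proof -
  have C: "hv \<in> carrier M" by (rule wsp_carrier [OF hv(1)])
  have S: "range (\<lambda>b. Fw b hv) \<subseteq> carrier M" using C by auto
  have "m \<in> lin (range (\<lambda>b. Fw b hv))" if "m \<in> lin {Fw b (Ew a hv) | a b. True}" for m
  proof (rule lin_map [of "\<lambda>m. m", OF _ _ _ S _ that])
    fix x
    assume "x \<in> {Fw b (Ew a hv) | a b. True}"
    then obtain a b where x: "x = Fw b (Ew a hv)" by blast
    show "x \<in> lin (range (\<lambda>b. Fw b hv))"
      by (cases a) (auto simp: x hv(3) lin.zero intro!: lin_base [OF _ S])
  qed (use C in \<open>auto simp: add_hom_def\<close>)
  then show ?thesis using FE_span [OF hv(1,2)] lin_carrier [OF _ S] by blast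
qed

definition words :: "'x \<Rightarrow> 'i list set"
  where "words \<mu> = {b. hw - wt D b = \<mu>}"

lemma finite_words: "finite (words \<mu>)"
proof (cases "words \<mu> = {}")
  case False
  then obtain b where b: "b \<in> words \<mu>" by blast
  have "length a = length b" if "a \<in> words \<mu>" for a
  proof -
    have "hw - wt D a = hw - wt D b" using that b by (simp add: words_def)
    then have "wt D a = wt D b" by simp
    then show ?thesis by (rule wt_count [OF datum])
  qed
  then have "words \<mu> \<subseteq> {a. set a \<subseteq> UNIV \<and> length a = length b}" by blast
  then show ?thesis using finite_lists_length_eq [of "UNIV :: 'i set" "length b"] by (rule finite_subset) simp
qed simp

lemma comp_linear:
  "add_hom M M (\<lambda>m. comp m \<mu>)" "m \<in> carrier M \<Longrightarrow> comp (sc c m) \<mu> = sc c (comp m \<mu>)"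
  by (simp_all add: add_hom_def comp_add comp_sc)

lemma wsp_span:
  assumes m: "m \<in> wsp \<mu>"
  shows "m \<in> lin ((\<lambda>b. Fw b hv) ` words \<mu>)"
proof -
  have C: "hv \<in> carrier M" by (rule wsp_carrier [OF hv(1)])
  have S: "range (\<lambda>b. Fw b hv) \<subseteq> carrier M" "(\<lambda>b. Fw b hv) ` words \<mu> \<subseteq> carrier M" using C by auto
  \<comment> \<open>projecting an expansion of \<open>m\<close> to weight \<open>\<mu>\<close> keeps exactly the words of the right weight\<close>
  have "comp m \<mu> \<in> lin ((\<lambda>b. Fw b hv) ` words \<mu>)"
  proof (rule lin_map [of "\<lambda>m. comp m \<mu>", OF comp_linear S])
    show "m \<in> lin (range (\<lambda>b. Fw b hv))" using F_span wsp_carrier [OF m] by simp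
    fix x
    assume "x \<in> range (\<lambda>b. Fw b hv)"
    then obtain b where b: "x = Fw b hv" by blast
    show "comp x \<mu> \<in> lin ((\<lambda>b. Fw b hv) ` words \<mu>)"
      unfolding b comp_wsp [OF Fw_wsp [OF hv(1)]]
      by (auto simp: words_def intro!: lin.zero lin_base) (use C in auto)
  qed
  then show ?thesis using comp_wsp [OF m, of \<mu>] by simp
qed

text \<open>A word of weight \<open>- wt D b\<close> would combine with \<open>b\<close> to a nonempty word of weight zero, and there is none.\<close>

lemma wsp_above:
  assumes m: "m \<in> wsp (hw + wt D b)" and b: "b \<noteq> []"
  shows "m = \<zero>"
proof -
  have "words (hw + wt D b) = {}"
  proof (intro equals0I)
    fix b'
    assume "b' \<in> words (hw + wt D b)"
    then have "wt D (b @ b') = wt D []" by (simp add: words_def algebra_simps)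
    then have "length (b @ b') = length ([] :: 'i list)" by (rule wt_count [OF datum])
    then show False using b by simp
  qed
  then show ?thesis using wsp_span [OF m] by (auto elim: lin.cases)
qed

text \<open>Otherwise the highest weight vector is a combination of the \<open>F\<^sub>b E\<^sub>a y\<close> of highest weight. There \<open>E\<^sub>a y\<close> lies strictly
  above the highest weight, unless \<open>b\<close> is empty and \<open>a\<close> is one of the words that kill \<open>y\<close>.\<close>

lemma nondegenerate:
  assumes y: "y \<in> wsp \<mu>" and E: "\<And>a. a \<in> words \<mu> \<Longrightarrow> Ew a y = \<zero>"
  shows "y = \<zero>"
proof (rule ccontr)
  assume ne: "y \<noteq> \<zero>"
  note [simp] = wsp_carrier [OF y]
  let ?S = "{Fw b (Ew a y) | a b. True}"
  have "comp hv hw \<in> lin {}"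
  proof (rule lin_map [of "\<lambda>m. comp m hw", OF comp_linear])
    show "hv \<in> lin ?S" using FE_span [OF y ne] wsp_carrier [OF hv(1)] by simp
    fix x
    assume "x \<in> ?S"
    then obtain a b where x: "x = Fw b (Ew a y)" by blast
    have "comp x hw = \<zero>"
    proof (cases "hw = \<mu> + wt D a - wt D b")
      case True
      have "Ew a y = \<zero>"
      proof (cases "b = []")
        case True
        then have "hw - wt D a = \<mu>" using \<open>hw = _\<close> by simp
        then show ?thesis by (intro E) (simp only: words_def mem_Collect_eq)
      next
        case False
        have "\<mu> + wt D a = hw + wt D b" using \<open>hw = _\<close> by simp
        then show ?thesis using Ew_wsp [OF y, of a] wsp_above [OF _ False] by simp
      qed
      then show ?thesis using comp_wsp [OF wsp_zero, of hw hw] by (simp add: x)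
    next
      case False
      then show ?thesis unfolding x by (simp add: comp_wsp [OF Fw_wsp [OF Ew_wsp [OF y]]])
    qed
    then show "comp x hw \<in> lin {}" by (simp add: lin.zero)
  qed auto
  then have "comp hv hw = \<zero>" by (auto elim: lin.cases)
  then show False using comp_wsp [OF hv(1), of hw] hv(2) by simp
qed

lemma Ew_Fw: "length a = length b \<Longrightarrow> Ew a (Fw b hv) = sc (EF_matrix D e w hw a b) hv"
proof (induction a arbitrary: b)
  case Nil
  then show ?case using wsp_carrier [OF hv(1)] by simp
next
  case (Cons i a)
  note [simp] = wsp_carrier [OF hv(1)]
  have "Ew a (terms hv L) = sc (\<Sum>(c, u) \<leftarrow> L. c * EF_matrix D e w hw a u) hv"
    if "\<And>c u. (c, u) \<in> set L \<Longrightarrow> length u = length a" for L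
    using that
  proof (induction L)
    case (Cons p L)
    obtain c u where p: "p = (c, u)" by (cases p)
    have "length a = length u" using Cons.prems [of c u] p by simp
    then have "Ew a (sc c (Fw u hv)) = sc (c * EF_matrix D e w hw a u) hv"
      by (simp add: Ew_sc \<open>\<And>b. length a = length b \<Longrightarrow> _\<close>)
    moreover have "Ew a (terms hv L) = sc (\<Sum>(c, u) \<leftarrow> L. c * EF_matrix D e w hw a u) hv"
    proof (rule Cons.IH)
      show "length u = length a" if "(c, u) \<in> set L" for c u
        using Cons.prems [of c u] that by simp
    qed
    ultimately show ?case by (simp add: p add_homD (2) [OF Ew_add_hom])
  qed simp
  moreover have "length u = length a" if "(c, u) \<in> set (EF_terms D e w hw i b)" for c u
    using EF_terms_word [OF that] Cons.prems by simp
  ultimately show ?case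
    by (simp add: E_Fw [OF hv(1)] hv(3))
qed

lemma combination_eq_0_iff:
  assumes S: "S \<subseteq> words \<mu>"
  shows "(\<Oplus>b\<in>S. sc (c b) (Fw b hv)) = \<zero> \<longleftrightarrow> (\<forall>a \<in> words \<mu>. (\<Sum>b\<in>S. c b * EF_matrix D e w hw a b) = 0)"
proof -
  note [simp] = wsp_carrier [OF hv(1)]
  have fin: "finite S" using S finite_words finite_subset by blast
  let ?y = "\<Oplus>b\<in>S. sc (c b) (Fw b hv)"
  have y: "?y \<in> wsp \<mu>" using fin S
  proof (induction S rule: finite_induct)
    case (insert b S)
    have "Fw b hv \<in> wsp \<mu>" using Fw_wsp [OF hv(1), of b] insert.prems by (simp add: words_def)
    then show ?case using insert by (simp add: Pi_def wsp_add wsp_sc)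
  qed simp
  have Ey: "Ew a ?y = sc (\<Sum>b\<in>S. c b * EF_matrix D e w hw a b) hv" if a: "a \<in> words \<mu>" for a
    using fin S
  proof (induction S rule: finite_induct)
    case (insert b S)
    have "hw - wt D a = hw - wt D b" using a insert.prems by (simp add: words_def)
    then have "wt D a = wt D b" by simp
    then have "length a = length b" by (rule wt_count [OF datum])
    then have "Ew a (sc (c b) (Fw b hv)) = sc (c b * EF_matrix D e w hw a b) hv"
      by (simp add: Ew_sc Ew_Fw)
    then show ?case using insert by (simp add: Pi_def add_homD (2) [OF Ew_add_hom])
  qed simp
  show ?thesis
  proof
    assume "?y = \<zero>"
    then have "sc (\<Sum>b\<in>S. c b * EF_matrix D e w hw a b) hv = \<zero>" if "a \<in> words \<mu>" for a
      using Ey [OF that] by simp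
    then show "\<forall>a \<in> words \<mu>. (\<Sum>b\<in>S. c b * EF_matrix D e w hw a b) = 0"
      using hv(2) by (simp add: sc_eq_0)
  qed (use nondegenerate [OF y] Ey in simp)
qed

text \<open>By nondegeneracy the linear relations between the \<open>F\<^sub>b x\<close> of weight \<open>\<mu>\<close> are the relations between columns of the
  matrix, so a basis of the weight space can be read off from the columns.\<close>

lemma word_basis:
  assumes SW: "S \<subseteq> words \<mu>" and ind: "indep_cols (EF_matrix D e w hw) (words \<mu>) S"
    and max: "\<And>b. b \<in> words \<mu> \<Longrightarrow> b \<notin> S \<Longrightarrow> \<not> indep_cols (EF_matrix D e w hw) (words \<mu>) (insert b S)"
  shows "unique_coords (wsp \<mu>) ((\<lambda>b. Fw b hv) ` S)" "card ((\<lambda>b. Fw b hv) ` S) = card S"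
proof -
  note [simp] = wsp_carrier [OF hv(1)]
  let ?x = "\<lambda>b. Fw b hv"
  have fin: "finite S" using SW finite_words finite_subset by blast
  have zero: "\<forall>b\<in>S. c b = 0" if "(\<Oplus>b\<in>S. sc (c b) (?x b)) = \<zero>" for c
    using that ind combination_eq_0_iff [OF SW] by (simp add: indep_cols_def)
  have eq: "\<forall>b\<in>S. c b = d b" if "(\<Oplus>b\<in>S. sc (c b) (?x b)) = (\<Oplus>b\<in>S. sc (d b) (?x b))" for c d
  proof -
    have "(\<Oplus>b\<in>S. sc (c b) (?x b)) = (\<Oplus>b\<in>S. sc (c b - d b) (?x b) \<oplus> sc (d b) (?x b))"
      by (rule finsum_cong') (auto simp flip: sc_simps(2))
    also have "\<dots> = (\<Oplus>b\<in>S. sc (c b - d b) (?x b)) \<oplus> (\<Oplus>b\<in>S. sc (d b) (?x b))"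
      by (rule finsum_addf) auto
    finally have "(\<Oplus>b\<in>S. sc (c b - d b) (?x b)) = \<zero>"
      using that by (simp add: Pi_def)
    from zero [OF this] show ?thesis by simp
  qed
  have inj: "inj_on ?x S"
  proof (rule inj_onI)
    fix a b
    assume ab: "a \<in> S" "b \<in> S" "?x a = ?x b"
    have delta: "(\<Oplus>k\<in>S. sc (if k = a then 1 else 0) (?x k)) = ?x a" if "a \<in> S" for a
    proof -
      have "(\<Oplus>k\<in>S. sc (if k = a then 1 else 0) (?x k)) = (\<Oplus>k\<in>S. if a = k then ?x k else \<zero>)"
        by (rule finsum_cong') auto
      also have "\<dots> = ?x a" using that fin by (intro finsum_singleton) auto
      finally show ?thesis .
    qed
    have "\<forall>k\<in>S. (if k = a then 1 else 0 :: qv) = (if k = b then 1 else 0)"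
      by (rule eq) (simp add: delta ab)
    then show "a = b" using ab(1) by (metis zero_neq_one)
  qed
  then show "card (?x ` S) = card S" by (rule card_image)
  have reindex: "(\<Oplus>m\<in>?x ` S. sc (c m) m) = (\<Oplus>b\<in>S. sc (c (?x b)) (?x b))" for c
    by (rule finsum_reindex [OF _ inj]) auto
  have span: "m \<in> lin (?x ` S)" if m: "m \<in> wsp \<mu>" for m
  proof (rule lin_map [of "\<lambda>m. m", OF _ _ _ _ _ wsp_span [OF m]])
    fix x
    assume "x \<in> ?x ` words \<mu>"
    then obtain b where b: "b \<in> words \<mu>" "x = ?x b" by blast
    show "x \<in> lin (?x ` S)"
    proof (cases "b \<in> S")
      case True
      then show ?thesis using b by (auto intro: lin_base)
    next
      case False
      obtain c where c: "\<forall>a\<in>words \<mu>. (\<Sum>k\<in>insert b S. c k * EF_matrix D e w hw a k) = 0" "\<exists>k\<in>insert b S. c k \<noteq> 0"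
        using max [OF b(1) False] unfolding indep_cols_def by blast
      let ?m = "\<Oplus>k\<in>S. sc (c k) (?x k)"
      have M: "?m \<in> carrier M" by (rule finsum_closed) auto
      have "insert b S \<subseteq> words \<mu>" using SW b by blast
      from combination_eq_0_iff [OF this, of c] c(1) have 0: "sc (c b) (?x b) \<oplus> ?m = \<zero>"
        using fin False by (simp add: Pi_def)
      have cb: "c b \<noteq> 0"
      proof
        assume "c b = 0"
        then have "\<forall>k\<in>S. c k = 0" using 0 M by (intro zero) simp
        then show False using c(2) \<open>c b = 0\<close> by auto
      qed
      have "?m \<in> lin (?x ` S)"
      proof -
        have "(\<Oplus>k\<in>A. sc (c k) (?x k)) \<in> lin (?x ` S)" if "A \<subseteq> S" for A
          using finite_subset [OF that fin] that
        proof (induction A rule: finite_induct)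
          case (insert k A)
          then show ?case by (auto simp: Pi_def intro: lin.step)
        qed (simp add: lin.zero)
        then show ?thesis by blast
      qed
      moreover have "?x b = sc (- inverse (c b)) ?m"
      proof -
        have "sc (c b) (?x b) = \<ominus> ?m" using 0 M by (simp add: minus_equality)
        then have "sc (inverse (c b)) (sc (c b) (?x b)) = sc (inverse (c b)) (\<ominus> ?m)" by simp
        then show ?thesis using cb M by (simp add: sc_minus sc_neg flip: sc_simps(4))
      qed
      ultimately show ?thesis unfolding b by (auto intro!: lin_sc)
    qed
  qed (auto simp: add_hom_def)
  show "unique_coords (wsp \<mu>) (?x ` S)" unfolding unique_coords_def
  proof (intro conjI ballI)
    show "finite (?x ` S)" using fin by simp
    show "?x ` S \<subseteq> wsp \<mu>" using SW Fw_wsp [OF hv(1)] by (force simp: words_def)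
    fix m
    assume "m \<in> wsp \<mu>"
    then obtain c where c: "m = (\<Oplus>b\<in>S. sc (c b) (?x b))"
      using lin_family [OF span fin] by auto
    define d where "d = (\<lambda>z\<in>?x ` S. c (the_inv_into S ?x z))"
    have d: "m = (\<Oplus>z\<in>?x ` S. sc (d z) z)"
      unfolding reindex c by (rule finsum_cong') (auto simp: d_def the_inv_into_f_f [OF inj])
    show "\<exists>!c. c \<in> ?x ` S \<rightarrow>\<^sub>E UNIV \<and> m = (\<Oplus>z\<in>?x ` S. sc (c z) z)"
    proof (rule ex1I [of _ d])
      show "d \<in> ?x ` S \<rightarrow>\<^sub>E UNIV \<and> m = (\<Oplus>z\<in>?x ` S. sc (d z) z)" using d by (simp add: d_def)
      fix d'
      assume d': "d' \<in> ?x ` S \<rightarrow>\<^sub>E UNIV \<and> m = (\<Oplus>z\<in>?x ` S. sc (d' z) z)"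
      have "\<forall>b\<in>S. d' (?x b) = d (?x b)" by (rule eq) (use d d' in \<open>simp add: reindex\<close>)
      then show "d' = d" using d' by (auto simp: d_def PiE_iff extensional_def fun_eq_iff)
    qed
  qed
qed

end


definition U_free_act ::
    "('i :: finite, 'y :: ab_group_add, 'x :: ab_group_add) root_datum \<Rightarrow> int \<Rightarrow>
     (('i, 'y) U_elt, 'm) module \<Rightarrow> ('i, 'y) freeU \<Rightarrow> 'm \<Rightarrow> 'm"
  where "U_free_act D e M p m = tens (cov_spec e) (U D) 1 (U_class D p) \<odot>\<^bsub>M\<^esub> m"

lemma U_free_act_gen: "U_free_act D e M (fgen x) m = U_at_gen e D x \<odot>\<^bsub>M\<^esub> m"
  by (simp add: U_free_act_def U_at_gen_def)

text \<open>The elements of \<open>U\<close> that preserve \<open>H\<close> contain the generators and are closed under the ring operations.\<close>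

lemma submodule_U_at:
  fixes D :: "('i :: finite, 'y :: ab_group_add, 'x :: ab_group_add) root_datum"
  assumes L: "left_module (U_at e D) M" and H: "H \<subseteq> carrier M" "\<zero>\<^bsub>M\<^esub> \<in> H"
    and add: "\<And>m n. m \<in> H \<Longrightarrow> n \<in> H \<Longrightarrow> m \<oplus>\<^bsub>M\<^esub> n \<in> H"
    and sc: "\<And>c m. m \<in> H \<Longrightarrow> scal_act (U_at e D) M c m \<in> H"
    and gen: "\<And>x m. m \<in> H \<Longrightarrow> U_at_gen e D x \<odot>\<^bsub>M\<^esub> m \<in> H"
    and minus: "\<And>m. m \<in> H \<Longrightarrow> \<ominus>\<^bsub>M\<^esub> m \<in> H"
  shows "submodule H (U_at e D) M"
proof -
  interpret U: scalar_extension "cov_spec e" "U D" by (rule scalar_extension_U)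
  interpret A: ring "U_at e D" unfolding U_at_def by (rule U.ring_base)
  have M: "abelian_group M" and act: "action (U_at e D) M (module.smult M)"
    using L by (simp_all add: left_module_iff_action)
  note D = actionD [OF act]
  have "a \<odot>\<^bsub>M\<^esub> m \<in> H" if "a \<in> carrier (U_at e D)" "m \<in> H" for a m
    using generates_U_at that
  proof (induction a arbitrary: m rule: generates_induct)
    case (scal r)
    then show ?case using sc [of m r] by (simp add: scal_act_def)
  next
    case (gen y)
    then show ?case using assms(6) by auto
  next
    case (mult a b)
    then show ?case using H by (simp add: D subset_iff)
  next
    case (diff a b)
    then have "m \<in> carrier M" using H by blast
    then have "(a \<ominus>\<^bsub>U_at e D\<^esub> b) \<odot>\<^bsub>M\<^esub> m = a \<odot>\<^bsub>M\<^esub> m \<oplus>\<^bsub>M\<^esub> \<ominus>\<^bsub>M\<^esub> (b \<odot>\<^bsub>M\<^esub> m)"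
      using diff by (simp add: a_minus_def D action_minus [OF M A.ring_axioms act])
    then show ?case using diff add minus by simp
  qed
  then show ?thesis
    by (intro submodule.intro subgroup.intro submodule_axioms.intro)
      (use H add minus in \<open>auto simp: a_inv_def\<close>)
qed

lemma hw_rep_is_V:
  fixes D :: "('i :: finite, 'y :: ab_group_add, 'x :: ab_group_add) root_datum"
  assumes D: "super_root_datum D" and e: "e * e = 1" and V: "is_V e D l V"
  obtains x where "hw_rep D e V (scal_act (U_at e D) V) (U_free_act D e V) l x"
    "\<And>\<mu>. free_rep.wsp D e (\<lambda>x. x) V (scal_act (U_at e D) V) (U_free_act D e V) \<mu> =
      weight_space D (U_at e D) (U_at_gen e D) qv_v e V \<mu>"
proof -
  have L: "left_module (U_at e D) V" and W: "weight_module D (U_at e D) (U_at_gen e D) qv_v e V"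
    using V by (simp_all add: is_V_def weight_module_def)
  interpret R: covering_rep D e "\<lambda>x. x" V "scal_act (U_at e D) V" "U_free_act D e V"
    using left_module_U_at [OF L e] by (simp only: U_free_act_def [abs_def])
  have wsp: "R.wsp \<mu> = weight_space D (U_at e D) (U_at_gen e D) qv_v e V \<mu>" for \<mu>
    by (simp add: R.wsp_def weight_space_def U_free_act_gen R.w_def)
  obtain x where x: "x \<in> R.wsp l" "x \<noteq> \<zero>\<^bsub>V\<^esub>" "\<And>i. U_at_gen e D (GE i) \<odot>\<^bsub>V\<^esub> x = \<zero>\<^bsub>V\<^esub>"
    using V unfolding wsp is_V_def by blast
  have "hw_rep D e V (scal_act (U_at e D) V) (U_free_act D e V) l x"
  proof unfold_locales
    show "\<exists>!c. (\<forall>l. c l \<in> R.wsp l) \<and> finite {l. c l \<noteq> \<zero>\<^bsub>V\<^esub>} \<and> m = finsum V c {l. c l \<noteq> \<zero>\<^bsub>V\<^esub>}"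
      if "m \<in> carrier V" for m
      using W that by (simp add: weight_module_def wsp)
  next
    fix H
    assume H: "H \<subseteq> carrier V" "\<zero>\<^bsub>V\<^esub> \<in> H" "\<And>m n. m \<in> H \<Longrightarrow> n \<in> H \<Longrightarrow> m \<oplus>\<^bsub>V\<^esub> n \<in> H"
      "\<And>c m. m \<in> H \<Longrightarrow> scal_act (U_at e D) V c m \<in> H"
      "\<And>x m. m \<in> H \<Longrightarrow> U_free_act D e V (fgen x) m \<in> H"
    have "\<ominus>\<^bsub>V\<^esub> m \<in> H" if "m \<in> H" for m
      using H(4) [OF that, of "- 1"] R.sc_neg [of m 1] H(1) that by (simp add: subset_iff)
    then have "submodule H (U_at e D) V"
      using H by (intro submodule_U_at L) (simp_all add: U_free_act_gen)
    then show "H = {\<zero>\<^bsub>V\<^esub>} \<or> H = carrier V"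
      using V by (simp add: is_V_def simple_module_def)
  qed (use x D in \<open>simp_all add: U_free_act_gen\<close>)
  then show ?thesis using that wsp by blast
qed

text \<open>The dimension is defined through an arbitrary choice of basis; all bases have the cardinality of the one
  that is indexed by words.\<close>

lemma char_U_eq_card:
  fixes D :: "('i :: finite, 'y :: ab_group_add, 'x :: ab_group_add) root_datum"
  assumes D: "super_root_datum D" and e: "e * e = 1" and V: "is_V e D l V"
    and sub: "S \<subseteq> {b. l - wt D b = \<mu>}" and ind: "indep_cols (EF_matrix D e qv_v l) {b. l - wt D b = \<mu>} S"
    and max: "\<And>b. l - wt D b = \<mu> \<Longrightarrow> b \<notin> S \<Longrightarrow>
      \<not> indep_cols (EF_matrix D e qv_v l) {b. l - wt D b = \<mu>} (insert b S)"
  shows "char_U e D V \<mu> = enat (card S)"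
proof -
  obtain x where x: "hw_rep D e V (scal_act (U_at e D) V) (U_free_act D e V) l x"
    "\<And>\<mu>. free_rep.wsp D e (\<lambda>x. x) V (scal_act (U_at e D) V) (U_free_act D e V) \<mu> =
      weight_space D (U_at e D) (U_at_gen e D) qv_v e V \<mu>"
    using hw_rep_is_V [OF D e V] by blast
  interpret hw_rep D e V "scal_act (U_at e D) V" "U_free_act D e V" l x by (rule x)
  have fb: "fin_basis (U_at e D) V (wsp \<mu>) = unique_coords (wsp \<mu>)"
    by (simp add: fun_eq_iff fin_basis_def unique_coords_def)
  let ?B = "(\<lambda>b. Fw b x) ` S"
  have B: "unique_coords (wsp \<mu>) ?B" "card ?B = card S"
    using word_basis [unfolded words_def w_eq, OF sub ind] max by simp_all
  define B' where "B' = (SOME B. unique_coords (wsp \<mu>) B)"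
  have B': "unique_coords (wsp \<mu>) B'" unfolding B'_def by (rule someI) (rule B)
  have "card B' = card ?B"
    using unique_coords_card_le [OF B(1) B'] unique_coords_card_le [OF B' B(1)] wsp_carrier by fastforce
  then show ?thesis
    using B unfolding char_U_def character_def vdim_def x(2) [symmetric] fb B'_def [symmetric] by auto
qed

lemma maximal_indep_cols:
  assumes "finite W"
  shows "\<exists>S \<subseteq> W. indep_cols P W S \<and> (\<forall>b \<in> W - S. \<not> indep_cols P W (insert b S))"
proof -
  let ?I = "{S. S \<subseteq> W \<and> indep_cols P W S}"
  have "finite ?I" using assms by simp
  moreover have "{} \<in> ?I" by (simp add: indep_cols_def)
  ultimately have "\<exists>S\<in>?I. \<forall>T\<in>?I. S \<subseteq> T \<longrightarrow> S = T"
    by (intro finite_has_maximal) auto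
  then obtain S where S: "S \<in> ?I" and max: "\<forall>T\<in>?I. S \<subseteq> T \<longrightarrow> S = T" by (rule bexE)
  have "\<not> indep_cols P W (insert b S)" if b: "b \<in> W - S" for b
  proof
    assume "indep_cols P W (insert b S)"
    then have "insert b S \<in> ?I" using S b by simp
    with max have "S = insert b S" by (metis subset_insertI)
    then show False using b by blast
  qed
  then show ?thesis using S by blast
qed

text \<open>The matrices at \<open>\<pi> = 1\<close> and \<open>\<pi> = -1\<close> have the same independent sets of columns, so one maximal set serves
  both modules.\<close>

lemma char_U_sign:
  fixes D :: "('i :: finite, 'y :: ab_group_add, 'x :: ab_group_add) root_datum"
  assumes D: "super_root_datum D" and V: "is_V (- 1) D l V" and V': "is_V 1 D l V'"
  shows "char_U (- 1) D V = char_U 1 D V'"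
proof
  fix \<mu>
  let ?W = "{b. l - wt D b = \<mu>}"
  obtain x where "hw_rep D 1 V' (scal_act (U_at 1 D) V') (U_free_act D 1 V') l x"
    using hw_rep_is_V [OF D mult_1 V'] by blast
  then interpret hw_rep D 1 V' "scal_act (U_at 1 D) V'" "U_free_act D 1 V'" l x .
  have "finite ?W" using finite_words [of \<mu>] by (simp add: words_def)
  then obtain S where T: "S \<subseteq> ?W" "indep_cols (EF_matrix D 1 qv_v l) ?W S"
    "\<And>b. b \<in> ?W - S \<Longrightarrow> \<not> indep_cols (EF_matrix D 1 qv_v l) ?W (insert b S)"
    using maximal_indep_cols by metis
  have sign: "indep_cols (EF_matrix D (- 1) qv_v l) ?W T \<longleftrightarrow> indep_cols (EF_matrix D 1 qv_v l) ?W T"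
    if "T \<subseteq> ?W" for T
    by (rule indep_cols_sign [OF D, where \<mu> = \<mu>]) (use that in auto)
  have "char_U (- 1) D V \<mu> = enat (card S)"
  proof (rule char_U_eq_card [OF D _ V T(1)])
    show "indep_cols (EF_matrix D (- 1) qv_v l) ?W S" using T by (simp only: sign)
    show "\<not> indep_cols (EF_matrix D (- 1) qv_v l) ?W (insert b S)" if "l - wt D b = \<mu>" "b \<notin> S" for b
      using T(3) [of b] T(1) that by (subst sign) auto
  qed simp
  also have "\<dots> = char_U 1 D V' \<mu>"
    by (rule char_U_eq_card [OF D mult_1 V' T(1,2), symmetric]) (use T(3) in simp)
  finally show "char_U (- 1) D V \<mu> = char_U 1 D V' \<mu>" .
qed

theorem proposition4p7:
  fixes D :: "('i :: finite, 'y :: ab_group_add, 'x :: ab_group_add) root_datum"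
  assumes "super_root_datum D"
  shows "equivalent_categories
           (Ct 1 D :: ((('i, 'y) Ut_elt, 'm) module, 'm \<Rightarrow> 'm) precat)
           (Ct (- 1) D :: ((('i, 'y) Ut_elt, 'm) module, 'm \<Rightarrow> 'm) precat)
         \<and>
         (\<forall>l \<in> dominant D.
            \<forall>(V :: (('i, 'y) U_elt, 'p) module) (V' :: (('i, 'y) U_elt, 'q) module).
              is_V (- 1) D l V \<and> is_V 1 D l V' \<longrightarrow>
              char_U (- 1) D V = char_U 1 D V')"
  using equivalence_Ct [OF assms] char_U_sign [OF assms] by blast

end
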